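(* Suppose $\psi$ satisfies (A1) and (A2), and that $\mathcal{X}=(x_j)_{j\in\mathbb{Z}}$ is a complete interpolating sequence for $PW_\pi$. Then there are constants $c_1,c_2,c_3,c_4>0$ (independent of $f$) such that for every $f=\sum_{j\in\mathbb{Z}}c_j\psi(\cdot-x_j)\in V(\psi,\mathcal{X})$ with $(c_j)\in\ell_2$, \[ c_1\|(c_j)\|_{\ell_2}\le \|f\|_{L_2(\mathbb{R})}\le c_2\|(c_j)\|_{\ell_2},\qquad c_3\|(f(x_j))\|_{\ell_2}\le\|(c_j)\|_{\ell_2}\le c_4\|(f(x_j))\|_{\ell_2}.\]
   Context: Fourier transform: $\widehat f(\xi)=\frac{1}{\sqrt{2\pi}}\int_{\mathbb{R}}f(x)e^{-i\xi x}\,dx$. $\mathbb{T}=[-\pi,\pi)$. $\|g\|_{W(L_\infty,\ell_1)}:=\sum_{k\in\mathbb{Z}}\|g(\cdot+2\pi k)\|_{L_\infty(\mathbb{T})}$. $PW_\pi=\{f\in L_2(\mathbb{R}):\widehat f=0\text{ a.e. outside }[-\pi,\pi]\}$. A sequence $\mathcal{X}=(x_j)\subset\mathbb{R}$ is a complete interpolating sequence for $PW_\pi$ if for every $(c_j)\in\ell_2$ there is a unique $f\in PW_\pi$ with $f(x_j)=c_j$ for all $j$ (equivalently $(e^{-ix_j\cdot})_j$ is a Riesz basis of $L_2(\mathbb{T})$). $\psi$ satisfies (A1) if $\psi\in L_2(\mathbb{R})$ is positive definite; (A2) if $\widehat\psi\in W(L_\infty,\ell_1)$, $\inf_{\xi\in\mathbb{T}}|\widehat\psi(\xi)|>0$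 and $\sum_{j\neq0}\|\widehat\psi(\cdot+2\pi j)\|_{L_\infty(\mathbb{T})}/\inf_{\xi\in\mathbb{T}}|\widehat\psi(\xi)|<\infty$. $V(\psi,\mathcal{X})$ is the $L_2(\mathbb{R})$-closure of the span of $\{\psi(\cdot-x_j)\}$; every element has the form $\sum_jc_j\psi(\cdot-x_j)$ with $(c_j)\in\ell_2$ (series converging in $L_2$) and is continuous. *)

theory Defs
  imports "HOL-Analysis.Analysis"
begin

definition sq_int :: "(real \<Rightarrow> complex) \<Rightarrow> bool" where
  "sq_int f \<longleftrightarrow> f \<in> borel_measurable lborel \<and> integrable lborel (\<lambda>x. (norm (f x))^2)"

definition L2_norm :: "(real \<Rightarrow> complex) \<Rightarrow> real" where
  "L2_norm f = sqrt (LINT x|lborel. (norm (f x))^2)"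

definition l2_seq :: "(int \<Rightarrow> complex) \<Rightarrow> bool" where
  "l2_seq c \<longleftrightarrow> (\<lambda>j. (norm (c j))^2) summable_on (UNIV :: int set)"

definition l2_norm :: "(int \<Rightarrow> complex) \<Rightarrow> real" where
  "l2_norm c = sqrt (\<Sum>\<^sub>\<infinity>j\<in>(UNIV :: int set). (norm (c j))^2)"

definition fourier_trunc :: "(real \<Rightarrow> complex) \<Rightarrow> real \<Rightarrow> real \<Rightarrow> complex" where
  "fourier_trunc f R \<xi> = of_real (1 / sqrt (2 * pi)) *
     (LINT x:{-R..R}|lborel. f x * exp (- (\<i> * of_real \<xi> * of_real x)))"

text \<open>g is (a representative of) the Plancherel Fourier transform of f in L_2:
  the truncated Fourier integrals converge to g in L_2.\<close>
definition is_fourier_L2 :: "(real \<Rightarrow> complex) \<Rightarrow> (real \<Rightarrow> complex) \<Rightarrow> bool" where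
  "is_fourier_L2 f g \<longleftrightarrow> sq_int f \<and> sq_int g \<and>
     ((\<lambda>R. \<integral>\<^sup>+\<xi>. ennreal ((norm (g \<xi> - fourier_trunc f R \<xi>))^2) \<partial>lborel) \<longlongrightarrow> 0) at_top"

definition torus :: "real set" where
  "torus = {-pi..<pi}"

definition amalgam_sup :: "(real \<Rightarrow> complex) \<Rightarrow> int \<Rightarrow> real" where
  "amalgam_sup g k = (SUP \<xi>\<in>torus. norm (g (\<xi> + 2 * pi * of_int k)))"

definition in_amalgam :: "(real \<Rightarrow> complex) \<Rightarrow> bool" where
  "in_amalgam g \<longleftrightarrow> (\<forall>k::int. bdd_above ((\<lambda>\<xi>. norm (g (\<xi> + 2 * pi * of_int k))) ` torus))
      \<and> (amalgam_sup g) summable_on (UNIV :: int set)"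

definition positive_definite :: "(real \<Rightarrow> complex) \<Rightarrow> bool" where
  "positive_definite \<psi> \<longleftrightarrow> (\<forall>(n::nat) (y::nat \<Rightarrow> real) (a::nat \<Rightarrow> complex).
      (\<Sum>j<n. \<Sum>k<n. a j * cnj (a k) * \<psi> (y j - y k)) \<in> \<real> \<and>
      Re (\<Sum>j<n. \<Sum>k<n. a j * cnj (a k) * \<psi> (y j - y k)) \<ge> 0)"

definition cond_A1 :: "(real \<Rightarrow> complex) \<Rightarrow> bool" where
  "cond_A1 \<psi> \<longleftrightarrow> sq_int \<psi> \<and> positive_definite \<psi>"

definition cond_A2 :: "(real \<Rightarrow> complex) \<Rightarrow> bool" where
  "cond_A2 \<psi> \<longleftrightarrow> (\<exists>g. is_fourier_L2 \<psi> g \<and> in_amalgam g \<and>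
      (INF \<xi>\<in>torus. norm (g \<xi>)) > 0 \<and>
      (\<lambda>k. amalgam_sup g k / (INF \<xi>\<in>torus. norm (g \<xi>))) summable_on (UNIV - {0::int}))"

text \<open>Paley-Wiener space, elements taken as their continuous representatives.\<close>
definition PW_pi :: "(real \<Rightarrow> complex) \<Rightarrow> bool" where
  "PW_pi f \<longleftrightarrow> continuous_on UNIV f \<and>
     (\<exists>g. is_fourier_L2 f g \<and> (AE \<xi> in lborel. \<xi> \<notin> {-pi..pi} \<longrightarrow> g \<xi> = 0))"

definition complete_interpolating :: "(int \<Rightarrow> real) \<Rightarrow> bool" where
  "complete_interpolating x \<longleftrightarrow>
     (\<forall>c. l2_seq c \<longrightarrow> (\<exists>!f. PW_pi f \<and> (\<forall>j. f (x j) = c j)))"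

text \<open>f = sum_j c_j psi(. - x_j) in V(psi, X): (c_j) in l_2, the series converges in L_2
  to f, and f is the continuous representative.\<close>
definition in_V_repr :: "(real \<Rightarrow> complex) \<Rightarrow> (int \<Rightarrow> real) \<Rightarrow> (int \<Rightarrow> complex) \<Rightarrow> (real \<Rightarrow> complex) \<Rightarrow> bool" where
  "in_V_repr \<psi> x c f \<longleftrightarrow> l2_seq c \<and> continuous_on UNIV f \<and>
     ((\<lambda>N::nat. \<integral>\<^sup>+t. ennreal ((norm (f t - (\<Sum>j\<in>{- int N..int N}. c j * \<psi> (t - x j))))^2) \<partial>lborel)
        \<longlonglongrightarrow> 0)"

end

theory Submission
  imports Defs "HOL-Probability.Probability"
begin

text \<open>On the Fourier side a finite combination \<open>\<Sum> c\<^sub>j \<psi>(\<cdot> - x\<^sub>j)\<close> is \<open>g E\<close>, where \<open>g\<close> is the transform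
  of \<open>\<psi>\<close> and \<open>E\<close> is the exponential sum \<open>\<Sum> c\<^sub>j e\<^bsup>-i x\<^sub>j \<xi>\<^esup>\<close>. Solvability of the interpolation problem
  and the uniform boundedness principle give a lower Riesz bound for \<open>E\<close> on \<open>[-\<pi>, \<pi>]\<close>. Applied to two-term sums it shows that the nodes are separated,
  whence a Bessel bound for \<open>E\<close> on every translate of \<open>[-\<pi>, \<pi>]\<close>, and the amalgam condition turns this
  into \<open>\<integral> |g| |E|\<^sup>2 \<le> K \<parallel>c\<parallel>\<^sup>2\<close>. Positive definiteness enters only through \<open>g \<ge> 0\<close> a.e., so that
  pairing the samples \<open>f(x\<^sub>k)\<close> with \<open>c\<close> yields \<open>\<integral> g |E|\<^sup>2\<close>, which the lower Riesz bound controls from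
  below. The little Plancherel theory that is needed comes from Gaussian regularisation.\<close>

section \<open>Square-integrable functions\<close>

text \<open>\<open>is_fourier_L2\<close> fixes a transform only as an L2 limit, and
  \<open>\<psi>\<close> may be discontinuous, whereas the claim concerns point values of f. So facts
  about \<open>g\<close> are extracted by pairing it with integrable, square-integrable test
  functions, and point values are read off with Gaussians shrinking to the point. For the same
  reason a finite sum has two versions. \<open>shift_comb\<close>, built from \<open>\<psi>\<close>
  itself, converges to f in L2 and gives the lower L2 bound, by duality and the contraction property
  of \<open>FT\<close>. \<open>cont_comb\<close>, the inverse transform of \<open>g E\<close>,
  converges to f at every point and gives both sample bounds and, by Fatou, the upper L2 bound. Why
  solvability yields a Riesz bound: if f interpolates c and has transform h, then the sum of a_j c_j
  is, up to normalisation, an inner product of h with an exponential sum whose coefficients have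
  moduli |a_j|. For each fixed c it is thus at most a constant times the norm of that sum, and
  uniform boundedness removes the dependence on c.\<close>

lemma measurable_cis [measurable]: "cis \<in> borel_measurable borel"
  by (intro borel_measurable_continuous_onI continuous_intros)

lemma measurable_cnj [measurable]: "cnj \<in> borel_measurable borel"
  by (intro borel_measurable_continuous_onI continuous_intros)

text \<open>Phrased with upper bounds \<open>a\<close>, \<open>b\<close> on extended integrals, so
  that it can establish integrability instead of presupposing it.\<close>

lemma nn_integral_Cauchy_Schwarz_bound:
  fixes f g :: "'a \<Rightarrow> complex"
  assumes [measurable]: "f \<in> borel_measurable M" "g \<in> borel_measurable M"
    and f: "(\<integral>\<^sup>+x. ennreal ((norm (f x))^2) \<partial>M) \<le> ennreal (a^2)"
    and g: "(\<integral>\<^sup>+x. ennreal ((norm (g x))^2) \<partial>M) \<le> ennreal (b^2)"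
    and ab: "0 \<le> a" "0 \<le> b"
  shows "(\<integral>\<^sup>+x. ennreal (norm (f x) * norm (g x)) \<partial>M) \<le> ennreal (a * b)"
proof -
  let ?I = "\<integral>\<^sup>+x. ennreal (norm (f x) * norm (g x)) \<partial>M"
  have "?I\<^sup>2 = (\<integral>\<^sup>+x. ennreal (norm (f x)) * ennreal (norm (g x)) \<partial>M)\<^sup>2"
    by (simp add: ennreal_mult)
  also have "\<dots> \<le> (\<integral>\<^sup>+x. ennreal (norm (f x))^2 \<partial>M) * (\<integral>\<^sup>+x. ennreal (norm (g x))^2 \<partial>M)"
    by (rule Cauchy_Schwarz_nn_integral) auto
  also have "\<dots> \<le> ennreal (a^2) * ennreal (b^2)"
    using f g by (intro mult_mono) (auto simp: ennreal_power)
  also have "\<dots> = (ennreal (a * b))\<^sup>2"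
    using ab by (simp add: ennreal_power ennreal_mult power_mult_distrib)
  finally have sq: "?I\<^sup>2 \<le> (ennreal (a * b))\<^sup>2" .
  show ?thesis
  proof (cases ?I)
    case (real r)
    then show ?thesis using sq ab
      by (simp add: ennreal_power ennreal_le_iff power2_le_iff_abs_le)
  next
    case top
    then show ?thesis using sq by (auto simp: ennreal_power top_unique power_eq_top_ennreal)
  qed
qed

lemma integrable_bound_norm:
  fixes f :: "'a \<Rightarrow> complex"
  assumes "f \<in> borel_measurable M" "(\<integral>\<^sup>+x. ennreal (norm (f x)) \<partial>M) \<le> ennreal a" "0 \<le> a"
  shows "integrable M f" "norm (integral\<^sup>L M f) \<le> a"
proof -
  show 1: "integrable M f"
    using assms(1,2) by (intro integrableI_bounded) (auto simp: le_less_trans)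
  have "ennreal (norm (integral\<^sup>L M f)) \<le> ennreal a"
    using integral_norm_bound_ennreal[OF 1] assms(2) by (rule order_trans)
  then show "norm (integral\<^sup>L M f) \<le> a"
    using assms(3) by (simp add: ennreal_le_iff)
qed

lemma L2_norm_nonneg [simp]: "0 \<le> L2_norm f"
  by (simp add: L2_norm_def)

lemma sq_int_measurable: "sq_int f \<Longrightarrow> f \<in> borel_measurable borel"
  by (simp add: sq_int_def)

lemma L2_norm_square: "(L2_norm f)^2 = (LINT x|lborel. (norm (f x))^2)"
  unfolding L2_norm_def by (subst real_sqrt_pow2) auto

lemma nn_integral_sq_int:
  assumes "sq_int f"
  shows "(\<integral>\<^sup>+x. ennreal ((norm (f x))^2) \<partial>lborel) = ennreal ((L2_norm f)^2)"
  unfolding L2_norm_square using assms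
  by (intro nn_integral_eq_integral) (auto simp: sq_int_def)

lemma sq_int_bound:
  assumes [measurable]: "f \<in> borel_measurable borel"
    and f: "(\<integral>\<^sup>+x. ennreal ((norm (f x))^2) \<partial>lborel) \<le> ennreal (a^2)" and a: "0 \<le> a"
  shows "sq_int f" "L2_norm f \<le> a"
proof -
  show 1: "sq_int f"
    unfolding sq_int_def using f
    by (auto intro!: integrableI_bounded simp: le_less_trans)
  from f have "(L2_norm f)^2 \<le> a^2"
    by (simp add: nn_integral_sq_int[OF 1] ennreal_le_iff)
  then show "L2_norm f \<le> a"
    using a by (simp add: power2_le_iff_abs_le)
qed

lemma sq_int_mult:
  assumes f: "sq_int f" and g: "sq_int g"
  shows "integrable lborel (\<lambda>x. f x * g x)"
    and "norm (LINT x|lborel. f x * g x) \<le> L2_norm f * L2_norm g"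
proof -
  note [measurable] = sq_int_measurable[OF f] sq_int_measurable[OF g]
  have *: "(\<integral>\<^sup>+x. ennreal (norm (f x * g x)) \<partial>lborel) \<le> ennreal (L2_norm f * L2_norm g)"
    unfolding norm_mult
    by (rule nn_integral_Cauchy_Schwarz_bound) (auto simp: nn_integral_sq_int f g)
  show "integrable lborel (\<lambda>x. f x * g x)"
    "norm (LINT x|lborel. f x * g x) \<le> L2_norm f * L2_norm g"
    by (rule integrable_bound_norm[OF _ *]; simp)+
qed

lemma sq_int_mult_bounded:
  assumes f: "sq_int f" and [measurable]: "h \<in> borel_measurable borel" and h: "\<And>x. norm (h x) \<le> C"
  shows "sq_int (\<lambda>x. f x * h x)"
  unfolding sq_int_def
proof
  note [measurable] = sq_int_measurable[OF f]
  show "(\<lambda>x. f x * h x) \<in> borel_measurable lborel" by measurable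
  have "0 \<le> C" using h[of 0] norm_ge_zero order_trans by blast
  show "integrable lborel (\<lambda>x. (cmod (f x * h x))\<^sup>2)"
  proof (rule Bochner_Integration.integrable_bound)
    show "integrable lborel (\<lambda>x. C^2 * (cmod (f x))\<^sup>2)"
      using f by (auto simp: sq_int_def)
    show "AE x in lborel. norm ((cmod (f x * h x))\<^sup>2) \<le> norm (C\<^sup>2 * (cmod (f x))\<^sup>2)"
      using h \<open>0 \<le> C\<close>
      by (simp add: norm_mult power_mult_distrib)
         (subst mult.commute, intro always_eventually allI mult_right_mono power_mono; simp)
  qed measurable
qed

lemma sq_int_add_diff:
  assumes f: "sq_int f" and g: "sq_int g"
  shows "sq_int (\<lambda>x. f x + g x)" "sq_int (\<lambda>x. f x - g x)"
proof -
  note [measurable] = sq_int_measurable[OF f] sq_int_measurable[OF g]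
  have b: "integrable lborel (\<lambda>x. 2 * (cmod (f x))\<^sup>2 + 2 * (cmod (g x))\<^sup>2)"
    using f g by (auto simp: sq_int_def)
  have *: "(norm (a + b))^2 \<le> 2 * (norm a)^2 + 2 * (norm b)^2" for a b :: complex
  proof -
    have "(norm (a + b))^2 \<le> (norm a + norm b)^2"
      by (intro power_mono norm_triangle_ineq) auto
    also have "\<dots> \<le> 2 * (norm a)^2 + 2 * (norm b)^2"
      using sum_squares_bound[of "norm a" "norm b"] by (simp add: power2_sum)
    finally show ?thesis .
  qed
  have **: "(norm (a - b))^2 \<le> 2 * (norm a)^2 + 2 * (norm b)^2" for a b :: complex
    using *[of a "-b"] by simp
  show "sq_int (\<lambda>x. f x + g x)" "sq_int (\<lambda>x. f x - g x)"
    unfolding sq_int_def using * ** by (auto intro!: Bochner_Integration.integrable_bound[OF b])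
qed

lemma sq_int_sum:
  assumes "finite F" "\<And>i. i \<in> F \<Longrightarrow> sq_int (f i)"
  shows "sq_int (\<lambda>x. \<Sum>i\<in>F. f i x)"
  using assms
  by (induction F rule: finite_induct)
     (auto intro!: sq_int_add_diff, simp add: sq_int_def)

text \<open>With h = f + g, the square of the norm of h is the pairing of f with
  \<open>cnj h\<close> plus that of g with \<open>cnj h\<close>. Cauchy-Schwarz bounds both, and one
  factor \<open>L2_norm h\<close> cancels.\<close>

lemma L2_norm_triangle:
  assumes f: "sq_int f" and g: "sq_int g"
  shows "L2_norm (\<lambda>x. f x + g x) \<le> L2_norm f + L2_norm g"
proof -
  let ?h = "\<lambda>x. f x + g x"
  note [measurable] = sq_int_measurable[OF f] sq_int_measurable[OF g]
  have h: "sq_int ?h" by (rule sq_int_add_diff[OF f g])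
  have c: "sq_int (\<lambda>x. cnj (?h x))" "L2_norm (\<lambda>x. cnj (?h x)) = L2_norm ?h"
    using h by (auto simp: sq_int_def L2_norm_def simp flip: complex_cnj_add)
  have "complex_of_real ((L2_norm ?h)^2) = (LINT x|lborel. complex_of_real ((norm (?h x))^2))"
    unfolding L2_norm_square by (rule integral_complex_of_real[symmetric])
  also have "\<dots> = (LINT x|lborel. f x * cnj (?h x) + g x * cnj (?h x))"
    by (simp only: complex_norm_square distrib_right)
  also have "\<dots> = (LINT x|lborel. f x * cnj (?h x)) + (LINT x|lborel. g x * cnj (?h x))"
    by (intro Bochner_Integration.integral_add sq_int_mult f g c)
  finally have "(L2_norm ?h)^2 = norm ((LINT x|lborel. f x * cnj (?h x)) + (LINT x|lborel. g x * cnj (?h x)))"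
    by (metis abs_of_nonneg norm_of_real zero_le_power2)
  also have "\<dots> \<le> L2_norm f * L2_norm ?h + L2_norm g * L2_norm ?h"
    using sq_int_mult(2)[OF f c(1)] sq_int_mult(2)[OF g c(1)] c(2)
    by (intro norm_triangle_le add_mono) auto
  finally have "L2_norm ?h * L2_norm ?h \<le> (L2_norm f + L2_norm g) * L2_norm ?h"
    by (simp add: power2_eq_square algebra_simps)
  then show ?thesis
    by (cases "L2_norm ?h = 0") (auto simp: less_le intro: mult_right_le_imp_le[of _ "L2_norm ?h"])
qed

section \<open>Gaussian regularisation and the Fourier transform\<close>

text \<open>Same normalisation as \<open>fourier_trunc\<close>, which is \<open>FT\<close> of a
  function cut off to an interval. The inverse transform is therefore \<open>FT\<close> at the
  reflected point.\<close>

definition FT :: "(real \<Rightarrow> complex) \<Rightarrow> real \<Rightarrow> complex" where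
  "FT \<phi> x = of_real (1 / sqrt (2 * pi)) * (LINT \<xi>|lborel. \<phi> \<xi> * cis (- (x * \<xi>)))"

text \<open>A damping factor that tends to 1 as e tends to 0; its transform is a multiple of the
  normal density of standard deviation e, which concentrates at 0.\<close>

definition gauss :: "real \<Rightarrow> real \<Rightarrow> real" where
  "gauss e \<xi> = exp (- ((e * \<xi>)^2) / 2)"

lemma gauss_measurable [measurable]: "gauss e \<in> borel_measurable borel"
  unfolding gauss_def by measurable

lemma gauss_bounds: "0 < gauss e \<xi>" "gauss e \<xi> \<le> 1"
  by (auto simp: gauss_def)

lemma gauss_eq_density: "0 < e \<Longrightarrow> gauss e \<xi> = sqrt (2 * pi) / e * normal_density 0 (1/e) \<xi>"
  by (simp add: gauss_def normal_density_def real_sqrt_divide field_simps)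

text \<open>This is the characteristic function of the standard normal distribution.\<close>

lemma gauss_FT_std: "(LINT \<xi>|lborel. complex_of_real (std_normal_density \<xi>) * cis (t * \<xi>)) = complex_of_real (exp (- (t^2) / 2))"
proof -
  have "char std_normal_distribution t = (LINT \<xi>|lborel. std_normal_density \<xi> *\<^sub>R iexp (t * \<xi>))"
    unfolding char_def by (subst integral_density) auto
  then show ?thesis
    by (simp add: char_std_normal_distribution cis_conv_exp scaleR_conv_of_real mult.commute flip: exp_of_real)
qed

lemma integrable_gauss: "0 < e \<Longrightarrow> integrable lborel (gauss e)"
  using integrable_mult_right[OF integrable_normal_density[of "1/e" 0], of "sqrt (2*pi) / e"]
  by (simp add: gauss_eq_density cong: Bochner_Integration.integrable_cong)

lemma gauss_FT:
  assumes e: "0 < e"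
  shows "(LINT \<xi>|lborel. complex_of_real (gauss e \<xi>) * cis (u * \<xi>)) = of_real (2 * pi * normal_density 0 e u)"
proof -
  have "(LINT \<xi>|lborel. complex_of_real (gauss e \<xi>) * cis (u * \<xi>))
    = \<bar>1/e\<bar> *\<^sub>R (LINT \<xi>|lborel. complex_of_real (gauss e (0 + 1/e * \<xi>)) * cis (u * (0 + 1/e * \<xi>)))"
    using e by (intro lborel_integral_real_affine) auto
  also have "(LINT \<xi>|lborel. complex_of_real (gauss e (0 + 1/e * \<xi>)) * cis (u * (0 + 1/e * \<xi>)))
      = (LINT \<xi>|lborel. of_real (sqrt (2 * pi)) * (complex_of_real (std_normal_density \<xi>) * cis (u/e * \<xi>)))"
    using e by (intro Bochner_Integration.integral_cong) (auto simp: gauss_def std_normal_density_def simp flip: of_real_mult)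
  also have "\<dots> = of_real (sqrt (2 * pi)) * complex_of_real (exp (- ((u/e)^2) / 2))"
    by (subst integral_mult_right_zero) (simp only: gauss_FT_std)
  finally have "(LINT \<xi>|lborel. complex_of_real (gauss e \<xi>) * cis (u * \<xi>))
      = of_real (1 / e * (sqrt (2 * pi) * exp (- ((u/e)^2) / 2)))"
    using e by (simp add: scaleR_conv_of_real del: of_real_exp)
  also have "1 / e * (sqrt (2 * pi) * exp (- ((u/e)^2) / 2)) = 2 * pi * normal_density 0 e u"
  proof -
    define s where "s = sqrt (2 * pi)"
    have s: "0 < s" "2 * pi = s * s" by (auto simp: s_def)
    have "sqrt (2 * pi * e\<^sup>2) = s * e"
      using e by (simp add: real_sqrt_mult s_def)
    then have "2 * pi * normal_density 0 e u = (s * s) * (1 / (s * e) * exp (- ((u/e)^2) / 2))"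
      unfolding normal_density_def s(2)[symmetric] by (simp add: power_divide mult.commute)
    then show ?thesis
      using e s(1) by (simp add: s_def[symmetric])
  qed
  finally show ?thesis .
qed

lemma FT_measurable [measurable]: "\<phi> \<in> borel_measurable borel \<Longrightarrow> FT \<phi> \<in> borel_measurable borel"
proof -
  assume [measurable]: "\<phi> \<in> borel_measurable borel"
  show ?thesis unfolding FT_def by measurable
qed

lemma norm_FT_le:
  assumes "integrable lborel \<phi>"
  shows "norm (FT \<phi> x) \<le> (LINT \<xi>|lborel. norm (\<phi> \<xi>)) / sqrt (2 * pi)"
proof -
  have "norm (LINT \<xi>|lborel. \<phi> \<xi> * cis (- (x * \<xi>))) \<le> (LINT \<xi>|lborel. norm (\<phi> \<xi> * cis (- (x * \<xi>))))"
    by (rule integral_norm_bound)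
  then show ?thesis
    by (simp add: FT_def norm_mult norm_divide divide_right_mono)
qed

lemma integrable_cis:
  assumes "integrable lborel (\<phi> :: real \<Rightarrow> complex)"
  shows "integrable lborel (\<lambda>\<xi>. \<phi> \<xi> * cis (u * \<xi>))"
    and "integrable lborel (\<lambda>\<xi>. \<phi> \<xi> * cis (- (u * \<xi>)))"
proof -
  have [measurable]: "\<phi> \<in> borel_measurable borel" using assms by auto
  show "integrable lborel (\<lambda>\<xi>. \<phi> \<xi> * cis (u * \<xi>))"
    "integrable lborel (\<lambda>\<xi>. \<phi> \<xi> * cis (- (u * \<xi>)))"
    using assms by (auto intro!: Bochner_Integration.integrable_bound[OF assms] simp: norm_mult)
qed

lemma integrable_pair_mult:
  fixes f g :: "_ \<Rightarrow> complex"
  assumes "sigma_finite_measure M" "sigma_finite_measure N" "integrable M f" "integrable N g"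
  shows "integrable (M \<Otimes>\<^sub>M N) (\<lambda>(x,y). f x * g y)"
proof -
  interpret M: sigma_finite_measure M by fact
  interpret N: sigma_finite_measure N by fact
  interpret pair_sigma_finite M N ..
  have [measurable]: "f \<in> borel_measurable M" "g \<in> borel_measurable N" using assms by auto
  show ?thesis
    by (rule Fubini_integrable) (use assms in \<open>auto simp: norm_mult\<close>)
qed

section \<open>The Plancherel inequality by Gaussian damping\<close>

lemma normal_density_commute: "normal_density 0 e (x - y) = normal_density 0 e (y - x)"
  by (simp add: normal_density_def power2_commute)

lemma nn_integral_normal_density_shift:
  "0 < e \<Longrightarrow> (\<integral>\<^sup>+y. ennreal (normal_density 0 e (x - y)) \<partial>lborel) = 1"
proof -
  assume e: "0 < e"
  have "(\<integral>\<^sup>+y. ennreal (normal_density 0 e y) \<partial>lborel) = ennreal \<bar>-1\<bar> * (\<integral>\<^sup>+y. ennreal (normal_density 0 e (x + (-1) * y)) \<partial>lborel)"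
    by (rule nn_integral_real_affine) auto
  moreover have "(\<integral>\<^sup>+y. ennreal (normal_density 0 e y) \<partial>lborel) = 1"
    using e by (subst nn_integral_eq_integral) auto
  ultimately show ?thesis by simp
qed

lemma nn_integral_normal_density_shift':
  "0 < e \<Longrightarrow> (\<integral>\<^sup>+y. ennreal (normal_density 0 e (y - x)) \<partial>lborel) = 1"
  by (subst normal_density_commute) (rule nn_integral_normal_density_shift)

text \<open>Schur test: ab is at most (a^2 + b^2)/2, and the kernel has mass 1 in each variable
  separately, so each of the two halves contributes half of the right-hand side.\<close>

lemma nn_integral_gauss_pair_le:
  fixes \<phi> :: "real \<Rightarrow> complex"
  assumes [measurable]: "\<phi> \<in> borel_measurable borel" and e: "0 < e"
  shows "(\<integral>\<^sup>+p. ennreal (norm (\<phi> (fst p)) * norm (\<phi> (snd p)) * normal_density 0 e (fst p - snd p)) \<partial>(lborel \<Otimes>\<^sub>M lborel))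
     \<le> (\<integral>\<^sup>+x. ennreal ((norm (\<phi> x))^2) \<partial>lborel)"
proof -
  let ?S = "\<integral>\<^sup>+x. ennreal ((norm (\<phi> x))^2) \<partial>lborel"
  let ?N = "\<lambda>p. normal_density 0 e (fst p - snd p)"
  have A: "(\<integral>\<^sup>+p. ennreal ((norm (\<phi> (fst p)))^2) * ennreal (?N p) \<partial>(lborel \<Otimes>\<^sub>M lborel)) = ?S"
    by (subst lborel.nn_integral_fst[symmetric])
       (auto simp: nn_integral_cmult nn_integral_normal_density_shift e)
  have B: "(\<integral>\<^sup>+p. ennreal ((norm (\<phi> (snd p)))^2) * ennreal (?N p) \<partial>(lborel \<Otimes>\<^sub>M lborel)) = ?S"
    by (subst lborel_pair.nn_integral_snd[symmetric])
       (auto simp: nn_integral_cmult nn_integral_normal_density_shift' e)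
  have distr: "ennreal (c * ((a + b) * n)) = ennreal c * (ennreal a * ennreal n + ennreal b * ennreal n)"
    if "0 \<le> a" "0 \<le> b" "0 \<le> c" "0 \<le> n" for a b c n
    using that by (simp add: ennreal_mult ennreal_plus distrib_right)
  have "(\<integral>\<^sup>+p. ennreal (norm (\<phi> (fst p)) * norm (\<phi> (snd p)) * ?N p) \<partial>(lborel \<Otimes>\<^sub>M lborel))
     \<le> (\<integral>\<^sup>+p. ennreal (1/2) * (ennreal ((norm (\<phi> (fst p)))^2) * ennreal (?N p) + ennreal ((norm (\<phi> (snd p)))^2) * ennreal (?N p)) \<partial>(lborel \<Otimes>\<^sub>M lborel))"
  proof (rule nn_integral_mono)
    fix p :: "real \<times> real"
    have "norm (\<phi> (fst p)) * norm (\<phi> (snd p)) \<le> 1/2 * ((norm (\<phi> (fst p)))^2 + (norm (\<phi> (snd p)))^2)"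
      using sum_squares_bound[of "norm (\<phi> (fst p))" "norm (\<phi> (snd p))"] by simp
    then have "norm (\<phi> (fst p)) * norm (\<phi> (snd p)) * ?N p \<le> 1/2 * ((norm (\<phi> (fst p)))^2 + (norm (\<phi> (snd p)))^2) * ?N p"
      by (rule mult_right_mono) simp
    then show "ennreal (norm (\<phi> (fst p)) * norm (\<phi> (snd p)) * ?N p)
      \<le> ennreal (1/2) * (ennreal ((norm (\<phi> (fst p)))^2) * ennreal (?N p) + ennreal ((norm (\<phi> (snd p)))^2) * ennreal (?N p))"
      by (subst distr[symmetric]) (auto intro!: ennreal_leI simp: mult.assoc)
  qed
  also have "\<dots> = ennreal (1/2) * (?S + ?S)"
    by (subst nn_integral_cmult, simp, subst nn_integral_add, simp, simp, subst A, subst B, simp)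
  also have "\<dots> = ?S"
  proof -
    have "ennreal (1/2) * ennreal 2 = ennreal 1"
      by (subst ennreal_mult[symmetric]) auto
    moreover have "?S + ?S = ennreal 2 * ?S"
      by (simp add: mult_2)
    ultimately show ?thesis
      by (simp only: mult.assoc[symmetric] ennreal_1 mult_1_left)
  qed
  finally show ?thesis .
qed

text \<open>Write |FT|^2 as a double integral and integrate over x first; the factor 1/(2 pi) from
  the two transforms cancels the 2 pi of \<open>gauss_FT\<close>. The weight \<open>gauss e\<close>
  is what makes the triple integral absolutely convergent, so that Fubini applies.\<close>

lemma FT_gauss_weighted:
  assumes int: "integrable lborel \<phi>" and e: "0 < e"
  shows "(LINT x|lborel. complex_of_real ((norm (FT \<phi> x))^2 * gauss e x)) =
     (LINT p|(lborel \<Otimes>\<^sub>M lborel). \<phi> (fst p) * cnj (\<phi> (snd p)) * of_real (normal_density 0 e (fst p - snd p)))"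
proof -
  have [measurable]: "\<phi> \<in> borel_measurable borel" using int by auto
  let ?P = "lborel \<Otimes>\<^sub>M lborel :: (real \<times> real) measure"
  define K where "K = (\<lambda>p. \<phi> (fst p) * cnj (\<phi> (snd p)))"
  have [measurable]: "K \<in> borel_measurable ?P" unfolding K_def by measurable
  have intc: "integrable lborel (\<lambda>x. cnj (\<phi> x))" using int by simp
  have K: "integrable ?P K"
    using integrable_pair_mult[OF lborel.sigma_finite_measure_axioms lborel.sigma_finite_measure_axioms int intc]
    by (simp add: K_def case_prod_unfold)
  have sfP: "sigma_finite_measure ?P"
    by (rule lborel_pair.P.sigma_finite_measure_axioms)
  interpret Q: pair_sigma_finite "lborel :: real measure" ?P
    by (simp add: pair_sigma_finite_def sfP lborel.sigma_finite_measure_axioms)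
  have sq: "complex_of_real ((norm (FT \<phi> x))^2) = of_real (1 / (2*pi)) * (LINT p|?P. K p * cis (- (x * (fst p - snd p))))" for x
  proof -
    let ?h = "\<lambda>\<xi>. \<phi> \<xi> * cis (- (x * \<xi>))"
    have h: "integrable lborel ?h" using integrable_cis[OF int] by simp
    have hc: "integrable lborel (\<lambda>x. cnj (?h x))" using h by (simp del: complex_cnj_mult)
    have "complex_of_real ((norm (FT \<phi> x))^2) = FT \<phi> x * cnj (FT \<phi> x)"
      by (rule complex_norm_square)
    also have "\<dots> = of_real (1 / (2*pi)) * ((LINT \<xi>|lborel. ?h \<xi>) * (LINT \<xi>|lborel. cnj (?h \<xi>)))"
      by (simp add: FT_def Bochner_Integration.integral_cnj del: complex_cnj_mult)
         (simp add: field_simps flip: of_real_mult, simp)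
    also have "(LINT \<xi>|lborel. ?h \<xi>) * (LINT \<xi>|lborel. cnj (?h \<xi>)) = (LINT a|lborel. LINT b|lborel. ?h a * cnj (?h b))"
      by simp
    also have "\<dots> = (LINT p|?P. ?h (fst p) * cnj (?h (snd p)))"
      using integrable_pair_mult[OF lborel.sigma_finite_measure_axioms lborel.sigma_finite_measure_axioms h hc]
      by (subst lborel_pair.integral_fst) (simp_all add: case_prod_unfold)
    also have "\<dots> = (LINT p|?P. K p * cis (- (x * (fst p - snd p))))"
      by (intro Bochner_Integration.integral_cong refl)
         (simp add: K_def cis_cnj cis_mult algebra_simps)
    finally show ?thesis .
  qed
  have G: "integrable lborel (\<lambda>x. complex_of_real (gauss e x))"
    using integrable_gauss[OF e] by simp
  have I0: "integrable (lborel \<Otimes>\<^sub>M ?P) (\<lambda>(x,p). complex_of_real (gauss e x) * K p)"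
    by (rule integrable_pair_mult[OF lborel.sigma_finite_measure_axioms sfP G K])
  have I: "integrable (lborel \<Otimes>\<^sub>M ?P) (\<lambda>(x,p). complex_of_real (gauss e x) * (K p * cis (- (x * (fst p - snd p)))))"
    by (rule Bochner_Integration.integrable_bound[OF I0]) (auto simp: norm_mult)
  have "(LINT x|lborel. complex_of_real ((norm (FT \<phi> x))^2 * gauss e x))
     = of_real (1 / (2*pi)) * (LINT x|lborel. LINT p|?P. complex_of_real (gauss e x) * (K p * cis (- (x * (fst p - snd p)))))"
    by (subst integral_mult_right_zero[symmetric])
       (intro Bochner_Integration.integral_cong refl, simp only: of_real_mult sq, simp)
  also have "(LINT x|lborel. LINT p|?P. complex_of_real (gauss e x) * (K p * cis (- (x * (fst p - snd p)))))
    = (LINT p|?P. LINT x|lborel. complex_of_real (gauss e x) * (K p * cis (- (x * (fst p - snd p)))))"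
    by (rule Q.Fubini_integral[symmetric]) (use I in auto)
  also have "\<dots> = (LINT p|?P. K p * (LINT x|lborel. complex_of_real (gauss e x) * cis ((snd p - fst p) * x)))"
    by (subst integral_mult_right_zero[symmetric]) (intro Bochner_Integration.integral_cong refl, simp add: algebra_simps)
  also have "\<dots> = (LINT p|?P. of_real (2*pi) * (K p * of_real (normal_density 0 e (fst p - snd p))))"
    by (simp only: gauss_FT[OF e]) (intro Bochner_Integration.integral_cong refl, simp add: normal_density_commute[of e "snd _" "fst _"])
  also have "\<dots> = of_real (2*pi) * (LINT p|?P. K p * of_real (normal_density 0 e (fst p - snd p)))"
    by simp
  finally show ?thesis by (simp add: K_def)
qed

lemma gauss_tendsto: "(\<lambda>n. gauss (1 / real (Suc n)) x) \<longlonglongrightarrow> 1"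
proof -
  have "(\<lambda>n. exp (- ((1 / real (Suc n) * x)^2) / 2)) \<longlonglongrightarrow> exp (- ((0 * x)^2) / 2)"
    by (intro tendsto_intros LIMSEQ_Suc[OF lim_1_over_n, simplified] lim_1_over_n filterlim_compose[OF lim_1_over_n filterlim_Suc]) simp
  then show ?thesis by (simp add: gauss_def)
qed

text \<open>The damped energy is bounded independently of e by the Schur test; Fatou removes the
  damping along e = 1/(n+1).\<close>

lemma nn_integral_FT_le:
  assumes int: "integrable lborel \<phi>"
  shows "(\<integral>\<^sup>+x. ennreal ((norm (FT \<phi> x))^2) \<partial>lborel) \<le> (\<integral>\<^sup>+x. ennreal ((norm (\<phi> x))^2) \<partial>lborel)"
    (is "_ \<le> ?S")
proof -
  have [measurable]: "\<phi> \<in> borel_measurable borel" using int by auto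
  have weighted: "(\<integral>\<^sup>+x. ennreal ((norm (FT \<phi> x))^2 * gauss e x) \<partial>lborel) \<le> ?S" if e: "0 < e" for e
  proof -
    define C where "C = (LINT \<xi>|lborel. norm (\<phi> \<xi>)) / sqrt (2 * pi)"
    have "(norm (FT \<phi> x))^2 * gauss e x \<le> C^2 * gauss e x" for x
      using norm_FT_le[OF int, of x] gauss_bounds[of e x]
      by (intro mult_right_mono power_mono) (auto simp: C_def)
    then have I: "integrable lborel (\<lambda>x. (norm (FT \<phi> x))^2 * gauss e x)"
      using gauss_bounds(1)[of e]
      by (intro Bochner_Integration.integrable_bound[OF integrable_mult_right[OF integrable_gauss[OF e], of "C^2"]])
         (auto simp: less_imp_le abs_mult)
    let ?P = "lborel \<Otimes>\<^sub>M lborel :: (real \<times> real) measure"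
    have "(\<integral>\<^sup>+x. ennreal ((norm (FT \<phi> x))^2 * gauss e x) \<partial>lborel) = ennreal (LINT x|lborel. (norm (FT \<phi> x))^2 * gauss e x)"
      using gauss_bounds(1)[of e] by (intro nn_integral_eq_integral I) (auto simp: less_imp_le)
    also have "(LINT x|lborel. (norm (FT \<phi> x))^2 * gauss e x) \<le> norm (LINT x|lborel. complex_of_real ((norm (FT \<phi> x))^2 * gauss e x))"
      unfolding integral_complex_of_real by (simp only: norm_of_real abs_ge_self)
    also have "ennreal \<dots> = ennreal (norm (LINT p|?P. \<phi> (fst p) * cnj (\<phi> (snd p)) * of_real (normal_density 0 e (fst p - snd p))))"
      by (simp only: FT_gauss_weighted[OF int e])
    also have "\<dots> \<le> (\<integral>\<^sup>+p. ennreal (norm (\<phi> (fst p) * cnj (\<phi> (snd p)) * of_real (normal_density 0 e (fst p - snd p)))) \<partial>?P)"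
    \<comment> \<open>The Bochner integral of a non-integrable function is 0 by convention, so the
      bound holds in either case.\<close>
    proof (cases "integrable ?P (\<lambda>p. \<phi> (fst p) * cnj (\<phi> (snd p)) * of_real (normal_density 0 e (fst p - snd p)))")
      case True
      then show ?thesis by (rule integral_norm_bound_ennreal)
    qed (simp add: not_integrable_integral_eq)
    also have "\<dots> = (\<integral>\<^sup>+p. ennreal (norm (\<phi> (fst p)) * norm (\<phi> (snd p)) * normal_density 0 e (fst p - snd p)) \<partial>?P)"
      by (simp add: norm_mult)
    also have "\<dots> \<le> ?S"
      by (rule nn_integral_gauss_pair_le) (use e in auto)
    finally show ?thesis by (simp add: ennreal_leI)
  qed
  have "(\<integral>\<^sup>+x. ennreal ((norm (FT \<phi> x))^2) \<partial>lborel)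
      = (\<integral>\<^sup>+x. liminf (\<lambda>n. ennreal ((norm (FT \<phi> x))^2 * gauss (1 / real (Suc n)) x)) \<partial>lborel)"
  proof (intro nn_integral_cong)
    fix x
    have "(\<lambda>n. ennreal ((norm (FT \<phi> x))^2 * gauss (1 / real (Suc n)) x)) \<longlonglongrightarrow> ennreal ((norm (FT \<phi> x))^2 * 1)"
      by (intro tendsto_ennrealI tendsto_intros gauss_tendsto)
    then show "ennreal ((norm (FT \<phi> x))^2) = liminf (\<lambda>n. ennreal ((norm (FT \<phi> x))^2 * gauss (1 / real (Suc n)) x))"
      by (simp add: lim_imp_Liminf)
  qed
  also have "\<dots> \<le> liminf (\<lambda>n. \<integral>\<^sup>+x. ennreal ((norm (FT \<phi> x))^2 * gauss (1 / real (Suc n)) x) \<partial>lborel)"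
    by (intro nn_integral_liminf) auto
  also have "\<dots> \<le> liminf (\<lambda>n::nat. ?S)"
    by (intro Liminf_mono always_eventually allI weighted) simp
  also have "\<dots> = ?S" by (simp add: Liminf_const)
  finally show ?thesis .
qed

lemma sq_int_FT:
  assumes "integrable lborel \<phi>" "sq_int \<phi>"
  shows "sq_int (FT \<phi>)" "L2_norm (FT \<phi>) \<le> L2_norm \<phi>"
proof -
  have [measurable]: "\<phi> \<in> borel_measurable borel" using assms by auto
  have "(\<integral>\<^sup>+x. ennreal ((norm (FT \<phi> x))^2) \<partial>lborel) \<le> ennreal ((L2_norm \<phi>)^2)"
    using nn_integral_FT_le[OF assms(1)] by (simp only: nn_integral_sq_int[OF assms(2)])
  then show "sq_int (FT \<phi>)" "L2_norm (FT \<phi>) \<le> L2_norm \<phi>"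
    by (auto intro!: sq_int_bound)
qed

section \<open>The multiplication formula, for integrable functions and then for L2
  transforms\<close>

lemma FT_multiplication:
  assumes f: "integrable lborel f" and h: "integrable lborel h"
  shows "(LINT x|lborel. FT f x * h x) = (LINT x|lborel. f x * FT h x)"
proof -
  have [measurable]: "f \<in> borel_measurable borel" "h \<in> borel_measurable borel" using f h by auto
  have I: "integrable (lborel \<Otimes>\<^sub>M lborel) (\<lambda>(x,\<xi>). f x * (h \<xi> * cis (- (\<xi> * x))))"
    by (rule Bochner_Integration.integrable_bound[OF integrable_pair_mult[OF lborel.sigma_finite_measure_axioms lborel.sigma_finite_measure_axioms f h]])
       (auto simp: norm_mult)
  have "(LINT \<xi>|lborel. FT f \<xi> * h \<xi>) = (LINT \<xi>|lborel. LINT x|lborel. of_real (1 / sqrt (2*pi)) * (f x * (h \<xi> * cis (- (\<xi> * x)))))"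
    unfolding FT_def
    by (intro Bochner_Integration.integral_cong refl)
       (simp only: integral_mult_left_zero[symmetric] integral_mult_right_zero[symmetric] mult_ac)
  also have "\<dots> = of_real (1 / sqrt (2*pi)) * (LINT \<xi>|lborel. LINT x|lborel. f x * (h \<xi> * cis (- (\<xi> * x))))"
    by (simp only: integral_mult_right_zero)
  also have "(LINT \<xi>|lborel. LINT x|lborel. f x * (h \<xi> * cis (- (\<xi> * x)))) = (LINT x|lborel. LINT \<xi>|lborel. f x * (h \<xi> * cis (- (\<xi> * x))))"
    by (rule lborel_pair.Fubini_integral) (use I in auto)
  also have "of_real (1 / sqrt (2*pi)) * \<dots> = (LINT x|lborel. LINT \<xi>|lborel. of_real (1 / sqrt (2*pi)) * (f x * (h \<xi> * cis (- (\<xi> * x)))))"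
    by (simp only: integral_mult_right_zero)
  also have "\<dots> = (LINT x|lborel. f x * FT h x)"
    unfolding FT_def
    by (intro Bochner_Integration.integral_cong refl)
       (simp only: integral_mult_left_zero[symmetric] integral_mult_right_zero[symmetric] mult_ac)
  finally show ?thesis .
qed

text \<open>The only place where the limit in \<open>is_fourier_L2\<close> is opened. Cut-offs
  \<open>fR\<close> of f are integrable, so the multiplication formula holds for them. One side
  converges by the defining L2 limit and Cauchy-Schwarz, the other by dominated convergence.\<close>

lemma is_fourier_L2_pairing:
  assumes fg: "is_fourier_L2 f g" and int: "integrable lborel \<phi>" and sq: "sq_int \<phi>"
  shows "(LINT x|lborel. g x * \<phi> x) = (LINT x|lborel. f x * FT \<phi> x)"
proof (rule LIMSEQ_unique)
  have f: "sq_int f" and g: "sq_int g" using fg by (auto simp: is_fourier_L2_def)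
  note [measurable] = sq_int_measurable[OF f] sq_int_measurable[OF g] sq_int_measurable[OF sq]
  define fR where "fR R x = indicator {-R..R} x * f x" for R x
  have trunc: "fourier_trunc f R = FT (fR R)" for R
    unfolding fourier_trunc_def FT_def fR_def set_lebesgue_integral_def
    by (intro ext arg_cong2[where f="(*)"] refl Bochner_Integration.integral_cong)
       (auto simp: indicator_def cis_conv_exp mult.assoc)
  have ind: "sq_int (\<lambda>x. indicator {-R..R} x)" for R :: real
  proof -
    have "(\<lambda>x. (norm (indicator {-R..R} x :: complex))^2) = indicator {-R..R}"
      by (auto simp: indicator_def fun_eq_iff)
    then show ?thesis
      unfolding sq_int_def by (auto intro!: integrable_real_indicator emeasure_bounded_finite[unfolded infinity_ennreal_def])
  qed
  have fR: "sq_int (fR R)" for R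
    unfolding fR_def using sq_int_mult_bounded[OF f, of "indicator {-R..R}" 1]
    by (simp add: mult.commute indicator_def)
  have fRi: "integrable lborel (fR R)" for R
    unfolding fR_def using sq_int_mult(1)[OF ind f] by simp
  have dsq: "sq_int (\<lambda>\<xi>. g \<xi> - FT (fR R) \<xi>)" for R
    by (intro sq_int_add_diff g sq_int_FT fRi fR)
  have lim0: "((\<lambda>n. ennreal ((L2_norm (\<lambda>\<xi>. g \<xi> - FT (fR (real n)) \<xi>))^2)) \<longlonglongrightarrow> 0)"
    using filterlim_compose[OF conjunct2[OF conjunct2[OF fg[unfolded is_fourier_L2_def]]] filterlim_real_sequentially]
    by (simp add: trunc nn_integral_sq_int[OF dsq])
  then have "(\<lambda>n. (L2_norm (\<lambda>\<xi>. g \<xi> - FT (fR (real n)) \<xi>))^2) \<longlonglongrightarrow> 0"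
    by (simp flip: ennreal_0)
  then have lim: "(\<lambda>n. L2_norm (\<lambda>\<xi>. g \<xi> - FT (fR (real n)) \<xi>)) \<longlonglongrightarrow> 0"
    using tendsto_real_sqrt by fastforce
  have "(\<lambda>n. (LINT x|lborel. g x * \<phi> x) - (LINT x|lborel. FT (fR (real n)) x * \<phi> x)) \<longlonglongrightarrow> 0"
  proof (rule Lim_null_comparison)
    show "\<forall>\<^sub>F n in sequentially. norm ((LINT x|lborel. g x * \<phi> x) - (LINT x|lborel. FT (fR (real n)) x * \<phi> x))
      \<le> L2_norm (\<lambda>\<xi>. g \<xi> - FT (fR (real n)) \<xi>) * L2_norm \<phi>"
    proof (intro always_eventually allI)
      fix n
      have "(LINT x|lborel. g x * \<phi> x) - (LINT x|lborel. FT (fR (real n)) x * \<phi> x) = (LINT x|lborel. (g x - FT (fR (real n)) x) * \<phi> x)"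
        unfolding left_diff_distrib
        by (intro Bochner_Integration.integral_diff[symmetric] sq_int_mult g sq sq_int_FT fRi fR)
      then show "norm ((LINT x|lborel. g x * \<phi> x) - (LINT x|lborel. FT (fR (real n)) x * \<phi> x))
        \<le> L2_norm (\<lambda>\<xi>. g \<xi> - FT (fR (real n)) \<xi>) * L2_norm \<phi>"
        using sq_int_mult(2)[OF dsq sq] by simp
    qed
    show "(\<lambda>n. L2_norm (\<lambda>\<xi>. g \<xi> - FT (fR (real n)) \<xi>) * L2_norm \<phi>) \<longlonglongrightarrow> 0"
      using tendsto_mult_left_zero[OF lim] .
  qed
  from tendsto_diff[OF tendsto_const[of "LINT x|lborel. g x * \<phi> x"] this]
  show "(\<lambda>n. (LINT x|lborel. FT (fR (real n)) x * \<phi> x)) \<longlonglongrightarrow> (LINT x|lborel. g x * \<phi> x)"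
    by simp
  have "(\<lambda>n. (LINT x|lborel. fR (real n) x * FT \<phi> x)) \<longlonglongrightarrow> (LINT x|lborel. f x * FT \<phi> x)"
  proof (rule integral_dominated_convergence[where w="\<lambda>x. norm (f x * FT \<phi> x)"])
    show "integrable lborel (\<lambda>x. cmod (f x * FT \<phi> x))"
      by (intro integrable_norm sq_int_mult f sq_int_FT int sq)
    show "AE x in lborel. (\<lambda>n. fR (real n) x * FT \<phi> x) \<longlonglongrightarrow> f x * FT \<phi> x"
    proof (intro always_eventually allI)
      fix x :: real
      obtain N :: nat where N: "\<bar>x\<bar> \<le> real N" using real_arch_simple by blast
      show "(\<lambda>n. fR (real n) x * FT \<phi> x) \<longlonglongrightarrow> f x * FT \<phi> x"
        by (rule tendsto_eventually)
           (use N in \<open>auto simp: eventually_sequentially fR_def indicator_def intro!: exI[of _ N]\<close>)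
    qed
  qed (auto simp: fR_def norm_mult indicator_def)
  then show "(\<lambda>n. (LINT x|lborel. FT (fR (real n)) x * \<phi> x)) \<longlonglongrightarrow> (LINT x|lborel. f x * FT \<phi> x)"
    by (simp only: FT_multiplication[OF fRi int])
qed

section \<open>Pointwise Fourier inversion\<close>

lemma normal_density_le: "0 < e \<Longrightarrow> normal_density 0 e u \<le> 1 / sqrt (2 * pi * e\<^sup>2)"
  by (simp add: normal_density_def divide_right_mono)

lemma integrable_normal_density_shift: "0 < e \<Longrightarrow> integrable lborel (\<lambda>x. normal_density 0 e (x - a))"
proof -
  assume "0 < e"
  then have "integrable lborel (normal_density a e)" by auto
  moreover have "(\<lambda>x. normal_density 0 e (x - a)) = normal_density a e"
    by (simp add: normal_density_def fun_eq_iff)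
  ultimately show ?thesis by simp
qed

lemma sq_int_of_bounded:
  fixes h :: "real \<Rightarrow> complex"
  assumes h: "integrable lborel h" and C: "\<And>x. norm (h x) \<le> C"
  shows "sq_int h"
  unfolding sq_int_def
proof
  have [measurable]: "h \<in> borel_measurable borel" using h by auto
  show "h \<in> borel_measurable lborel" by measurable
  show "integrable lborel (\<lambda>x. (norm (h x))^2)"
  proof (rule Bochner_Integration.integrable_bound[OF integrable_mult_right[OF integrable_norm[OF h], of C]])
    show "AE x in lborel. norm ((norm (h x))^2) \<le> norm (C * norm (h x))"
      using C by (auto simp: power2_eq_square abs_mult intro!: mult_right_mono order_trans[OF _ abs_ge_self])
  qed measurable
qed

lemma sq_int_normal_density:
  assumes "0 < e"
  shows "sq_int (\<lambda>x. complex_of_real (normal_density 0 e (x - a)))"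
  by (rule sq_int_of_bounded[where C="1 / sqrt (2 * pi * e\<^sup>2)"])
     (use assms normal_density_le integrable_normal_density_shift in \<open>auto simp del: of_real_eq_iff\<close>)

text \<open>An exponential made integrable by Gaussian damping. Its transform is a normal bump
  centred at a, so pairing \<open>g\<close> with it averages f near a.\<close>

definition wave :: "real \<Rightarrow> real \<Rightarrow> real \<Rightarrow> complex" where
  "wave e a \<xi> = of_real (gauss e \<xi>) * cis (a * \<xi>)"

lemma wave_measurable [measurable]: "wave e a \<in> borel_measurable borel"
  unfolding wave_def by measurable

lemma norm_wave: "norm (wave e a \<xi>) = gauss e \<xi>"
  using gauss_bounds(1)[of e \<xi>] by (simp add: wave_def norm_mult)

lemma integrable_wave: "0 < e \<Longrightarrow> integrable lborel (wave e a)"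
  unfolding wave_def by (intro integrable_cis) (simp add: integrable_gauss)

lemma sq_int_wave: "0 < e \<Longrightarrow> sq_int (wave e a)"
  by (rule sq_int_of_bounded[where C=1]) (auto simp: integrable_wave norm_wave gauss_bounds)

lemma FT_wave:
  assumes "0 < e"
  shows "FT (wave e a) x = of_real (sqrt (2 * pi) * normal_density 0 e (x - a))"
proof -
  have "wave e a \<xi> * cis (- (x * \<xi>)) = of_real (gauss e \<xi>) * cis ((a - x) * \<xi>)" for \<xi>
    by (simp add: wave_def mult.assoc cis_mult left_diff_distrib)
  then have "FT (wave e a) x = of_real (1 / sqrt (2 * pi)) * (LINT \<xi>|lborel. of_real (gauss e \<xi>) * cis ((a - x) * \<xi>))"
    unfolding FT_def by (simp only:)
  also have "\<dots> = of_real (1 / sqrt (2 * pi) * (2 * pi * normal_density 0 e (a - x)))"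
    by (simp only: gauss_FT[OF assms] of_real_mult)
  also have "1 / sqrt (2 * pi) * (2 * pi * normal_density 0 e (a - x)) = sqrt (2 * pi) * normal_density 0 e (x - a)"
  proof -
    have "1 / sqrt (2 * pi) * (2 * pi * normal_density 0 e (a - x)) = 2 * pi / sqrt (2 * pi) * normal_density 0 e (x - a)"
      by (simp add: normal_density_commute[of e a x])
    also have "2 * pi / sqrt (2 * pi) = sqrt (2 * pi)"
      by (rule real_div_sqrt) simp
    finally show ?thesis .
  qed
  finally show ?thesis .
qed

lemma is_fourier_L2_gauss:
  assumes "is_fourier_L2 f g" "0 < e"
  shows "(LINT \<xi>|lborel. g \<xi> * wave e a \<xi>) = of_real (sqrt (2 * pi)) * (LINT x|lborel. f x * of_real (normal_density 0 e (x - a)))"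
  unfolding is_fourier_L2_pairing[OF assms(1) integrable_wave[OF assms(2)] sq_int_wave[OF assms(2)]]
  by (subst integral_mult_right_zero[symmetric]) (simp add: FT_wave[OF assms(2)] mult_ac)

text \<open>Substituting x = a + t/(n+1) turns the kernel into the fixed standard normal density;
  continuity at a and the bound C then allow dominated convergence.\<close>

lemma approx_identity_bounded:
  fixes h :: "real \<Rightarrow> complex"
  assumes [measurable]: "h \<in> borel_measurable borel" and C: "\<And>x. norm (h x) \<le> C" and cont: "isCont h a"
  shows "(\<lambda>n. LINT x|lborel. h x * of_real (normal_density 0 (1 / real (Suc n)) (x - a))) \<longlonglongrightarrow> h a"
proof -
  have eq: "(LINT x|lborel. h x * of_real (normal_density 0 (1 / real (Suc n)) (x - a)))
     = (LINT t|lborel. h (a + 1 / real (Suc n) * t) * of_real (std_normal_density t))" for n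
  proof -
    have nd: "1 / real (Suc n) * normal_density 0 (1 / real (Suc n)) (1 / real (Suc n) * t) = std_normal_density t" for t
    proof -
      have "1 / k * normal_density 0 (1 / k) (1 / k * t) = std_normal_density t" if "0 < k" for k :: real
        using that by (simp add: normal_density_def real_sqrt_divide field_simps)
      then show ?thesis by (metis of_nat_0_less_iff zero_less_Suc)
    qed
    have "(LINT x|lborel. h x * of_real (normal_density 0 (1 / real (Suc n)) (x - a)))
       = \<bar>1 / real (Suc n)\<bar> *\<^sub>R (LINT t|lborel. h (a + 1 / real (Suc n) * t) * of_real (normal_density 0 (1 / real (Suc n)) (a + 1 / real (Suc n) * t - a)))"
      by (rule lborel_integral_real_affine) simp
    also have "\<dots> = (LINT t|lborel. \<bar>1 / real (Suc n)\<bar> *\<^sub>R (h (a + 1 / real (Suc n) * t) * of_real (normal_density 0 (1 / real (Suc n)) (a + 1 / real (Suc n) * t - a))))"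
      by (rule integral_scaleR_right[symmetric]) 
    also have "\<dots> = (LINT t|lborel. h (a + 1 / real (Suc n) * t) * of_real (std_normal_density t))"
      by (intro Bochner_Integration.integral_cong refl)
         (simp only: scaleR_conv_of_real nd[symmetric] of_real_mult add_diff_cancel_left' mult_ac abs_of_nonneg of_nat_0_le_iff zero_le_divide_1_iff)
    finally show ?thesis .
  qed
  have "(\<lambda>n. LINT t|lborel. h (a + 1 / real (Suc n) * t) * of_real (std_normal_density t)) \<longlonglongrightarrow> (LINT t|lborel. h a * of_real (std_normal_density t))"
  proof (rule integral_dominated_convergence[where w="\<lambda>t. C * std_normal_density t"])
    show "AE t in lborel. (\<lambda>n. h (a + 1 / real (Suc n) * t) * of_real (std_normal_density t)) \<longlonglongrightarrow> h a * of_real (std_normal_density t)"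
    proof (intro always_eventually allI tendsto_mult tendsto_const)
      fix t
      have "(\<lambda>n. a + 1 / real (Suc n) * t) \<longlonglongrightarrow> a + 0 * t"
        by (intro tendsto_intros filterlim_compose[OF lim_1_over_n filterlim_Suc])
      then show "(\<lambda>n. h (a + 1 / real (Suc n) * t)) \<longlonglongrightarrow> h a"
        using isCont_tendsto_compose[OF cont] by simp
    qed
    show "AE t in lborel. norm (h (a + 1 / real (Suc n) * t) * of_real (std_normal_density t)) \<le> C * std_normal_density t" for n
      using C by (auto simp: norm_mult intro!: mult_right_mono)
  qed auto
  moreover have "(LINT t|lborel. h a * of_real (std_normal_density t)) = h a"
    by (subst integral_mult_right_zero) simp
  ultimately show ?thesis by (simp only: eq)
qed

text \<open>A square-integrable f can be unbounded away from a. Near a it is bounded by continuity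
  and the previous lemma applies; far from a the kernels decay geometrically relative to the kernel
  of width 1.\<close>

lemma approx_identity:
  assumes f: "sq_int f" and cont: "isCont f a"
  shows "(\<lambda>n. LINT x|lborel. f x * of_real (normal_density 0 (1 / real (Suc n)) (x - a))) \<longlonglongrightarrow> f a"
proof -
  note [measurable] = sq_int_measurable[OF f]
  let ?N = "\<lambda>n x. normal_density 0 (1 / real (Suc n)) (x - a)"
  obtain d where d0: "0 < d" "\<And>x. x \<noteq> a \<and> norm (x - a) < d \<Longrightarrow> norm (f x - f a) < 1"
    using cont[unfolded isCont_def LIM_eq, rule_format, of 1] by auto
  have d: "0 < d" "norm (f x - f a) < 1" if "\<bar>x - a\<bar> < d" for x
    using d0(1) d0(2)[of x] that by (cases "x = a"; simp)+
  note d = d0(1) d(2)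
  define f1 where "f1 x = f x * indicator {x. \<bar>x - a\<bar> < d} x" for x
  define f2 where "f2 x = f x * indicator {x. d \<le> \<bar>x - a\<bar>} x" for x
  have [measurable]: "f1 \<in> borel_measurable borel" "f2 \<in> borel_measurable borel"
    unfolding f1_def f2_def by measurable
  have sum: "f x = f1 x + f2 x" for x by (auto simp: f1_def f2_def indicator_def)
  have sq1: "sq_int f1" unfolding f1_def by (rule sq_int_mult_bounded[OF f, where C=1]) (auto simp: indicator_def)
  have sq2: "sq_int f2" unfolding f2_def by (rule sq_int_mult_bounded[OF f, where C=1]) (auto simp: indicator_def)
  have near: "(\<lambda>n. LINT x|lborel. f1 x * of_real (?N n x)) \<longlonglongrightarrow> f1 a"
  proof (rule approx_identity_bounded[where C="norm (f a) + 1"])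
    show "norm (f1 x) \<le> norm (f a) + 1" for x
      using d(2)[of x] norm_triangle_sub[of "f x" "f a"] by (auto simp: f1_def indicator_def)
    have "\<forall>\<^sub>F x in nhds a. f1 x = f x"
      using eventually_nhds_metric d(1) by (auto simp: f1_def indicator_def dist_real_def eventually_nhds_metric)
    then show "isCont f1 a"
      using cont isCont_cong by blast
  qed measurable
  define K where "K = (LINT x|lborel. norm (f x * of_real (normal_density 0 1 (x - a))))"
  have Ki: "integrable lborel (\<lambda>x. f x * of_real (normal_density 0 1 (x - a)))"
    by (intro sq_int_mult f sq_int_normal_density) simp
  \<comment> \<open>Since (n+1)^2 = 1 + (n^2 + 2n) and n^2 + 2n is at least n, the kernel of width
    1/(n+1) at distance at least d is at most (n+1) q^n times the kernel of width 1.\<close>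
  define q where "q = exp (- (d^2) / 2)"
  have q: "0 < q" "q < 1" using d(1) by (auto simp: q_def)
  have far_bound: "norm (LINT x|lborel. f2 x * of_real (?N n x)) \<le> real (Suc n) * q ^ n * K" for n
  proof -
    have pt: "norm (f2 x * of_real (?N n x)) \<le> real (Suc n) * q ^ n * norm (f x * of_real (normal_density 0 1 (x - a)))" for x
    proof (cases "d \<le> \<bar>x - a\<bar>")
      case True
      then have "d^2 \<le> (x - a)^2" using d(1) by (metis abs_le_square_iff abs_of_pos)
      have "(real (Suc n) * (x - a))^2 / 2 = (x - a)^2 / 2 + ((real n)^2 + 2 * real n) * (x - a)^2 / 2"
        by (simp add: field_simps power2_eq_square)
      moreover have "real n * d^2 \<le> ((real n)^2 + 2 * real n) * (x - a)^2"
        using \<open>d^2 \<le> (x - a)^2\<close> by (intro mult_mono) auto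
      ultimately have "(x - a)^2 / 2 + real n * d^2 / 2 \<le> (real (Suc n) * (x - a))^2 / 2"
        by simp
      then have "exp (- ((real (Suc n) * (x - a))^2 / 2)) \<le> exp (- ((x - a)^2 / 2 + real n * d^2 / 2))"
        by simp
      also have "\<dots> = exp (- ((x - a)^2 / 2)) * q ^ n"
        unfolding q_def exp_of_nat_mult[symmetric] exp_add[symmetric] by (simp add: field_simps)
      finally have le: "exp (- ((real (Suc n) * (x - a))^2 / 2)) \<le> exp (- ((x - a)^2 / 2)) * q ^ n" .
      have "?N n x = real (Suc n) / sqrt (2 * pi) * exp (- ((real (Suc n) * (x - a))^2 / 2))"
      proof -
        have "normal_density 0 (1 / k) t = k / sqrt (2 * pi) * exp (- ((k * t)^2 / 2))" if "0 < k" for k t :: real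
          using that by (simp add: normal_density_def real_sqrt_divide field_simps)
        then show ?thesis by (metis of_nat_0_less_iff zero_less_Suc)
      qed
      also have "\<dots> \<le> real (Suc n) / sqrt (2 * pi) * (exp (- ((x - a)^2 / 2)) * q ^ n)"
        by (intro mult_left_mono le) auto
      also have "\<dots> = real (Suc n) * q ^ n * normal_density 0 1 (x - a)"
        by (simp add: normal_density_def)
      finally have "norm (f x) * ?N n x \<le> norm (f x) * (real (Suc n) * q ^ n * normal_density 0 1 (x - a))"
        by (rule mult_left_mono) simp
      then show ?thesis using True by (simp add: f2_def norm_mult mult_ac)
    qed (use q in \<open>simp add: f2_def\<close>)
    have I: "integrable lborel (\<lambda>x. f2 x * of_real (?N n x))"
      by (intro sq_int_mult sq2 sq_int_normal_density) simp
    have "norm (LINT x|lborel. f2 x * of_real (?N n x)) \<le> (LINT x|lborel. norm (f2 x * of_real (?N n x)))"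
      by (rule integral_norm_bound)
    also have "\<dots> \<le> (LINT x|lborel. real (Suc n) * q ^ n * norm (f x * of_real (normal_density 0 1 (x - a))))"
      using I Ki by (intro integral_mono integrable_norm integrable_mult_right pt) auto
    also have "\<dots> = real (Suc n) * q ^ n * K"
      unfolding K_def by (rule integral_mult_right_zero)
    finally show ?thesis .
  qed
  have "(\<lambda>n. (real n * q ^ n + q ^ n) * K) \<longlonglongrightarrow> (0 + 0) * K"
    using q by (intro tendsto_intros powser_times_n_limit_0 LIMSEQ_power_zero) auto
  then have "(\<lambda>n. real (Suc n) * q ^ n * K) \<longlonglongrightarrow> 0"
    by (simp add: algebra_simps)
  then have far: "(\<lambda>n. LINT x|lborel. f2 x * of_real (?N n x)) \<longlonglongrightarrow> 0"
    by (rule Lim_null_comparison[OF always_eventually, rotated]) (intro allI far_bound)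
  have "(LINT x|lborel. f x * of_real (?N n x)) = (LINT x|lborel. f1 x * of_real (?N n x)) + (LINT x|lborel. f2 x * of_real (?N n x))" for n
    unfolding sum[of _] distrib_right
    by (intro Bochner_Integration.integral_add sq_int_mult sq1 sq2 sq_int_normal_density) simp_all
  then show ?thesis
    using tendsto_add[OF near far] d(1) by (simp add: f1_def)
qed

lemma wave_limit:
  fixes G :: "real \<Rightarrow> complex"
  assumes "integrable lborel G"
  shows "(\<lambda>n. LINT \<xi>|lborel. G \<xi> * wave (1 / real (Suc n)) a \<xi>) \<longlonglongrightarrow> of_real (sqrt (2 * pi)) * FT G (- a)"
proof -
  have [measurable]: "G \<in> borel_measurable borel" using assms by auto
  have "(\<lambda>n. LINT \<xi>|lborel. G \<xi> * wave (1 / real (Suc n)) a \<xi>) \<longlonglongrightarrow> (LINT \<xi>|lborel. G \<xi> * cis (a * \<xi>))"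
  proof (rule integral_dominated_convergence[where w="\<lambda>\<xi>. norm (G \<xi>)"])
    show "AE \<xi> in lborel. (\<lambda>n. G \<xi> * wave (1 / real (Suc n)) a \<xi>) \<longlonglongrightarrow> G \<xi> * cis (a * \<xi>)"
    proof (intro always_eventually allI)
      fix \<xi>
      have "(\<lambda>n. G \<xi> * (complex_of_real (gauss (1 / real (Suc n)) \<xi>) * cis (a * \<xi>))) \<longlonglongrightarrow> G \<xi> * (of_real 1 * cis (a * \<xi>))"
        by (intro tendsto_intros gauss_tendsto)
      then show "(\<lambda>n. G \<xi> * wave (1 / real (Suc n)) a \<xi>) \<longlonglongrightarrow> G \<xi> * cis (a * \<xi>)"
        by (simp add: wave_def)
    qed
  qed (use assms gauss_bounds in \<open>auto simp: norm_mult norm_wave intro!: mult_left_le\<close>)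
  then show ?thesis by (simp add: FT_def)
qed

text \<open>The pairing of \<open>g\<close> with \<open>wave\<close> has two limits as the width
  shrinks: f(a), by the approximate identity, and the undamped inverse integral, by dominated
  convergence. They must agree.\<close>

lemma fourier_inversion:
  assumes fg: "is_fourier_L2 f g" and g: "integrable lborel g" and cont: "isCont f a"
  shows "f a = FT g (- a)"
proof -
  have f: "sq_int f" using fg by (simp add: is_fourier_L2_def)
  have "(\<lambda>n. LINT \<xi>|lborel. g \<xi> * wave (1 / real (Suc n)) a \<xi>) \<longlonglongrightarrow> of_real (sqrt (2 * pi)) * f a"
    by (subst is_fourier_L2_gauss[OF fg]) (simp, intro tendsto_intros approx_identity f cont)
  from LIMSEQ_unique[OF this wave_limit[OF g]] show ?thesis by simp
qed

section \<open>Uniform boundedness on square-summable sequences\<close>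

text \<open>Gliding hump: functionals whose norms grow like \<open>4 ^ n\<close> are tested on a series of unit
  vectors with weights \<open>\<plusminus> 3 ^ -n\<close>, the signs being chosen so that no hump is cancelled
  by the earlier ones.\<close>

lemma l2_uniform_boundedness:
  fixes Q :: "int set \<Rightarrow> (int \<Rightarrow> complex) \<Rightarrow> real"
  assumes bd: "\<And>c. l2_seq c \<Longrightarrow> \<exists>M. \<forall>F a. finite F \<longrightarrow> norm (\<Sum>j\<in>F. a j * c j) \<le> M * Q F a"
    and Q0: "\<And>F a. 0 \<le> Q F a"
  shows "\<exists>M>0. \<forall>F a. finite F \<longrightarrow> L2_set (\<lambda>j. norm (a j)) F \<le> M * Q F a"
proof (rule ccontr)
  assume "\<not> ?thesis"
  then have "\<exists>F a. finite F \<and> 4 ^ n * Q F a < L2_set (\<lambda>j. norm (a j)) F" for n :: nat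
    by (meson not_less zero_less_numeral zero_less_power)
  then obtain F a where fin: "\<And>n. finite (F n)"
    and big: "\<And>n::nat. 4 ^ n * Q (F n) (a n) < L2_set (\<lambda>j. norm (a n j)) (F n)"
    by metis
  define w where "w n = L2_set (\<lambda>j. norm (a n j)) (F n)" for n
  have w0: "0 < w n" for n
    using big[of n] Q0[of "F n" "a n"] unfolding w_def
    by (smt (verit) mult_nonneg_nonneg zero_le_power)
  have w2: "(w n)^2 = (\<Sum>j\<in>F n. (norm (a n j))^2)" for n
    by (simp add: w_def L2_set_def sum_nonneg)
  \<comment> \<open>The unit vector at which the functional \<open>T n\<close> attains its norm
    \<open>w n\<close>.\<close>
  define u where "u n j = (if j \<in> F n then cnj (a n j) / of_real (w n) else 0)" for n j
  define T where "T n c = (\<Sum>j\<in>F n. a n j * c j)" for n and c :: "int \<Rightarrow> complex"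
  have T_add: "T n (\<lambda>j. c j + s * d j) = T n c + s * T n d" for n c d s
    by (simp add: T_def algebra_simps sum.distrib sum_distrib_left)
  have Tu: "T n (u n) = of_real (w n)" for n
  proof -
    have "T n (u n) = (\<Sum>j\<in>F n. of_real ((norm (a n j))^2) / of_real (w n))"
      unfolding T_def by (intro sum.cong) (auto simp: u_def complex_norm_square simp del: of_real_power)
    also have "\<dots> = of_real ((w n)^2) / of_real (w n)"
      by (simp only: w2 sum_divide_distrib of_real_sum)
    finally show ?thesis using w0[of n] by (simp add: power2_eq_square)
  qed
  have norm_u: "L2_set (\<lambda>j. norm (u n j)) G \<le> 1" if "finite G" for n G
  proof -
    have "(\<Sum>j\<in>G. (norm (u n j))^2) = (\<Sum>j\<in>G \<inter> F n. (norm (u n j))^2)"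
      using that by (intro sum.mono_neutral_right) (auto simp: u_def)
    also have "\<dots> \<le> (\<Sum>j\<in>F n. (norm (u n j))^2)"
      using fin by (intro sum_mono2) auto
    also have "\<dots> = (\<Sum>j\<in>F n. (norm (a n j))^2 / (w n)^2)"
      by (intro sum.cong) (auto simp: u_def norm_divide power_divide)
    also have "\<dots> = 1"
      using w0[of n] unfolding sum_divide_distrib[symmetric] w2[symmetric] by simp
    finally show ?thesis by (simp add: L2_set_def)
  qed
  have norm_T: "norm (T n c) \<le> w n * L2_set (\<lambda>j. norm (c j)) (F n)" for n c
  proof -
    have "norm (T n c) \<le> (\<Sum>j\<in>F n. \<bar>norm (a n j)\<bar> * \<bar>norm (c j)\<bar>)"
      unfolding T_def by (rule order_trans[OF norm_sum]) (simp add: norm_mult)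
    also have "\<dots> \<le> w n * L2_set (\<lambda>j. norm (c j)) (F n)"
      unfolding w_def by (rule L2_set_mult_ineq)
    finally show ?thesis .
  qed
  have norm_Tu: "norm (T n (u m)) \<le> w n" for n m
    using norm_T[of n "u m"] norm_u[OF fin, of m n] w0[of n]
    by (smt (verit) mult_left_le)
  \<comment> \<open>The values of \<open>T n\<close> at c + u/3^n and c - u/3^n differ by 2 w/3^n,
    so at least one of them has modulus w/3^n or more; the sign selects such a point.\<close>
  define sgn' where "sgn' n c = (if w n / 3^n \<le> norm (T n (\<lambda>j. c j + 1/3^n * u n j)) then 1 else -1 :: complex)" for n c
  define cs where "cs = rec_nat (\<lambda>_. 0) (\<lambda>n c j. c j + sgn' n c / 3^n * u n j)"
  have cs0: "cs 0 = (\<lambda>_. 0)" and csS: "cs (Suc n) = (\<lambda>j. cs n j + sgn' n (cs n) / 3^n * u n j)" for n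
    by (auto simp: cs_def)
  have norm_sgn: "norm (sgn' n c) = 1" for n c by (simp add: sgn'_def)
  have hump: "w n / 3^n \<le> norm (T n (cs (Suc n)))" for n
  proof (cases "w n / 3^n \<le> norm (T n (\<lambda>j. cs n j + 1/3^n * u n j))")
    case True
    then show ?thesis by (simp add: csS sgn'_def)
  next
    case False
    have "T n (\<lambda>j. cs n j + 1/3^n * u n j) - T n (\<lambda>j. cs n j + (-1/3^n) * u n j) = of_real (2 * (w n / 3^n))"
      unfolding T_add Tu by simp
    then have "2 * (w n / 3^n) = norm (T n (\<lambda>j. cs n j + 1/3^n * u n j) - T n (\<lambda>j. cs n j + (-1/3^n) * u n j))"
      using w0[of n] by (simp only: norm_of_real) simp
    also have "\<dots> \<le> norm (T n (\<lambda>j. cs n j + 1/3^n * u n j)) + norm (T n (\<lambda>j. cs n j + (-1/3^n) * u n j))"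
      by (rule norm_triangle_ineq4)
    finally show ?thesis using False by (simp add: csS sgn'_def)
  qed
  \<comment> \<open>The right-hand side is the partial sum 1 + 1/3 + ... + 1/3^(n-1); its limit 3/2
    bounds the norm of the limit sequence.\<close>
  have cs_bound: "L2_set (\<lambda>j. norm (cs n j)) G \<le> 3/2 - 3/2 / 3^n" if G: "finite G" for n G
  proof (induction n)
    case 0
    then show ?case by (simp add: cs0 L2_set_def)
  next
    case (Suc n)
    have "L2_set (\<lambda>j. norm (cs (Suc n) j)) G \<le> L2_set (\<lambda>j. norm (cs n j) + 1/3^n * norm (u n j)) G"
      by (intro L2_set_mono) (auto simp: csS norm_mult norm_divide norm_power norm_sgn intro!: order_trans[OF norm_triangle_ineq])
    also have "\<dots> \<le> L2_set (\<lambda>j. norm (cs n j)) G + L2_set (\<lambda>j. 1/3^n * norm (u n j)) G"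
      by (rule L2_set_triangle_ineq)
    also have "L2_set (\<lambda>j. 1/3^n * norm (u n j)) G = 1/3^n * L2_set (\<lambda>j. norm (u n j)) G"
      by (rule L2_set_right_distrib[symmetric]) simp
    also have "\<dots> \<le> 1/3^n" using norm_u[OF G, of n] by (simp add: field_simps)
    finally show ?case using Suc by (simp add: field_simps)
  qed
  have u1: "norm (u n j) \<le> 1" for n j
    using norm_u[of "{j}" n] by (simp add: L2_set_def)
  define c where "c j = (\<Sum>m. sgn' m (cs m) / 3^m * u m j)" for j
  have cs_sum: "cs n j = (\<Sum>m<n. sgn' m (cs m) / 3^m * u m j)" for n j
    by (induction n) (auto simp: cs0 csS)
  have lim: "(\<lambda>n. cs n j) \<longlonglongrightarrow> c j" for j
  proof -
    have "summable (\<lambda>m. sgn' m (cs m) / 3^m * u m j)"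
    proof (rule summable_comparison_test'[where N=0])
      show "summable (\<lambda>m. (1/3 :: real)^m)" by (rule summable_geometric) simp
      show "norm (sgn' m (cs m) / 3^m * u m j) \<le> (1/3)^m" for m
      proof -
        have "norm (sgn' m (cs m) / 3^m * u m j) = (1/3)^m * norm (u m j)"
          by (simp add: norm_mult norm_divide norm_power norm_sgn power_divide)
        also have "\<dots> \<le> (1/3)^m * 1"
          by (intro mult_left_mono u1) simp
        finally show ?thesis by simp
      qed
    qed
    then have "(\<lambda>n. \<Sum>m<n. sgn' m (cs m) / 3^m * u m j) \<longlonglongrightarrow> c j"
      unfolding c_def by (rule summable_LIMSEQ)
    moreover have "(\<lambda>n. cs n j) = (\<lambda>n. \<Sum>m<n. sgn' m (cs m) / 3^m * u m j)"
      by (rule ext) (rule cs_sum)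
    ultimately show ?thesis by (rule back_subst[of "\<lambda>s. s \<longlonglongrightarrow> c j", OF _ sym])
  qed
  have "l2_seq c"
    unfolding l2_seq_def
  proof (rule nonneg_bdd_above_summable_on)
    show "bdd_above (sum (\<lambda>j. (norm (c j))\<^sup>2) ` {F. F \<subseteq> UNIV \<and> finite F})"
    proof (rule bdd_aboveI2[where M="(3/2)^2"])
      fix G :: "int set" assume "G \<in> {F. F \<subseteq> UNIV \<and> finite F}"
      then have G: "finite G" by simp
      have "(\<lambda>n. \<Sum>j\<in>G. (norm (cs n j))^2) \<longlonglongrightarrow> (\<Sum>j\<in>G. (norm (c j))^2)"
        by (intro tendsto_intros lim)
      moreover have "(\<Sum>j\<in>G. (norm (cs n j))^2) \<le> (3/2)^2" for n
      proof -
        have "L2_set (\<lambda>j. norm (cs n j)) G \<le> 3/2"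
          using cs_bound[OF G, of n] by (rule order_trans) simp
        then have "(L2_set (\<lambda>j. norm (cs n j)) G)^2 \<le> (3/2)^2"
          by (intro power_mono) auto
        then show ?thesis by (simp add: L2_set_def sum_nonneg)
      qed
      ultimately show "(\<Sum>j\<in>G. (norm (c j))^2) \<le> (3/2)^2"
        by (auto intro: LIMSEQ_le_const2)
    qed
  qed auto
  from bd[OF this] obtain M where M: "\<And>F a. finite F \<Longrightarrow> norm (\<Sum>j\<in>F. a j * c j) \<le> M * Q F a"
    by blast
  \<comment> \<open>The later weights add up to less than (1/2)/3^n, so they can destroy at most
    half of the n-th hump. This is why the ratio is 1/3.\<close>
  have tail: "norm (T n (cs (Suc n + k)) - T n (cs (Suc n))) \<le> w n * (1/2 / 3^n - 3/2 / 3^(Suc n + k))" for n k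
  proof (induction k)
    case (Suc k)
    have "T n (cs (Suc n + Suc k)) - T n (cs (Suc n)) = (T n (cs (Suc n + k)) - T n (cs (Suc n))) + sgn' (Suc n + k) (cs (Suc n + k)) / 3^(Suc n + k) * T n (u (Suc n + k))"
      unfolding add_Suc_right csS[of "Suc n + k"] T_add by simp
    also have "norm \<dots> \<le> w n * (1/2 / 3^n - 3/2 / 3^(Suc n + k)) + 1 / 3^(Suc n + k) * w n"
      using norm_Tu[of n "Suc n + k"]
      by (intro norm_triangle_mono Suc.IH) (simp add: norm_mult norm_divide norm_power norm_sgn divide_right_mono)
    also have "\<dots> = w n * (1/2 / 3^n - 3/2 / 3^(Suc n + Suc k))"
      by (simp add: field_simps)
    finally show ?case .
  qed simp
  \<comment> \<open>The surviving half gives w/(2 3^n) as a lower bound for |T n c|, while pointwise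
    boundedness and the choice of \<open>F n\<close>, \<open>a n\<close> give |M| w/4^n as an upper
    bound.\<close>
  have "(4/3)^n \<le> 2 * \<bar>M\<bar>" for n :: nat
  proof -
    have "(\<lambda>k. norm (T n (cs (Suc n + k)) - T n (cs (Suc n)))) \<longlonglongrightarrow> norm (T n c - T n (cs (Suc n)))"
    proof -
      have sub: "filterlim (\<lambda>k. Suc n + k) sequentially sequentially"
        by (rule filterlim_subseq) (simp add: strict_mono_def)
      show ?thesis
        unfolding T_def by (intro tendsto_intros filterlim_compose[OF lim sub])
    qed
    moreover have "norm (T n (cs (Suc n + k)) - T n (cs (Suc n))) \<le> w n * (1/2 / 3^n)" for k
      using w0[of n] by (intro order_trans[OF tail] mult_left_mono) auto
    ultimately have "norm (T n c - T n (cs (Suc n))) \<le> w n * (1/2 / 3^n)"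
      by (auto intro: LIMSEQ_le_const2)
    with hump[of n] have "w n / 3^n * (1/2) \<le> norm (T n c)"
      using norm_triangle_ineq2[of "T n (cs (Suc n))" "T n c"] by (simp add: norm_minus_commute)
    also have "\<dots> \<le> M * Q (F n) (a n)"
      unfolding T_def by (rule M[OF fin])
    also have "\<dots> \<le> \<bar>M\<bar> * (w n / 4^n)"
      using big[of n] Q0[of "F n" "a n"] by (intro mult_mono) (auto simp: w_def field_simps)
    finally have "w n * ((4/3)^n / 2) \<le> w n * \<bar>M\<bar>"
      by (simp add: field_simps power_divide)
    then show ?thesis using w0[of n] by simp
  qed
  then show False
    using real_arch_pow[of "4/3" "2 * \<bar>M\<bar>"] by (auto simp: not_less[symmetric])
qed

section \<open>Riesz and Bessel bounds for exponential sums\<close>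

definition expsum :: "(int \<Rightarrow> real) \<Rightarrow> int set \<Rightarrow> (int \<Rightarrow> complex) \<Rightarrow> real \<Rightarrow> complex" where
  "expsum x F c \<xi> = (\<Sum>j\<in>F. c j * cis (- (x j * \<xi>)))"

text \<open>Extension by zero lets \<open>L2_norm\<close> on the whole line serve as the norm of
  L2(-pi, pi).\<close>

definition expsum_T :: "(int \<Rightarrow> real) \<Rightarrow> int set \<Rightarrow> (int \<Rightarrow> complex) \<Rightarrow> real \<Rightarrow> complex" where
  "expsum_T x F c \<xi> = indicator {-pi..pi} \<xi> * expsum x F c \<xi>"

lemma expsum_measurable [measurable]: "expsum x F c \<in> borel_measurable borel"
  unfolding expsum_def by measurable

lemma expsum_T_measurable [measurable]: "expsum_T x F c \<in> borel_measurable borel"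
  unfolding expsum_T_def by measurable

lemma norm_expsum_le: "norm (expsum x F c \<xi>) \<le> (\<Sum>j\<in>F. norm (c j))"
  unfolding expsum_def by (rule order_trans[OF norm_sum]) (simp add: norm_mult)

lemma integrable_indicator_Icc: "integrable lborel (\<lambda>\<xi>. indicator {a..b} \<xi> :: complex)" for a b :: real
proof -
  have "integrable lborel (\<lambda>\<xi>. complex_of_real (indicator {a..b} \<xi>))"
    by (intro integrable_of_real integrable_real_indicator emeasure_bounded_finite) auto
  moreover have "(\<lambda>\<xi>. complex_of_real (indicator {a..b} \<xi>)) = indicator {a..b}"
    by (auto simp: indicator_def fun_eq_iff)
  ultimately show ?thesis by simp
qed

lemma sq_int_expsum_T: "sq_int (expsum_T x F c)"
proof (rule sq_int_of_bounded)
  show "integrable lborel (expsum_T x F c)"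
  proof (rule Bochner_Integration.integrable_bound)
    show "integrable lborel (\<lambda>\<xi>. complex_of_real (\<Sum>j\<in>F. norm (c j)) * indicator {-pi..pi} \<xi>)"
      by (intro integrable_mult_right integrable_indicator_Icc)
    show "AE \<xi> in lborel. norm (expsum_T x F c \<xi>) \<le> norm (complex_of_real (\<Sum>j\<in>F. norm (c j)) * indicator {-pi..pi} \<xi>)"
      using norm_expsum_le[of x F c] by (auto simp: expsum_T_def indicator_def sum_nonneg simp del: of_real_sum)
  qed measurable
  show "norm (expsum_T x F c \<xi>) \<le> (\<Sum>j\<in>F. norm (c j))" for \<xi>
    using norm_expsum_le[of x F c \<xi>] by (auto simp: expsum_T_def indicator_def sum_nonneg)
qed

text \<open>On a bounded interval square-integrability implies integrability, so inversion holds at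
  every point of the continuous f. The transform is first changed on a null set so that it vanishes
  everywhere outside the interval.\<close>

lemma PW_pi_sample:
  assumes "PW_pi f"
  obtains h where "sq_int h" "integrable lborel h" "\<And>\<xi>. \<xi> \<notin> {-pi..pi} \<Longrightarrow> h \<xi> = 0" "\<And>a. f a = FT h (- a)"
proof -
  from assms obtain g where cont: "continuous_on UNIV f" and fg: "is_fourier_L2 f g"
    and supp: "AE \<xi> in lborel. \<xi> \<notin> {-pi..pi} \<longrightarrow> g \<xi> = 0"
    unfolding PW_pi_def by blast
  have g: "sq_int g" using fg by (simp add: is_fourier_L2_def)
  note [measurable] = sq_int_measurable[OF g]
  define h where "h \<xi> = g \<xi> * indicator {-pi..pi} \<xi>" for \<xi>
  have [measurable]: "h \<in> borel_measurable borel" unfolding h_def by measurable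
  have eq: "AE \<xi> in lborel. g \<xi> = h \<xi>"
    using supp by eventually_elim (auto simp: h_def indicator_def)
  have ind: "sq_int (\<lambda>\<xi>. indicator {-pi..pi} \<xi>)"
    by (rule sq_int_of_bounded[where C=1, OF integrable_indicator_Icc]) (auto simp: indicator_def)
  have hi: "integrable lborel h"
    unfolding h_def by (rule sq_int_mult[OF g ind])
  have gi: "integrable lborel g"
    by (subst integrable_cong_AE[OF _ _ eq]) (auto simp: hi)
  have "FT g y = FT h y" for y
    unfolding FT_def using eq by (intro arg_cong2[where f="(*)"] refl integral_cong_AE) auto
  with fourier_inversion[OF fg gi] cont have "f a = FT h (- a)" for a
    by (simp add: continuous_on_eq_continuous_at)
  moreover have "sq_int h"
    unfolding h_def by (rule sq_int_mult_bounded[OF g, where C=1]) (auto simp: indicator_def)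
  ultimately show ?thesis
    by (intro that[of h] hi) (auto simp: h_def)
qed

text \<open>Expresses a linear functional of point values as an inner product with an exponential
  sum; the conjugated weights compensate for the conjugation in the inner product.\<close>

lemma sum_FT_samples:
  assumes h: "integrable lborel h"
  shows "(\<Sum>j\<in>F. a j * FT h (- x j)) = of_real (1 / sqrt (2 * pi)) * (LINT \<xi>|lborel. h \<xi> * cnj (expsum x F (\<lambda>j. cnj (a j)) \<xi>))"
proof -
  have "(\<Sum>j\<in>F. a j * FT h (- x j)) = of_real (1 / sqrt (2 * pi)) * (\<Sum>j\<in>F. (LINT \<xi>|lborel. a j * (h \<xi> * cis (x j * \<xi>))))"
    unfolding FT_def sum_distrib_left by (intro sum.cong refl) (simp add: mult_ac)
  also have "(\<Sum>j\<in>F. (LINT \<xi>|lborel. a j * (h \<xi> * cis (x j * \<xi>)))) = (LINT \<xi>|lborel. (\<Sum>j\<in>F. a j * (h \<xi> * cis (x j * \<xi>))))"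
    by (intro Bochner_Integration.integral_sum[symmetric] integrable_mult_right integrable_cis h)
  also have "\<dots> = (LINT \<xi>|lborel. h \<xi> * cnj (expsum x F (\<lambda>j. cnj (a j)) \<xi>))"
    by (intro Bochner_Integration.integral_cong refl) (simp add: expsum_def sum_distrib_left cis_cnj mult_ac)
  finally show ?thesis .
qed

text \<open>For fixed c take an interpolant and its transform h: Cauchy-Schwarz bounds the
  functional with weights a by \<open>L2_norm h / sqrt (2 * pi)\<close> times the norm of the
  exponential sum. This is pointwise boundedness with \<open>Q\<close> equal to that norm.\<close>

lemma riesz_lower_bound:
  assumes "complete_interpolating x"
  shows "\<exists>M>0. \<forall>F c. finite F \<longrightarrow> L2_set (\<lambda>j. norm (c j)) F \<le> M * L2_norm (expsum_T x F c)"
proof -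
  have "\<exists>M>0. \<forall>F a. finite F \<longrightarrow> L2_set (\<lambda>j. norm (a j)) F \<le> M * L2_norm (expsum_T x F (\<lambda>j. cnj (a j)))"
  proof (rule l2_uniform_boundedness)
    fix c assume "l2_seq c"
    then obtain f where f: "PW_pi f" "\<And>j. f (x j) = c j"
      using assms unfolding complete_interpolating_def by blast
    obtain h where h: "sq_int h" "integrable lborel h" "\<And>\<xi>. \<xi> \<notin> {-pi..pi} \<Longrightarrow> h \<xi> = 0" "\<And>a. f a = FT h (- a)"
      using PW_pi_sample[OF f(1)] by blast
    have "norm (\<Sum>j\<in>F. a j * c j) \<le> (L2_norm h / sqrt (2 * pi)) * L2_norm (expsum_T x F (\<lambda>j. cnj (a j)))" for F a
    proof -
      let ?e = "\<lambda>\<xi>. cnj (expsum_T x F (\<lambda>j. cnj (a j)) \<xi>)"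
      have e: "sq_int ?e" "L2_norm ?e = L2_norm (expsum_T x F (\<lambda>j. cnj (a j)))"
        using sq_int_expsum_T[of x F "\<lambda>j. cnj (a j)"] by (auto simp: sq_int_def L2_norm_def)
      have "(\<Sum>j\<in>F. a j * c j) = of_real (1 / sqrt (2 * pi)) * (LINT \<xi>|lborel. h \<xi> * cnj (expsum x F (\<lambda>j. cnj (a j)) \<xi>))"
        using sum_FT_samples[OF h(2), where a=a and x=x and F=F] by (simp add: f(2)[symmetric] h(4))
      also have "(LINT \<xi>|lborel. h \<xi> * cnj (expsum x F (\<lambda>j. cnj (a j)) \<xi>)) = (LINT \<xi>|lborel. h \<xi> * ?e \<xi>)"
        using h(3) by (intro Bochner_Integration.integral_cong refl) (auto simp: expsum_T_def indicator_def)
      finally have "norm (\<Sum>j\<in>F. a j * c j) = norm (LINT \<xi>|lborel. h \<xi> * ?e \<xi>) / sqrt (2 * pi)"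
        by (simp add: norm_mult norm_divide)
      also have "\<dots> \<le> L2_norm h * L2_norm ?e / sqrt (2 * pi)"
        by (intro divide_right_mono sq_int_mult h e) auto
      finally show ?thesis by (simp add: e(2))
    qed
    then show "\<exists>M. \<forall>F a. finite F \<longrightarrow> norm (\<Sum>j\<in>F. a j * c j) \<le> M * L2_norm (expsum_T x F (\<lambda>j. cnj (a j)))"
      by blast
  qed simp
  then obtain M where M: "M > 0" "\<And>F a. finite F \<Longrightarrow> L2_set (\<lambda>j. norm (a j)) F \<le> M * L2_norm (expsum_T x F (\<lambda>j. cnj (a j)))"
    by blast
  have "L2_set (\<lambda>j. norm (c j)) F \<le> M * L2_norm (expsum_T x F c)" if "finite F" for F c
    using M(2)[OF that, of "\<lambda>j. cnj (c j)"] by simp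
  with M(1) show ?thesis by blast
qed

lemma norm_cis_diff_le: "norm (cis a - cis b) \<le> \<bar>a - b\<bar>"
proof -
  have "cis a - cis b = cis b * (cis (a - b) - 1)"
    by (simp add: right_diff_distrib cis_mult)
  then have "norm (cis a - cis b) = norm (cis (a - b) - 1)"
    by (simp add: norm_mult)
  also have "\<dots> \<le> \<bar>a - b\<bar>"
    using iexp_approx1[of "a - b" 0] by (simp add: cis_conv_exp)
  finally show ?thesis .
qed

text \<open>The coefficients 1 and -1 have l2 norm sqrt 2, but at two nodes at distance r their
  exponential sum is at most r pi on [-pi, pi], hence has L2 norm at most r pi sqrt(2 pi). Close
  nodes would violate the Riesz bound.\<close>

lemma riesz_lower_separated:
  assumes M: "0 < M" "\<And>F c. finite F \<Longrightarrow> L2_set (\<lambda>j. norm (c j)) F \<le> M * L2_norm (expsum_T x F c)"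
  shows "\<exists>d>0. \<forall>j k. j \<noteq> k \<longrightarrow> d \<le> \<bar>x j - x k\<bar>"
proof -
  have "sqrt 2 / (M * (pi * sqrt (2 * pi))) \<le> \<bar>x j - x k\<bar>" if jk: "j \<noteq> k" for j k
  proof -
    define c :: "int \<Rightarrow> complex" where "c i = (if i = j then 1 else - 1)" for i
    let ?d = "\<bar>x j - x k\<bar>"
    have E: "norm (expsum x {j,k} c \<xi>) \<le> ?d * \<bar>\<xi>\<bar>" for \<xi>
    proof -
      have "expsum x {j,k} c \<xi> = cis (- (x j * \<xi>)) - cis (- (x k * \<xi>))"
        using jk by (simp add: expsum_def c_def)
      also have "norm \<dots> \<le> \<bar>- (x j * \<xi>) - - (x k * \<xi>)\<bar>" by (rule norm_cis_diff_le)
      also have "\<dots> = \<bar>(x k - x j) * \<xi>\<bar>" by (simp add: algebra_simps)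
      finally show ?thesis by (simp add: abs_mult abs_minus_commute)
    qed
    have "(\<integral>\<^sup>+\<xi>. ennreal ((norm (expsum_T x {j,k} c \<xi>))^2) \<partial>lborel) \<le> (\<integral>\<^sup>+\<xi>. ennreal ((?d * pi)^2) * indicator {-pi..pi} \<xi> \<partial>lborel)"
    proof (rule nn_integral_mono)
      fix \<xi>
      show "ennreal ((norm (expsum_T x {j,k} c \<xi>))^2) \<le> ennreal ((?d * pi)^2) * indicator {-pi..pi} \<xi>"
      proof (cases "\<xi> \<in> {-pi..pi}")
        case True
        then have "?d * \<bar>\<xi>\<bar> \<le> ?d * pi" by (intro mult_left_mono) auto
        with E[of \<xi>] have "(norm (expsum x {j,k} c \<xi>))^2 \<le> (?d * pi)^2" by (intro power_mono) auto
        then show ?thesis using True by (simp add: expsum_T_def ennreal_leI)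
      qed (simp add: expsum_T_def)
    qed
    also have "\<dots> = ennreal ((?d * (pi * sqrt (2 * pi)))^2)"
      by (subst nn_integral_cmult_indicator) (auto simp: power_mult_distrib simp flip: ennreal_mult)
    finally have "L2_norm (expsum_T x {j,k} c) \<le> ?d * (pi * sqrt (2 * pi))"
      by (intro sq_int_bound) auto
    then have "M * L2_norm (expsum_T x {j,k} c) \<le> M * (?d * (pi * sqrt (2 * pi)))"
      using M(1) by (intro mult_left_mono) auto
    moreover have "L2_set (\<lambda>j. norm (c j)) {j,k} = sqrt 2"
      using jk by (simp add: L2_set_def c_def)
    ultimately have "sqrt 2 \<le> M * (?d * (pi * sqrt (2 * pi)))"
      using M(2)[of "{j,k}" c] by simp
    then show ?thesis using M(1) by (simp add: field_simps)
  qed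
  moreover have "0 < sqrt 2 / (M * (pi * sqrt (2 * pi)))" using M(1) by simp
  ultimately show ?thesis by blast
qed

text \<open>Cells of length d starting at y contain at most one node each. The i-th cell on either
  side lies at distance at least i d (i = 0, 1, ...), so each side contributes at most a geometric
  series of ratio exp(-d^2/2).\<close>

lemma separated_gauss_sum:
  fixes x :: "int \<Rightarrow> real"
  assumes d: "0 < d" "\<And>j k. j \<noteq> k \<Longrightarrow> d \<le> \<bar>x j - x k\<bar>" and F: "finite F"
  shows "(\<Sum>k\<in>F. exp (- ((y - x k)^2) / 2)) \<le> 2 / (1 - exp (- (d^2) / 2))"
proof -
  define q where "q = exp (- (d^2) / 2)"
  have q: "0 < q" "q < 1" using d(1) by (auto simp: q_def)
  define m where "m k = \<lfloor>(x k - y) / d\<rfloor>" for k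
  \<comment> \<open>A floor i >= 0 gives distance at least i d; a negative floor i only gives
    distance at least (-i - 1) d, so cell -1 also touches y.\<close>
  define h where "h i = q ^ nat (if 0 \<le> i then i else - i - 1)" for i :: int
  have inj: "inj_on m F"
  proof (rule inj_onI, rule ccontr)
    fix k l assume "m k = m l" "k \<noteq> l"
    then have "\<bar>(x k - y) / d - (x l - y) / d\<bar> < 1"
      unfolding m_def by linarith
    moreover have "(x k - y) / d - (x l - y) / d = (x k - x l) / d"
      by (simp add: diff_divide_distrib)
    ultimately have "\<bar>x k - x l\<bar> < d" using d(1) by (simp add: field_simps)
    with d(2)[OF \<open>k \<noteq> l\<close>] show False by simp
  qed
  have le: "exp (- ((y - x k)^2) / 2) \<le> h (m k)" for k
  proof -
    define n where "n = nat (if 0 \<le> m k then m k else - m k - 1)"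
    have "real n \<le> \<bar>(x k - y) / d\<bar>"
    proof -
      have "real (nat (if 0 \<le> \<lfloor>t\<rfloor> then \<lfloor>t\<rfloor> else - \<lfloor>t\<rfloor> - 1)) \<le> \<bar>t\<bar>" for t :: real
        by (cases "0 \<le> \<lfloor>t\<rfloor>") (simp; linarith)+
      then show ?thesis unfolding n_def m_def .
    qed
    then have "real n * d \<le> \<bar>y - x k\<bar>" using d(1) by (simp add: field_simps abs_minus_commute)
    then have "(real n * d)^2 \<le> (y - x k)^2"
      using d(1) by (metis abs_le_square_iff abs_of_nonneg mult_nonneg_nonneg of_nat_0_le_iff less_imp_le)
    moreover have "real n * d^2 \<le> (real n * d)^2"
    proof -
      have "real n \<le> real n ^ 2" by (cases n) (auto simp: power2_eq_square)
      then show ?thesis unfolding power_mult_distrib by (intro mult_right_mono) auto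
    qed
    ultimately have "- ((y - x k)^2) / 2 \<le> real n * (- (d^2) / 2)" by simp
    then have "exp (- ((y - x k)^2) / 2) \<le> q ^ n"
      unfolding q_def exp_of_nat_mult[symmetric] by simp
    then show ?thesis by (simp add: h_def n_def)
  qed
  have geo: "(\<Sum>n\<in>N. q ^ n) \<le> 1 / (1 - q)" if "finite N" for N :: "nat set"
    using sum_le_suminf[of "\<lambda>n. q ^ n" N] q that suminf_geometric[of q] by simp
  have "(\<Sum>k\<in>F. exp (- ((y - x k)^2) / 2)) \<le> (\<Sum>k\<in>F. h (m k))"
    by (intro sum_mono le)
  also have "\<dots> = (\<Sum>i\<in>m ` F. h i)"
    by (simp add: sum.reindex[OF inj])
  also have "\<dots> = (\<Sum>i\<in>m ` F \<inter> {0..}. h i) + (\<Sum>i\<in>m ` F - {0..}. h i)"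
    using F by (intro sum.Int_Diff) auto
  also have "(\<Sum>i\<in>m ` F \<inter> {0..}. h i) = (\<Sum>n\<in>nat ` (m ` F \<inter> {0..}). q ^ n)"
    by (subst sum.reindex) (auto simp: h_def inj_on_def)
  also have "\<dots> \<le> 1 / (1 - q)" using F by (intro geo) auto
  also have "(\<Sum>i\<in>m ` F - {0..}. h i) = (\<Sum>n\<in>(\<lambda>i. nat (- i - 1)) ` (m ` F - {0..}). q ^ n)"
    by (subst sum.reindex) (auto simp: h_def inj_on_def)
  also have "\<dots> \<le> 1 / (1 - q)" using F by (intro geo) auto
  finally show ?thesis by (simp add: q_def)
qed

text \<open>Each cross term is the Gaussian integral \<open>gauss_FT\<close> at x_k - x_j, so the
  weighted energy becomes a quadratic form with a rapidly decaying matrix.\<close>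

lemma expsum_gauss_energy:
  "(LINT \<xi>|lborel. complex_of_real ((norm (expsum x F c \<xi>))^2 * gauss 1 \<xi>))
    = of_real (sqrt (2 * pi)) * (\<Sum>j\<in>F. \<Sum>k\<in>F. c j * cnj (c k) * of_real (exp (- ((x j - x k)^2) / 2)))"
proof -
  have pt: "complex_of_real ((norm (expsum x F c \<xi>))^2 * gauss 1 \<xi>)
      = (\<Sum>j\<in>F. \<Sum>k\<in>F. c j * cnj (c k) * (of_real (gauss 1 \<xi>) * cis ((x k - x j) * \<xi>)))" for \<xi>
  proof -
    have "complex_of_real ((norm (expsum x F c \<xi>))^2 * gauss 1 \<xi>) = expsum x F c \<xi> * cnj (expsum x F c \<xi>) * of_real (gauss 1 \<xi>)"
      by (simp only: of_real_mult complex_norm_square)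
    also have "\<dots> = (\<Sum>j\<in>F. \<Sum>k\<in>F. (c j * cis (- (x j * \<xi>))) * cnj (c k * cis (- (x k * \<xi>))) * of_real (gauss 1 \<xi>))"
      by (simp only: expsum_def cnj_sum sum_product) (simp only: sum_distrib_right)
    also have "\<dots> = (\<Sum>j\<in>F. \<Sum>k\<in>F. c j * cnj (c k) * (of_real (gauss 1 \<xi>) * cis ((x k - x j) * \<xi>)))"
    proof (intro sum.cong refl)
      fix j k
      have "cis (- (x j * \<xi>)) * cis (x k * \<xi>) = cis ((x k - x j) * \<xi>)"
        by (simp add: cis_mult algebra_simps)
      then show "(c j * cis (- (x j * \<xi>))) * cnj (c k * cis (- (x k * \<xi>))) * of_real (gauss 1 \<xi>)
          = c j * cnj (c k) * (of_real (gauss 1 \<xi>) * cis ((x k - x j) * \<xi>))"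
        by (simp add: cis_cnj mult_ac)
    qed
    finally show ?thesis .
  qed
  have I: "integrable lborel (\<lambda>\<xi>. complex_of_real (gauss 1 \<xi>) * cis (u * \<xi>))" for u
    using integrable_wave[of 1 u] by (simp add: wave_def[abs_def])
  have "(LINT \<xi>|lborel. complex_of_real ((norm (expsum x F c \<xi>))^2 * gauss 1 \<xi>))
     = (\<Sum>j\<in>F. \<Sum>k\<in>F. c j * cnj (c k) * (LINT \<xi>|lborel. of_real (gauss 1 \<xi>) * cis ((x k - x j) * \<xi>)))"
  proof -
    have "(LINT \<xi>|lborel. complex_of_real ((norm (expsum x F c \<xi>))^2 * gauss 1 \<xi>))
      = (\<Sum>j\<in>F. (LINT \<xi>|lborel. (\<Sum>k\<in>F. c j * cnj (c k) * (of_real (gauss 1 \<xi>) * cis ((x k - x j) * \<xi>)))))"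
      unfolding pt by (intro Bochner_Integration.integral_sum Bochner_Integration.integrable_sum integrable_mult_right I)
    also have "\<dots> = (\<Sum>j\<in>F. \<Sum>k\<in>F. (LINT \<xi>|lborel. c j * cnj (c k) * (of_real (gauss 1 \<xi>) * cis ((x k - x j) * \<xi>))))"
      by (intro sum.cong refl Bochner_Integration.integral_sum integrable_mult_right I)
    finally show ?thesis by (simp only: integral_mult_right_zero)
  qed
  also have "\<dots> = of_real (sqrt (2 * pi)) * (\<Sum>j\<in>F. \<Sum>k\<in>F. c j * cnj (c k) * of_real (exp (- ((x j - x k)^2) / 2)))"
    unfolding sum_distrib_left
  proof (intro sum.cong refl)
    fix j k
    have "2 * pi * normal_density 0 1 (x k - x j) = 2 * pi / sqrt (2 * pi) * exp (- ((x j - x k)^2) / 2)"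
      by (simp add: normal_density_def power2_commute[of "x k"])
    also have "2 * pi / sqrt (2 * pi) = sqrt (2 * pi)" by (rule real_div_sqrt) simp
    finally have "(LINT \<xi>|lborel. of_real (gauss 1 \<xi>) * cis ((x k - x j) * \<xi>)) = of_real (sqrt (2 * pi) * exp (- ((x j - x k)^2) / 2))"
      by (simp only: gauss_FT zero_less_one)
    then show "c j * cnj (c k) * (LINT \<xi>|lborel. of_real (gauss 1 \<xi>) * cis ((x k - x j) * \<xi>))
      = of_real (sqrt (2 * pi)) * (c j * cnj (c k) * of_real (exp (- ((x j - x k)^2) / 2)))"
      by (simp only: of_real_mult mult_ac)
  qed
  finally show ?thesis .
qed

text \<open>Schur test for the Gaussian matrix of \<open>expsum_gauss_energy\<close>: it is
  symmetric, and separation bounds its row sums by S.\<close>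

lemma bessel_upper_bound:
  fixes x :: "int \<Rightarrow> real"
  assumes d: "0 < d" "\<And>j k. j \<noteq> k \<Longrightarrow> d \<le> \<bar>x j - x k\<bar>"
  shows "\<exists>B>0. \<forall>F c. finite F \<longrightarrow>
     (\<integral>\<^sup>+\<xi>. ennreal ((norm (expsum x F c \<xi>))^2) * indicator {-pi..pi} \<xi> \<partial>lborel) \<le> ennreal (B * (\<Sum>j\<in>F. (norm (c j))^2))"
proof -
  define S where "S = 2 / (1 - exp (- (d^2) / 2))"
  have S: "0 < S" using d(1) by (simp add: S_def)
  \<comment> \<open>On [-pi, pi] the weight \<open>gauss 1\<close> is at least exp(-pi^2/2), so the
    first factor pays for replacing the indicator by the Gaussian.\<close>
  define B where "B = exp (pi^2 / 2) * (sqrt (2 * pi) * S)"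
  have "(\<integral>\<^sup>+\<xi>. ennreal ((norm (expsum x F c \<xi>))^2) * indicator {-pi..pi} \<xi> \<partial>lborel) \<le> ennreal (B * (\<Sum>j\<in>F. (norm (c j))^2))"
    if F: "finite F" for F c
  proof -
    let ?e = "\<lambda>j k. exp (- ((x j - x k)^2) / 2)"
    let ?s = "\<Sum>j\<in>F. (norm (c j))^2"
    have sym: "?e j k = ?e k j" for j k by (simp add: power2_commute)
    have "integrable lborel (\<lambda>\<xi>. (\<Sum>j\<in>F. norm (c j))^2 * gauss 1 \<xi>)"
      by (intro integrable_mult_right integrable_gauss) simp
    then have I: "integrable lborel (\<lambda>\<xi>. (norm (expsum x F c \<xi>))^2 * gauss 1 \<xi>)"
      by (rule Bochner_Integration.integrable_bound)
         (auto simp: abs_mult gauss_bounds(1) less_imp_le intro!: mult_right_mono power_mono norm_expsum_le)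
    have "(LINT \<xi>|lborel. (norm (expsum x F c \<xi>))^2 * gauss 1 \<xi>) \<le> norm (LINT \<xi>|lborel. complex_of_real ((norm (expsum x F c \<xi>))^2 * gauss 1 \<xi>))"
      unfolding integral_complex_of_real by (simp only: norm_of_real abs_ge_self)
    also have "\<dots> = sqrt (2 * pi) * norm (\<Sum>j\<in>F. \<Sum>k\<in>F. c j * cnj (c k) * of_real (?e j k))"
      unfolding expsum_gauss_energy norm_mult by simp
    also have "\<dots> \<le> sqrt (2 * pi) * (\<Sum>j\<in>F. \<Sum>k\<in>F. norm (c j) * norm (c k) * ?e j k)"
      by (intro mult_left_mono order_trans[OF norm_sum] sum_mono) (auto simp: norm_mult)
    also have "(\<Sum>j\<in>F. \<Sum>k\<in>F. norm (c j) * norm (c k) * ?e j k) \<le> (\<Sum>j\<in>F. \<Sum>k\<in>F. ((norm (c j))^2 * ?e j k + (norm (c k))^2 * ?e j k) / 2)"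
    proof (intro sum_mono)
      fix j k
      have "norm (c j) * norm (c k) * ?e j k \<le> ((norm (c j))^2 + (norm (c k))^2) / 2 * ?e j k"
        using sum_squares_bound[of "norm (c j)" "norm (c k)"] by (intro mult_right_mono) auto
      then show "norm (c j) * norm (c k) * ?e j k \<le> ((norm (c j))^2 * ?e j k + (norm (c k))^2 * ?e j k) / 2"
        by (simp add: field_simps)
    qed
    also have "\<dots> = (\<Sum>j\<in>F. (norm (c j))^2 * (\<Sum>k\<in>F. ?e j k))"
    proof -
      have "(\<Sum>j\<in>F. \<Sum>k\<in>F. (norm (c k))^2 * ?e j k) = (\<Sum>k\<in>F. \<Sum>j\<in>F. (norm (c k))^2 * ?e k j)"
        by (subst sum.swap) (simp only: sym)
      moreover have "(\<Sum>j\<in>F. \<Sum>k\<in>F. ((norm (c j))^2 * ?e j k + (norm (c k))^2 * ?e j k) / 2)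
        = ((\<Sum>j\<in>F. \<Sum>k\<in>F. (norm (c j))^2 * ?e j k) + (\<Sum>j\<in>F. \<Sum>k\<in>F. (norm (c k))^2 * ?e j k)) / 2"
        by (simp only: sum_divide_distrib[symmetric] sum.distrib)
      ultimately show ?thesis
        by (simp only: sum_distrib_left) simp
    qed
    also have "\<dots> \<le> (\<Sum>j\<in>F. (norm (c j))^2 * S)"
      unfolding S_def by (intro sum_mono mult_left_mono separated_gauss_sum[OF d F]) auto
    also have "\<dots> = S * ?s" by (simp add: sum_distrib_left mult.commute)
    finally have main: "(LINT \<xi>|lborel. (norm (expsum x F c \<xi>))^2 * gauss 1 \<xi>) \<le> sqrt (2 * pi) * (S * ?s)"
      by simp
    have "(\<integral>\<^sup>+\<xi>. ennreal ((norm (expsum x F c \<xi>))^2) * indicator {-pi..pi} \<xi> \<partial>lborel)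
      \<le> (\<integral>\<^sup>+\<xi>. ennreal (exp (pi^2 / 2)) * ennreal ((norm (expsum x F c \<xi>))^2 * gauss 1 \<xi>) \<partial>lborel)"
    proof (rule nn_integral_mono)
      fix \<xi>
      show "ennreal ((norm (expsum x F c \<xi>))^2) * indicator {-pi..pi} \<xi> \<le> ennreal (exp (pi^2 / 2)) * ennreal ((norm (expsum x F c \<xi>))^2 * gauss 1 \<xi>)"
      proof (cases "\<xi> \<in> {-pi..pi}")
        case True
        then have "\<xi>^2 \<le> pi^2" by (auto simp: abs_le_square_iff[symmetric])
        then have "1 \<le> exp (pi^2 / 2) * gauss 1 \<xi>" by (simp add: gauss_def flip: exp_add)
        then have "(norm (expsum x F c \<xi>))^2 * 1 \<le> (norm (expsum x F c \<xi>))^2 * (exp (pi^2 / 2) * gauss 1 \<xi>)"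
          by (rule mult_left_mono) simp
        then show ?thesis using True gauss_bounds(1)[of 1 \<xi>]
          by (auto intro!: ennreal_leI simp: mult_ac simp flip: ennreal_mult)
      qed simp
    qed
    also have "\<dots> = ennreal (exp (pi^2 / 2)) * ennreal (LINT \<xi>|lborel. (norm (expsum x F c \<xi>))^2 * gauss 1 \<xi>)"
      using gauss_bounds(1)[of 1]
      by (subst nn_integral_cmult, measurable) (subst nn_integral_eq_integral[OF I], auto simp: less_imp_le)
    also have "\<dots> \<le> ennreal (exp (pi^2 / 2)) * ennreal (sqrt (2 * pi) * (S * ?s))"
      by (intro mult_left_mono ennreal_leI main) simp
    also have "\<dots> = ennreal (B * ?s)"
      using S by (simp add: B_def sum_nonneg mult_ac flip: ennreal_mult)
    finally show ?thesis .
  qed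
  moreover have "0 < B" using S by (simp add: B_def)
  ultimately show ?thesis by blast
qed

section \<open>The amalgam weight\<close>

lemma expsum_add: "expsum x F c (\<xi> + t) = expsum x F (\<lambda>j. c j * cis (- (x j * t))) \<xi>"
  unfolding expsum_def by (intro sum.cong refl) (simp add: mult.assoc cis_mult algebra_simps)

text \<open>Translating the argument multiplies the coefficients by unimodular numbers, so the
  constant B serves every translate.\<close>

lemma bessel_upper_bound_cell:
  assumes B: "\<And>F c. finite F \<Longrightarrow> (\<integral>\<^sup>+\<xi>. ennreal ((norm (expsum x F c \<xi>))^2) * indicator {-pi..pi} \<xi> \<partial>lborel)
      \<le> ennreal (B * (\<Sum>j\<in>F. (norm (c j))^2))" and F: "finite F"
  shows "(\<integral>\<^sup>+\<xi>. ennreal ((norm (expsum x F c \<xi>))^2) * indicator {-pi + t..<pi + t} \<xi> \<partial>lborel) \<le> ennreal (B * (\<Sum>j\<in>F. (norm (c j))^2))"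
proof -
  let ?c = "\<lambda>j. c j * cis (- (x j * t))"
  have "(\<integral>\<^sup>+\<xi>. ennreal ((norm (expsum x F c \<xi>))^2) * indicator {-pi + t..<pi + t} \<xi> \<partial>lborel)
     = ennreal \<bar>1\<bar> * (\<integral>\<^sup>+\<xi>. ennreal ((norm (expsum x F c (t + 1 * \<xi>)))^2) * indicator {-pi + t..<pi + t} (t + 1 * \<xi>) \<partial>lborel)"
    by (rule nn_integral_real_affine) auto
  also have "\<dots> = (\<integral>\<^sup>+\<xi>. ennreal ((norm (expsum x F ?c \<xi>))^2) * indicator {-pi + t..<pi + t} (t + 1 * \<xi>) \<partial>lborel)"
    by (simp add: add.commute[of t] expsum_add)
  also have "\<dots> \<le> (\<integral>\<^sup>+\<xi>. ennreal ((norm (expsum x F ?c \<xi>))^2) * indicator {-pi..pi} \<xi> \<partial>lborel)"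
    by (intro nn_integral_mono mult_left_mono) (auto simp: indicator_def)
  also have "\<dots> \<le> ennreal (B * (\<Sum>j\<in>F. (norm (?c j))^2))" by (rule B[OF F])
  finally show ?thesis by (simp add: norm_mult)
qed

text \<open>The half-open cells tile the line, and \<open>amalgam_sup\<close> is a true supremum, so
  the bound holds at every point and not merely almost everywhere.\<close>

lemma amalgam_sup_upper:
  assumes "in_amalgam g"
  obtains k where "\<xi> \<in> {-pi + 2 * pi * of_int k..<pi + 2 * pi * of_int k}" "norm (g \<xi>) \<le> amalgam_sup g k"
proof
  define k where "k = \<lfloor>(\<xi> + pi) / (2 * pi)\<rfloor>"
  have "of_int k \<le> (\<xi> + pi) / (2 * pi)" "(\<xi> + pi) / (2 * pi) < of_int k + 1"
    unfolding k_def by linarith+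
  then have k: "-pi + 2 * pi * of_int k \<le> \<xi>" "\<xi> < pi + 2 * pi * of_int k"
    by (simp_all add: field_simps)
  then show "\<xi> \<in> {-pi + 2 * pi * of_int k..<pi + 2 * pi * of_int k}" by simp
  have "\<xi> - 2 * pi * of_int k \<in> torus" using k by (simp add: torus_def)
  from cSUP_upper[OF this, of "\<lambda>\<xi>. norm (g (\<xi> + 2 * pi * of_int k))"] assms
  show "norm (g \<xi>) \<le> amalgam_sup g k"
    by (simp add: in_amalgam_def amalgam_sup_def)
qed

lemma amalgam_sup_nonneg: "in_amalgam g \<Longrightarrow> 0 \<le> amalgam_sup g k"
  unfolding amalgam_sup_def in_amalgam_def
  by (rule cSUP_upper2[of "\<lambda>\<xi>. norm (g (\<xi> + 2 * pi * of_int k))" torus "-pi"]) (auto simp: torus_def)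

lemma in_amalgam_bounded:
  assumes g: "in_amalgam g"
  shows "norm (g \<xi>) \<le> (\<Sum>\<^sub>\<infinity>k. amalgam_sup g k)"
proof -
  obtain k where "norm (g \<xi>) \<le> amalgam_sup g k" using amalgam_sup_upper[OF g] by blast
  also have "\<dots> = (\<Sum>k\<in>{k}. amalgam_sup g k)" by simp
  also have "\<dots> \<le> (\<Sum>\<^sub>\<infinity>k. amalgam_sup g k)"
    using g by (intro finite_sum_le_infsum amalgam_sup_nonneg) (auto simp: in_amalgam_def)
  finally show ?thesis .
qed

text \<open>Cell by cell, |g| is at most its supremum and the energy of the exponential sum is at
  most B times the coefficient sum; summability of the suprema finishes. The weight is |g| rather
  than |g|^2 because this is what pairing the samples produces.\<close>

lemma amalgam_energy:
  assumes g: "in_amalgam g" and [measurable]: "g \<in> borel_measurable borel" and B0: "0 < B"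
    and B: "\<And>F c. finite F \<Longrightarrow> (\<integral>\<^sup>+\<xi>. ennreal ((norm (expsum x F c \<xi>))^2) * indicator {-pi..pi} \<xi> \<partial>lborel)
      \<le> ennreal (B * (\<Sum>j\<in>F. (norm (c j))^2))"
  shows "\<exists>K>0. \<forall>F c. finite F \<longrightarrow> (\<integral>\<^sup>+\<xi>. ennreal (norm (g \<xi>) * (norm (expsum x F c \<xi>))^2) \<partial>lborel) \<le> ennreal (K * (\<Sum>j\<in>F. (norm (c j))^2))"
proof -
  define s where "s n = amalgam_sup g (int_decode n)" for n
  define C where "C n = {-pi + 2 * pi * of_int (int_decode n)..<pi + 2 * pi * of_int (int_decode n)}" for n
  have s0: "0 \<le> s n" for n unfolding s_def by (rule amalgam_sup_nonneg[OF g])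
  have "(amalgam_sup g \<circ> int_decode) summable_on UNIV"
    using g bij_int_decode by (subst summable_on_reindex[symmetric]) (auto simp: in_amalgam_def bij_def)
  then have sum_s: "summable s"
    by (simp add: s_def[abs_def] comp_def summable_on_imp_summable)
  \<comment> \<open>The summand 1 only ensures K > 0.\<close>
  define K where "K = (\<Sum>n. s n) * B + 1"
  have "(\<integral>\<^sup>+\<xi>. ennreal (norm (g \<xi>) * (norm (expsum x F c \<xi>))^2) \<partial>lborel) \<le> ennreal (K * (\<Sum>j\<in>F. (norm (c j))^2))"
    if F: "finite F" for F c
  proof -
    let ?e = "\<lambda>\<xi>. ennreal ((norm (expsum x F c \<xi>))^2)"
    let ?S = "\<Sum>j\<in>F. (norm (c j))^2"
    have "(\<integral>\<^sup>+\<xi>. ennreal (norm (g \<xi>) * (norm (expsum x F c \<xi>))^2) \<partial>lborel)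
      \<le> (\<integral>\<^sup>+\<xi>. (\<Sum>n. ennreal (s n) * (?e \<xi> * indicator (C n) \<xi>)) \<partial>lborel)"
    proof (rule nn_integral_mono)
      fix \<xi>
      obtain k where k: "\<xi> \<in> {-pi + 2 * pi * of_int k..<pi + 2 * pi * of_int k}" "norm (g \<xi>) \<le> amalgam_sup g k"
        by (rule amalgam_sup_upper[OF g])
      let ?n = "int_encode k"
      have "ennreal (norm (g \<xi>) * (norm (expsum x F c \<xi>))^2) \<le> ennreal (s ?n) * (?e \<xi> * indicator (C ?n) \<xi>)"
        using k s0[of ?n] by (auto simp: s_def C_def intro!: ennreal_leI mult_right_mono simp flip: ennreal_mult)
      also have "\<dots> = (\<Sum>n\<in>{?n}. ennreal (s n) * (?e \<xi> * indicator (C n) \<xi>))" by simp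
      also have "\<dots> \<le> (\<Sum>n. ennreal (s n) * (?e \<xi> * indicator (C n) \<xi>))"
        by (rule sum_le_suminf) auto
      finally show "ennreal (norm (g \<xi>) * (norm (expsum x F c \<xi>))^2) \<le> (\<Sum>n. ennreal (s n) * (?e \<xi> * indicator (C n) \<xi>))" .
    qed
    also have "\<dots> = (\<Sum>n. \<integral>\<^sup>+\<xi>. ennreal (s n) * (?e \<xi> * indicator (C n) \<xi>) \<partial>lborel)"
      unfolding C_def by (rule nn_integral_suminf) measurable
    also have "\<dots> = (\<Sum>n. ennreal (s n) * (\<integral>\<^sup>+\<xi>. ?e \<xi> * indicator (C n) \<xi> \<partial>lborel))"
      unfolding C_def by (intro suminf_cong nn_integral_cmult) measurable
    also have "\<dots> \<le> (\<Sum>n. ennreal (s n) * ennreal (B * ?S))"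
      unfolding C_def by (intro suminf_le mult_left_mono bessel_upper_bound_cell B F) auto
    also have "\<dots> = (\<Sum>n. ennreal (s n * (B * ?S)))"
      using s0 B0 by (intro suminf_cong) (simp add: ennreal_mult sum_nonneg)
    also have "\<dots> = ennreal (\<Sum>n. s n * (B * ?S))"
      using s0 B0 sum_s by (intro suminf_ennreal2 summable_mult2) (auto intro!: mult_nonneg_nonneg sum_nonneg)
    also have "(\<Sum>n. s n * (B * ?S)) = (\<Sum>n. s n) * B * ?S"
      using sum_s by (subst suminf_mult2[symmetric]) auto
    also have "\<dots> \<le> K * ?S"
      unfolding K_def by (intro mult_right_mono) (auto intro: sum_nonneg)
    finally show ?thesis by (simp add: ennreal_leI)
  qed
  moreover have "0 < K"
    unfolding K_def using s0 B0 sum_s by (intro add_nonneg_pos mult_nonneg_nonneg suminf_nonneg) auto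
  ultimately show ?thesis by blast
qed

section \<open>Positive definite functions\<close>

lemma positive_definite_bounded:
  assumes "positive_definite \<psi>"
  shows "norm (\<psi> t) \<le> Re (\<psi> 0)"
proof -
  note pd = assms[unfolded positive_definite_def, rule_format]
  \<comment> \<open>The form at the points t, 0 with weights 1, z. Its reality for z = 1 and z = i
    forces Hermitian symmetry; its sign for the phase opposite to that of \<open>\<psi> t\<close>
    gives the bound.\<close>
  have two: "\<psi> 0 + z * cnj z * \<psi> 0 + (cnj z * \<psi> t + z * \<psi> (- t)) \<in> \<real> \<and> 0 \<le> Re (\<psi> 0 + z * cnj z * \<psi> 0 + (cnj z * \<psi> t + z * \<psi> (- t)))" for z
    using pd[where n=2 and y="\<lambda>i. if i = 0 then t else 0" and a="\<lambda>i. if i = 0 then 1 else z"]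
    by (simp add: numeral_2_eq_2 lessThan_Suc algebra_simps)
  have zero: "\<psi> 0 \<in> \<real>"
    using two[of 0] by simp
  have s1: "Im (\<psi> t) = - Im (\<psi> (- t))"
    using two[of 1] zero by (simp add: complex_is_Real_iff)
  have s2: "Re (\<psi> t) = Re (\<psi> (- t))"
    using two[of \<i>] zero by (simp add: complex_is_Real_iff)
  have sym: "\<psi> (- t) = cnj (\<psi> t)"
    using s1 s2 by (simp add: complex_eq_iff)
  show ?thesis
  proof (cases "\<psi> t = 0")
    case True
    then show ?thesis using two[of 0] by simp
  next
    case False
    define z where "z = - (\<psi> t / of_real (norm (\<psi> t)))"
    have "z * cnj z = of_real ((norm z)^2)" by (simp only: complex_norm_square)
    then have z1: "z * cnj z = 1" using False by (simp add: z_def norm_divide)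
    have e: "cnj z * \<psi> t = of_real (- norm (\<psi> t))"
    proof -
      have "cnj z * \<psi> t = - (\<psi> t * cnj (\<psi> t) / of_real (norm (\<psi> t)))" by (simp add: z_def mult.commute)
      also have "\<psi> t * cnj (\<psi> t) = of_real ((norm (\<psi> t))^2)" by (simp only: complex_norm_square)
      finally show ?thesis using False by (simp add: power2_eq_square)
    qed
    then have "cnj (cnj z * \<psi> t) = of_real (- norm (\<psi> t))" by simp
    then have e': "z * \<psi> (- t) = of_real (- norm (\<psi> t))" by (simp add: sym)
    show ?thesis using two[of z] by (simp add: z1 e e')
  qed
qed

text \<open>The joint law of two coordinates agrees with the product measure on rectangles. Used to
  recognise differences of independent Gaussian coordinates as Gaussian.\<close>

lemma indep_var_PiM_component:
  assumes P: "prob_space P" and setsP: "sets P = sets borel" and l: "l \<in> I" "k \<in> I" "l \<noteq> k"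
  shows "prob_space.indep_var (PiM I (\<lambda>_. P)) borel (\<lambda>\<omega>. \<omega> l) borel (\<lambda>\<omega>. \<omega> k)"
proof -
  interpret P: prob_space P by fact
  define M where "M = PiM I (\<lambda>_. P)"
  interpret M: prob_space M unfolding M_def by (rule prob_space_PiM) (rule P)
  have rv [measurable]: "(\<lambda>\<omega>. \<omega> i) \<in> measurable M borel" if "i \<in> I" for i
    unfolding M_def measurable_cong_sets[OF refl setsP[symmetric]] by (rule measurable_component_singleton) (use that in simp)
  have comp: "distr M borel (\<lambda>\<omega>. \<omega> i) = P" if "i \<in> I" for i
    using distr_PiM_component[of I "\<lambda>_. P" i] P that setsP
    by (simp add: M_def cong: distr_cong)
  have "P \<Otimes>\<^sub>M P = distr M (borel \<Otimes>\<^sub>M borel) (\<lambda>\<omega>. (\<omega> l, \<omega> k))"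
  proof (rule pair_measure_eqI)
    show "sigma_finite_measure P" "sigma_finite_measure P" by unfold_locales
    show "sets (P \<Otimes>\<^sub>M P) = sets (distr M (borel \<Otimes>\<^sub>M borel) (\<lambda>\<omega>. (\<omega> l, \<omega> k)))"
      using setsP by (simp cong: sets_pair_measure_cong)
    fix A B assume A: "A \<in> sets P" and B: "B \<in> sets P"
    let ?X = "\<lambda>i. if i = l then A else B"
    have "(\<lambda>\<omega>. (\<omega> l, \<omega> k)) -` (A \<times> B) \<inter> space M = prod_emb I (\<lambda>_. P) {l, k} (Pi\<^sub>E {l, k} ?X)"
      using l by (auto simp: prod_emb_def M_def space_PiM PiE_iff)
    then have "emeasure (distr M (borel \<Otimes>\<^sub>M borel) (\<lambda>\<omega>. (\<omega> l, \<omega> k))) (A \<times> B) = emeasure M (prod_emb I (\<lambda>_. P) {l, k} (Pi\<^sub>E {l, k} ?X))"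
      using A B l rv setsP by (subst emeasure_distr) auto
    also have "\<dots> = (\<Prod>i\<in>{l, k}. emeasure P (?X i))"
      unfolding M_def using l A B P by (intro emeasure_PiM_emb) auto
    finally show "emeasure P A * emeasure P B = emeasure (distr M (borel \<Otimes>\<^sub>M borel) (\<lambda>\<omega>. (\<omega> l, \<omega> k))) (A \<times> B)"
      using l by simp
  qed
  then show ?thesis
    unfolding M_def[symmetric] M.indep_var_distribution_eq using l by (simp add: comp rv)
qed

text \<open>Evaluate the positive definite form at independent Gaussian points \<open>s\<^sub>0, \<dots>, s\<^sub>n\<close> with
  weights \<open>cis (- w s\<^sub>l)\<close>: the \<open>n (n + 1)\<close> off-diagonal expectations all equal the integral
  below, and the \<open>n + 1\<close> diagonal terms become negligible as \<open>n\<close> grows.\<close>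

lemma positive_definite_gauss_average:
  assumes pd: "positive_definite \<psi>" and [measurable]: "\<psi> \<in> borel_measurable borel" and e: "0 < e"
  shows "0 \<le> Re (LINT t|lborel. of_real (normal_density 0 e t) * (\<psi> t * cis (- (w * t))))"
    and "Im (LINT t|lborel. of_real (normal_density 0 e t) * (\<psi> t * cis (- (w * t)))) = 0"
proof -
  \<comment> \<open>Chosen so that the difference of two independent points has standard deviation
    e.\<close>
  define \<sigma> where "\<sigma> = e / sqrt 2"
  have \<sigma>: "0 < \<sigma>" "sqrt (\<sigma>\<^sup>2 + \<sigma>\<^sup>2) = e" using e by (auto simp: \<sigma>_def power_divide)
  define P where "P = density lborel (normal_density 0 \<sigma>)"
  have P: "prob_space P" unfolding P_def by (rule prob_space_normal_density[OF \<sigma>(1)])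
  have setsP: "sets P = sets borel" by (simp add: P_def)
  define h where "h t = \<psi> t * cis (- (w * t))" for t
  have [measurable]: "h \<in> borel_measurable borel" unfolding h_def by measurable
  define C where "C = Re (\<psi> 0)"
  have hC: "norm (h t) \<le> C" for t
    using positive_definite_bounded[OF pd] by (simp add: h_def norm_mult C_def)
  define I where "I = (LINT t|lborel. of_real (normal_density 0 e t) * h t)"
  \<comment> \<open>D collects the n + 1 diagonal expectations. Division by n + 1 below leaves n
    times I against the fixed bound C.\<close>
  have key: "\<exists>D. norm D \<le> real (Suc n) * C \<and> 0 \<le> Re (of_nat (Suc n * n) * I + D) \<and> Im (of_nat (Suc n * n) * I + D) = 0" for n
  proof -
    define M where "M = PiM {..<Suc n} (\<lambda>_. P)"
    interpret M: prob_space M unfolding M_def by (rule prob_space_PiM) (rule P)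
    have rv [measurable]: "(\<lambda>\<omega>. \<omega> i) \<in> measurable M borel" if "i < Suc n" for i
      unfolding M_def measurable_cong_sets[OF refl setsP[symmetric]] by (rule measurable_component_singleton) (use that in simp)
    have comp: "distr M lborel (\<lambda>\<omega>. \<omega> i) = P" if "i < Suc n" for i
      using distr_PiM_component[of "{..<Suc n}" "\<lambda>_. P" i] P that setsP
      by (simp add: M_def cong: distr_cong)
    have dist: "distributed M lborel (\<lambda>\<omega>. \<omega> i) (normal_density 0 \<sigma>)" if "i < Suc n" for i
      unfolding distributed_def using rv[OF that] comp[OF that] by (auto simp: P_def)
    have off: "(LINT \<omega>|M. h (\<omega> l - \<omega> k)) = I" if "l < Suc n" "k < Suc n" "l \<noteq> k" for l k
    proof -
      have "M.indep_var borel (\<lambda>\<omega>. \<omega> l) borel (\<lambda>\<omega>. \<omega> k)"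
        unfolding M_def by (rule indep_var_PiM_component[OF P setsP]) (use that in auto)
      from M.diff_indep_normal[OF this \<sigma>(1) \<sigma>(1) dist dist] that \<sigma>(2)
      have "distributed M lborel (\<lambda>\<omega>. \<omega> l - \<omega> k) (normal_density 0 e)" by simp
      then have D: "distr M lborel (\<lambda>\<omega>. \<omega> l - \<omega> k) = density lborel (normal_density 0 e)"
        and [measurable]: "(\<lambda>\<omega>. \<omega> l - \<omega> k) \<in> borel_measurable M"
        by (auto simp: distributed_def)
      have "(LINT \<omega>|M. h (\<omega> l - \<omega> k)) = (LINT t|distr M lborel (\<lambda>\<omega>. \<omega> l - \<omega> k). h t)"
        by (subst integral_distr) auto
      also have "\<dots> = I"
        unfolding D I_def by (subst integral_density) (auto simp: scaleR_conv_of_real)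
      finally show ?thesis .
    qed
    have hi: "integrable M (\<lambda>\<omega>. h (\<omega> l - \<omega> k))" if "l < Suc n" "k < Suc n" for l k
    proof (rule M.integrable_const_bound[where B=C])
      show "(\<lambda>\<omega>. h (\<omega> l - \<omega> k)) \<in> borel_measurable M"
        using rv[OF that(1)] rv[OF that(2)] by measurable
    qed (simp add: hC)
    define Z where "Z \<omega> = (\<Sum>l<Suc n. \<Sum>k<Suc n. h (\<omega> l - \<omega> k))" for \<omega> :: "nat \<Rightarrow> real"
    have Z: "Z \<omega> \<in> \<real>" "0 \<le> Re (Z \<omega>)" for \<omega>
    proof -
      have "Z \<omega> = (\<Sum>l<Suc n. \<Sum>k<Suc n. cis (- (w * \<omega> l)) * cnj (cis (- (w * \<omega> k))) * \<psi> (\<omega> l - \<omega> k))"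
        unfolding Z_def h_def
        by (intro sum.cong refl) (simp add: cis_cnj cis_mult algebra_simps)
      then show "Z \<omega> \<in> \<real>" "0 \<le> Re (Z \<omega>)"
        using pd[unfolded positive_definite_def, rule_format, where n="Suc n" and y=\<omega> and a="\<lambda>l. cis (- (w * \<omega> l))"] by auto
    qed
    have Zi: "integrable M Z"
      unfolding Z_def by (intro Bochner_Integration.integrable_sum hi) auto
    define D where "D = (\<Sum>l<Suc n. (LINT \<omega>|M. h (\<omega> l - \<omega> l)))"
    have "(LINT \<omega>|M. Z \<omega>) = (\<Sum>l<Suc n. \<Sum>k<Suc n. (LINT \<omega>|M. h (\<omega> l - \<omega> k)))"
      unfolding Z_def
      by (subst Bochner_Integration.integral_sum, intro Bochner_Integration.integrable_sum hi, simp, simp,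
          intro sum.cong refl Bochner_Integration.integral_sum hi) auto
    also have "\<dots> = (\<Sum>l<Suc n. (LINT \<omega>|M. h (\<omega> l - \<omega> l)) + of_nat n * I)"
    proof (intro sum.cong refl)
      fix l assume l: "l \<in> {..<Suc n}"
      have "(\<Sum>k<Suc n. (LINT \<omega>|M. h (\<omega> l - \<omega> k))) = (LINT \<omega>|M. h (\<omega> l - \<omega> l)) + (\<Sum>k\<in>{..<Suc n} - {l}. (LINT \<omega>|M. h (\<omega> l - \<omega> k)))"
        using l by (intro sum.remove) auto
      also have "(\<Sum>k\<in>{..<Suc n} - {l}. (LINT \<omega>|M. h (\<omega> l - \<omega> k))) = (\<Sum>k\<in>{..<Suc n} - {l}. I)"
        using l by (intro sum.cong refl off) auto
      also have "\<dots> = of_nat n * I" using l by simp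
      finally show "(\<Sum>k<Suc n. (LINT \<omega>|M. h (\<omega> l - \<omega> k))) = (LINT \<omega>|M. h (\<omega> l - \<omega> l)) + of_nat n * I" .
    qed
    also have "\<dots> = of_nat (Suc n * n) * I + D"
      unfolding D_def sum.distrib by (simp add: mult.assoc algebra_simps)
    finally have eq: "(LINT \<omega>|M. Z \<omega>) = of_nat (Suc n * n) * I + D" .
    have "norm (LINT \<omega>|M. h (\<omega> l - \<omega> l)) \<le> C" for l
      using hC[of 0] by (simp add: M.prob_space)
    then have "norm D \<le> (\<Sum>l<Suc n. C)"
      unfolding D_def by (intro order_trans[OF norm_sum] sum_mono) auto
    then have D: "norm D \<le> real (Suc n) * C" by simp
    have "0 \<le> (LINT \<omega>|M. Re (Z \<omega>))" by (intro integral_nonneg_AE) (simp add: Z)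
    then have "0 \<le> Re (LINT \<omega>|M. Z \<omega>)" using Zi by simp
    moreover have "(LINT \<omega>|M. Im (Z \<omega>)) = 0"
      using Z(1) by (simp add: complex_is_Real_iff)
    then have "Im (LINT \<omega>|M. Z \<omega>) = 0" using Zi by simp
    ultimately show ?thesis using D unfolding eq by blast
  qed
  have bound: "- C \<le> real n * Re I" "real n * \<bar>Im I\<bar> \<le> C" for n
  proof -
    obtain D where D: "norm D \<le> real (Suc n) * C" "0 \<le> Re (of_nat (Suc n * n) * I + D)" "Im (of_nat (Suc n * n) * I + D) = 0"
      using key by blast
    have nat: "Re (of_nat m * I) = real m * Re I" "Im (of_nat m * I) = real m * Im I" for m by simp_all
    have "- (real (Suc n) * C) \<le> real (Suc n * n) * Re I"
      using D(1,2) complex_Re_le_cmod[of D] unfolding plus_complex.simps nat by linarith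
    then have "real (Suc n) * (- C) \<le> real (Suc n) * (real n * Re I)" by (simp only: of_nat_mult mult.assoc minus_mult_right)
    then show "- C \<le> real n * Re I" by (rule mult_left_le_imp_le) simp
    have "\<bar>real (Suc n * n) * Im I\<bar> \<le> real (Suc n) * C"
      using D(1,3) abs_Im_le_cmod[of D] unfolding plus_complex.simps nat by linarith
    then have "real (Suc n) * (real n * \<bar>Im I\<bar>) \<le> real (Suc n) * C" by (simp only: of_nat_mult mult.assoc abs_mult abs_of_nat)
    then show "real n * \<bar>Im I\<bar> \<le> C" by (rule mult_left_le_imp_le) simp
  qed
  have "0 \<le> Re I"
  proof (rule ccontr)
    assume "\<not> 0 \<le> Re I"
    then obtain n where "C < real n * (- Re I)"
      using reals_Archimedean3[of "- Re I"] by auto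
    with bound(1)[of n] show False by simp
  qed
  moreover have "Im I = 0"
  proof (rule ccontr)
    assume "Im I \<noteq> 0"
    then obtain n where "C < real n * \<bar>Im I\<bar>"
      using reals_Archimedean3[of "\<bar>Im I\<bar>"] by auto
    with bound(2)[of n] show False by simp
  qed
  ultimately show "0 \<le> Re (LINT t|lborel. of_real (normal_density 0 e t) * (\<psi> t * cis (- (w * t))))"
    and "Im (LINT t|lborel. of_real (normal_density 0 e t) * (\<psi> t * cis (- (w * t)))) = 0"
    by (simp_all add: I_def h_def)
qed

text \<open>The transform of a Gaussian of width e centred at w is a Gaussian of width 1/e times the
  phase e^(-iwt), so averages of \<open>g\<close> are the integrals treated in
  \<open>positive_definite_gauss_average\<close>.\<close>

lemma fourier_pd_gauss_average:
  assumes pd: "positive_definite \<psi>" and fg: "is_fourier_L2 \<psi> g" and e: "0 < e"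
  shows "0 \<le> Re (LINT \<xi>|lborel. g \<xi> * of_real (normal_density 0 e (\<xi> - w)))"
    and "Im (LINT \<xi>|lborel. g \<xi> * of_real (normal_density 0 e (\<xi> - w))) = 0"
proof -
  have \<psi>: "sq_int \<psi>" using fg by (simp add: is_fourier_L2_def)
  note [measurable] = sq_int_measurable[OF \<psi>]
  let ?\<phi> = "\<lambda>\<xi>. complex_of_real (normal_density 0 e (\<xi> - w))"
  have \<phi>: "integrable lborel ?\<phi>" by (simp add: integrable_normal_density_shift e)
  have nd: "normal_density 0 e \<xi> = 1 / (e * sqrt (2 * pi)) * gauss (1 / e) \<xi>" for \<xi>
    using e by (simp add: normal_density_def gauss_def real_sqrt_mult power_divide field_simps)
  have "FT ?\<phi> t = of_real (1 / e) * (of_real (normal_density 0 (1 / e) t) * cis (- (w * t)))" for t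
  proof -
    have "(LINT \<xi>|lborel. ?\<phi> \<xi> * cis (- (t * \<xi>))) = \<bar>1\<bar> *\<^sub>R (LINT \<xi>|lborel. ?\<phi> (w + 1 * \<xi>) * cis (- (t * (w + 1 * \<xi>))))"
      by (rule lborel_integral_real_affine) simp
    also have "\<dots> = (LINT \<xi>|lborel. (of_real (1 / (e * sqrt (2 * pi))) * cis (- (w * t))) * (of_real (gauss (1 / e) \<xi>) * cis (- t * \<xi>)))"
    proof -
      have "cis (- (t * (w + 1 * \<xi>))) = cis (- (w * t)) * cis (- t * \<xi>)" for \<xi>
        by (simp add: cis_mult algebra_simps)
      then show ?thesis by (simp add: nd mult_ac)
    qed
    also have "\<dots> = (of_real (1 / (e * sqrt (2 * pi))) * cis (- (w * t))) * of_real (2 * pi * normal_density 0 (1 / e) (- t))"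
      by (simp only: integral_mult_right_zero gauss_FT e zero_less_divide_1_iff)
    also have "normal_density 0 (1 / e) (- t) = normal_density 0 (1 / e) t" by (simp add: normal_density_def)
    finally have "FT ?\<phi> t = of_real (1 / sqrt (2 * pi) * (1 / (e * sqrt (2 * pi))) * (2 * pi)) * (of_real (normal_density 0 (1 / e) t) * cis (- (w * t)))"
      unfolding FT_def by (simp only: of_real_mult mult_ac)
    also have "1 / sqrt (2 * pi) * (1 / (e * sqrt (2 * pi))) * (2 * pi) = 1 / e"
      using e by (simp add: field_simps)
    finally show ?thesis .
  qed
  then have "(LINT \<xi>|lborel. g \<xi> * ?\<phi> \<xi>) = (LINT t|lborel. of_real (1 / e) * (of_real (normal_density 0 (1 / e) t) * (\<psi> t * cis (- (w * t)))))"
    unfolding is_fourier_L2_pairing[OF fg \<phi> sq_int_normal_density[OF e]] by (simp add: mult_ac)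
  also have "\<dots> = of_real (1 / e) * (LINT t|lborel. of_real (normal_density 0 (1 / e) t) * (\<psi> t * cis (- (w * t))))"
    by (rule integral_mult_right_zero)
  finally have eq: "(LINT \<xi>|lborel. g \<xi> * ?\<phi> \<xi>) = of_real (1 / e) * (LINT t|lborel. of_real (normal_density 0 (1 / e) t) * (\<psi> t * cis (- (w * t))))" .
  show "0 \<le> Re (LINT \<xi>|lborel. g \<xi> * ?\<phi> \<xi>)" "Im (LINT \<xi>|lborel. g \<xi> * ?\<phi> \<xi>) = 0"
    unfolding eq using positive_definite_gauss_average[OF pd, of "1 / e" w] e by (simp_all del: of_real_divide)
qed

text \<open>Continuous tests reach indicators of closed sets in the limit, and by inner regularity
  the set where u < 0 is exhausted by closed subsets up to arbitrarily small measure. Each such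
  subset must be null.\<close>

lemma AE_nonneg_of_continuous_tests:
  fixes u :: "real \<Rightarrow> real"
  assumes u: "integrable lborel u"
    and test: "\<And>\<eta>. continuous_on UNIV \<eta> \<Longrightarrow> (\<And>x. 0 \<le> \<eta> x) \<Longrightarrow> (\<And>x. \<eta> x \<le> (1::real)) \<Longrightarrow> 0 \<le> (LINT x|lborel. u x * \<eta> x)"
  shows "AE x in lborel. 0 \<le> u x"
proof -
  have [measurable]: "u \<in> borel_measurable borel" using u by auto
  have closed: "0 \<le> (LINT x|lborel. u x * indicator T x)" if T: "closed T" "T \<noteq> {}" for T
  proof (rule LIMSEQ_le_const)
    let ?\<eta> = "\<lambda>n x. max 0 (1 - real n * infdist x T)"
    have [measurable]: "T \<in> sets borel" using T by auto
    show "(\<lambda>n. LINT x|lborel. u x * ?\<eta> n x) \<longlonglongrightarrow> (LINT x|lborel. u x * indicator T x)"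
    proof (rule integral_dominated_convergence[where w="\<lambda>x. \<bar>u x\<bar>"])
      show "AE x in lborel. (\<lambda>n. u x * ?\<eta> n x) \<longlonglongrightarrow> u x * indicator T x"
      proof (intro always_eventually allI tendsto_mult tendsto_const)
        fix x
        show "(\<lambda>n. ?\<eta> n x) \<longlonglongrightarrow> indicator T x"
        proof (cases "x \<in> T")
          case False
          then have d: "0 < infdist x T" using T by (simp add: infdist_pos_not_in_closed)
          obtain N where N: "1 < real N * infdist x T" using reals_Archimedean3[OF d] by blast
          have "?\<eta> n x = 0" if "N \<le> n" for n
          proof -
            have "real N * infdist x T \<le> real n * infdist x T" using d that by (intro mult_right_mono) auto
            then show ?thesis using N by simp
          qed
          then show ?thesis using False by (intro tendsto_eventually) (auto simp: eventually_sequentially)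
        qed (simp add: T)
      qed
      show "AE x in lborel. norm (u x * ?\<eta> n x) \<le> \<bar>u x\<bar>" for n
        by (auto simp: abs_mult infdist_nonneg intro!: mult_left_le)
      have "?\<eta> n \<in> borel_measurable borel" for n
        by (intro borel_measurable_continuous_onI continuous_intros)
      then show "(\<lambda>x. u x * ?\<eta> n x) \<in> borel_measurable lborel" for n by measurable
    qed (use u in auto)
    show "\<exists>N. \<forall>n\<ge>N. 0 \<le> (LINT x|lborel. u x * ?\<eta> n x)"
      by (intro exI[of _ 0] allI impI test continuous_intros) (auto simp: infdist_nonneg)
  qed
  define N where "N = {x. u x < 0}"
  have N [measurable]: "N \<in> sets borel" unfolding N_def by measurable
  have small: "emeasure lborel N \<le> ennreal e" if e: "0 < e" for e
  proof -
    have "N \<in> sets lebesgue" by simp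
    then obtain T where T: "closed T" "T \<subseteq> N" "emeasure lebesgue (N - T) < ennreal e"
      using sets_lebesgue_inner_closed[OF _ e] by metis
    have [measurable]: "T \<in> sets borel" using T by auto
    have "emeasure lborel T = 0"
    proof (cases "T = {}")
      case False
      have I: "integrable lborel (\<lambda>x. - u x * indicator T x)" using u by (intro integrable_real_mult_indicator) auto
      have nn: "0 \<le> - u x * indicator T x" for x using T(2) by (auto simp: N_def indicator_def)
      \<comment> \<open>Together with \<open>closed\<close> this forces the integral to vanish,
        although the integrand is strictly positive on T.\<close>
      then have "0 \<le> (LINT x|lborel. - u x * indicator T x)" by (intro integral_nonneg_AE) auto
      then have "(LINT x|lborel. - u x * indicator T x) = 0"
        using closed[OF T(1) False] by simp
      then have "AE x in lborel. - u x * indicator T x = 0"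
        using integral_nonneg_eq_0_iff_AE[OF I] nn by simp
      then have "AE x in lborel. x \<notin> T"
        by eventually_elim (use T(2) in \<open>auto simp: N_def indicator_def split: if_splits\<close>)
      then show ?thesis by (simp add: AE_iff_null_sets[symmetric] null_setsD1)
    qed simp
    then have "T \<in> null_sets lborel" by auto
    then have "emeasure lborel N = emeasure lborel (N - T)"
      by (intro emeasure_Diff_null_set[symmetric]) auto
    also have "\<dots> = emeasure lebesgue (N - T)" by simp
    also have "\<dots> \<le> ennreal e" using T(3) by (rule less_imp_le)
    finally show ?thesis .
  qed
  have "emeasure lborel N = 0"
  proof -
    have "emeasure lborel N \<le> 0" by (rule ennreal_le_epsilon) (simp add: small)
    then show ?thesis by simp
  qed
  then have "AE x in lborel. x \<notin> N" by (intro AE_not_in) auto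
  then show ?thesis by eventually_elim (simp add: N_def not_less)
qed

text \<open>A test function is replaced by its Gaussian smoothings \<open>A n\<close>; Fubini moves
  the kernel onto \<open>g\<close>, where the averages \<open>J n\<close> are known to be real and
  nonnegative. The conclusion expresses "real and nonnegative" in one equation.\<close>

lemma fourier_pd_nonneg:
  assumes pd: "positive_definite \<psi>" and fg: "is_fourier_L2 \<psi> g" and g: "integrable lborel g"
  shows "AE \<xi> in lborel. g \<xi> = of_real (norm (g \<xi>))"
proof -
  have [measurable]: "g \<in> borel_measurable borel" using g by auto
  have test: "0 \<le> Re (LINT \<xi>|lborel. g \<xi> * of_real (\<eta> \<xi>)) \<and> Im (LINT \<xi>|lborel. g \<xi> * of_real (\<eta> \<xi>)) = 0"
    if \<eta>: "continuous_on UNIV \<eta>" "\<And>x. 0 \<le> \<eta> x" "\<And>x. \<eta> x \<le> 1" for \<eta> :: "real \<Rightarrow> real"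
  proof -
    have [measurable]: "\<eta> \<in> borel_measurable borel" by (rule borel_measurable_continuous_onI[OF \<eta>(1)])
    define A where "A n \<xi> = (LINT w|lborel. complex_of_real (\<eta> w) * of_real (normal_density 0 (1 / real (Suc n)) (w - \<xi>)))" for n \<xi>
    define J where "J n w = (LINT \<xi>|lborel. g \<xi> * of_real (normal_density 0 (1 / real (Suc n)) (\<xi> - w)))" for n w
    have [measurable]: "A n \<in> borel_measurable borel" for n unfolding A_def by measurable
    have A_norm: "norm (A n \<xi>) \<le> 1" for n \<xi>
    proof -
      let ?N = "\<lambda>w. normal_density 0 (1 / real (Suc n)) (w - \<xi>)"
      have N: "integrable lborel ?N" by (rule integrable_normal_density_shift) simp
      have "integrable lborel (\<lambda>w. complex_of_real (\<eta> w) * of_real (?N w))"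
        using \<eta> by (intro Bochner_Integration.integrable_bound[OF N]) (auto simp: norm_mult intro!: mult_left_le_one_le)
      then have "norm (A n \<xi>) \<le> (LINT w|lborel. ?N w)"
        unfolding A_def using \<eta>
        by (intro order_trans[OF integral_norm_bound] integral_mono integrable_norm N) (auto simp: norm_mult intro!: mult_left_le_one_le)
      also have "\<dots> = 1"
      proof -
        have "(\<lambda>w. normal_density 0 (1 / real (Suc n)) (w - \<xi>)) = normal_density \<xi> (1 / real (Suc n))"
          by (simp add: normal_density_def fun_eq_iff)
        then show ?thesis by (simp only:) (rule integral_normal_density, simp)
      qed
      finally show ?thesis .
    qed
    have lim: "(\<lambda>n. LINT \<xi>|lborel. g \<xi> * A n \<xi>) \<longlonglongrightarrow> (LINT \<xi>|lborel. g \<xi> * of_real (\<eta> \<xi>))"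
    proof (rule integral_dominated_convergence[where w="\<lambda>\<xi>. norm (g \<xi>)"])
      show "AE \<xi> in lborel. (\<lambda>n. g \<xi> * A n \<xi>) \<longlonglongrightarrow> g \<xi> * of_real (\<eta> \<xi>)"
      proof (intro always_eventually allI tendsto_mult tendsto_const)
        fix \<xi>
        show "(\<lambda>n. A n \<xi>) \<longlonglongrightarrow> of_real (\<eta> \<xi>)"
          unfolding A_def
        proof (rule approx_identity_bounded[where C=1])
          show "isCont (\<lambda>x. complex_of_real (\<eta> x)) \<xi>"
            using \<eta>(1) by (intro continuous_intros) (simp add: continuous_on_eq_continuous_at)
        qed (use \<eta> in auto)
      qed
    qed (use g A_norm in \<open>auto simp: norm_mult intro!: mult_left_le\<close>)
    have swap: "(LINT \<xi>|lborel. g \<xi> * A n \<xi>) = (LINT w|lborel. of_real (\<eta> w) * J n w)" for n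
    proof -
      let ?N = "\<lambda>u. normal_density 0 (1 / real (Suc n)) u"
      have Ni: "(\<integral>\<^sup>+w. ennreal (?N (w - \<xi>)) \<partial>lborel) = 1" for \<xi>
        by (rule nn_integral_normal_density_shift') simp
      have I: "integrable (lborel \<Otimes>\<^sub>M lborel) (\<lambda>(\<xi>, w). g \<xi> * (of_real (\<eta> w) * of_real (?N (w - \<xi>))))"
      proof (rule integrableI_bounded)
        have "(\<integral>\<^sup>+p. ennreal (norm (case p of (\<xi>, w) \<Rightarrow> g \<xi> * (of_real (\<eta> w) * of_real (?N (w - \<xi>))))) \<partial>(lborel \<Otimes>\<^sub>M lborel))
          \<le> (\<integral>\<^sup>+p. ennreal (norm (g (fst p))) * ennreal (?N (snd p - fst p)) \<partial>(lborel \<Otimes>\<^sub>M lborel))"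
          using \<eta> by (intro nn_integral_mono)
            (auto simp: norm_mult ennreal_mult[symmetric] intro!: ennreal_leI mult_left_mono mult_left_le_one_le)
        also have "\<dots> = (\<integral>\<^sup>+\<xi>. ennreal (norm (g \<xi>)) \<partial>lborel)"
          by (subst lborel.nn_integral_fst[symmetric]) (auto simp: nn_integral_cmult Ni simp del: of_nat_Suc)
        also have "\<dots> < \<infinity>" using g by (simp add: integrable_iff_bounded)
        finally show "(\<integral>\<^sup>+p. ennreal (norm (case p of (\<xi>, w) \<Rightarrow> g \<xi> * (of_real (\<eta> w) * of_real (?N (w - \<xi>))))) \<partial>(lborel \<Otimes>\<^sub>M lborel)) < \<infinity>" .
      qed measurable
      have "(LINT \<xi>|lborel. g \<xi> * A n \<xi>) = (LINT \<xi>|lborel. LINT w|lborel. g \<xi> * (of_real (\<eta> w) * of_real (?N (w - \<xi>))))"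
        unfolding A_def by (simp only: integral_mult_right_zero)
      also have "\<dots> = (LINT w|lborel. LINT \<xi>|lborel. g \<xi> * (of_real (\<eta> w) * of_real (?N (w - \<xi>))))"
        by (rule lborel_pair.Fubini_integral[symmetric]) (use I in auto)
      also have "\<dots> = (LINT w|lborel. LINT \<xi>|lborel. of_real (\<eta> w) * (g \<xi> * of_real (?N (\<xi> - w))))"
        by (intro Bochner_Integration.integral_cong refl) (simp add: normal_density_commute[of _ "_" "_"] mult_ac)
      also have "\<dots> = (LINT w|lborel. of_real (\<eta> w) * J n w)"
        unfolding J_def by (simp only: integral_mult_right_zero)
      finally show ?thesis .
    qed
    have J: "0 \<le> Re (J n w)" "Im (J n w) = 0" for n w
      unfolding J_def by (rule fourier_pd_gauss_average[OF pd fg]; simp)+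
    have Jr: "J n w = of_real (Re (J n w))" for n w by (simp add: complex_eq_iff J)
    have "(LINT w|lborel. of_real (\<eta> w) * J n w) = of_real (LINT w|lborel. \<eta> w * Re (J n w))" for n
      by (subst Jr) (simp flip: of_real_mult)
    then have "0 \<le> Re (LINT \<xi>|lborel. g \<xi> * A n \<xi>) \<and> Im (LINT \<xi>|lborel. g \<xi> * A n \<xi>) = 0" for n
      using \<eta> J by (simp add: swap integral_nonneg_AE)
    then show ?thesis
      using LIMSEQ_le_const[OF tendsto_Re[OF lim], of 0] tendsto_Im[OF lim] by (auto simp: LIMSEQ_const_iff)
  qed
  have gx: "integrable lborel (\<lambda>\<xi>. g \<xi> * complex_of_real (\<eta> \<xi>))"
    if "continuous_on UNIV \<eta>" "\<And>x. 0 \<le> \<eta> x" "\<And>x. \<eta> x \<le> 1" for \<eta> :: "real \<Rightarrow> real"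
  proof -
    have [measurable]: "\<eta> \<in> borel_measurable borel" by (rule borel_measurable_continuous_onI[OF that(1)])
    show ?thesis using that
      by (intro Bochner_Integration.integrable_bound[OF g]) (auto simp: norm_mult intro!: mult_left_le)
  qed
  have Re_eq: "(LINT \<xi>|lborel. Re (g \<xi>) * \<eta> \<xi>) = Re (LINT \<xi>|lborel. g \<xi> * of_real (\<eta> \<xi>))"
    and Im_eq: "(LINT \<xi>|lborel. Im (g \<xi>) * \<eta> \<xi>) = Im (LINT \<xi>|lborel. g \<xi> * of_real (\<eta> \<xi>))"
    if "continuous_on UNIV \<eta>" "\<And>x. 0 \<le> \<eta> x" "\<And>x. \<eta> x \<le> 1" for \<eta> :: "real \<Rightarrow> real"
    using integral_Re[OF gx[OF that]] integral_Im[OF gx[OF that]] by simp_all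
  \<comment> \<open>Testing both signs of the imaginary part shows that it vanishes almost
    everywhere.\<close>
  have "AE \<xi> in lborel. 0 \<le> Re (g \<xi>)"
    by (rule AE_nonneg_of_continuous_tests) (use g test Re_eq in auto)
  moreover have "AE \<xi> in lborel. 0 \<le> Im (g \<xi>)"
    by (rule AE_nonneg_of_continuous_tests) (use g test Im_eq in auto)
  moreover have "AE \<xi> in lborel. 0 \<le> - Im (g \<xi>)"
    by (rule AE_nonneg_of_continuous_tests) (use g test Im_eq in auto)
  ultimately show ?thesis
  proof eventually_elim
    case (elim \<xi>)
    then have "g \<xi> = of_real (Re (g \<xi>))" "0 \<le> Re (g \<xi>)" by (auto simp: complex_eq_iff)
    then show ?case by (metis abs_of_nonneg norm_of_real)
  qed
qed

section \<open>Norm equivalences\<close>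

lemma l2_partial_sums:
  assumes "l2_seq c"
  shows "(\<lambda>N. L2_set (\<lambda>j. norm (c j)) {- int N..int N}) \<longlonglongrightarrow> l2_norm c"
    and "finite F \<Longrightarrow> L2_set (\<lambda>j. norm (c j)) F \<le> l2_norm c"
proof -
  have "((\<lambda>j. (norm (c j))^2) has_sum (\<Sum>\<^sub>\<infinity>j. (norm (c j))^2)) UNIV"
    using assms unfolding l2_seq_def by (rule has_sum_infsum)
  then have "(sum (\<lambda>j. (norm (c j))^2) \<longlongrightarrow> (\<Sum>\<^sub>\<infinity>j. (norm (c j))^2)) (finite_subsets_at_top UNIV)"
    by (simp add: has_sum_def)
  \<comment> \<open>Symmetric intervals eventually contain any given finite set, so they compute the
    unordered sum.\<close>
  moreover have "filterlim (\<lambda>N. {- int N..int N}) (finite_subsets_at_top UNIV) sequentially"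
  proof (rule filterlim_finite_subsets_at_top[THEN iffD2], intro allI impI)
    fix X :: "int set" assume X: "finite X \<and> X \<subseteq> UNIV"
    then obtain k where k: "\<forall>i\<in>X. \<bar>i\<bar> \<le> k"
      by (metis finite_imageI image_eqI Max_ge)
    show "\<forall>\<^sub>F N in sequentially. finite {- int N..int N} \<and> X \<subseteq> {- int N..int N} \<and> {- int N..int N} \<subseteq> UNIV"
      using eventually_ge_at_top[of "nat k"] by eventually_elim (use k in \<open>force simp: abs_le_iff\<close>)
  qed
  ultimately have "(\<lambda>N. \<Sum>j\<in>{- int N..int N}. (norm (c j))^2) \<longlonglongrightarrow> (\<Sum>\<^sub>\<infinity>j. (norm (c j))^2)"
    by (rule filterlim_compose)
  then show "(\<lambda>N. L2_set (\<lambda>j. norm (c j)) {- int N..int N}) \<longlonglongrightarrow> l2_norm c"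
    unfolding L2_set_def l2_norm_def by (rule tendsto_real_sqrt)
  show "L2_set (\<lambda>j. norm (c j)) F \<le> l2_norm c" if "finite F"
    unfolding L2_set_def l2_norm_def using assms that
    by (intro real_sqrt_le_mono finite_sum_le_infsum) (auto simp: l2_seq_def)
qed

lemma l2_norm_bound:
  assumes "\<And>F. finite F \<Longrightarrow> L2_set (\<lambda>j. norm (c j)) F \<le> B" and B: "0 \<le> B"
  shows "l2_seq c" "l2_norm c \<le> B"
proof -
  have *: "(\<Sum>j\<in>F. (norm (c j))^2) \<le> B^2" if "finite F" for F
    using assms(1)[OF that] B by (metis L2_set_def real_sqrt_le_iff real_sqrt_abs abs_of_nonneg)
  show 1: "l2_seq c"
    unfolding l2_seq_def
    by (rule nonneg_bdd_above_summable_on) (auto intro!: bdd_aboveI2[where M="B^2"] *)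
  have "(\<Sum>\<^sub>\<infinity>j. (norm (c j))^2) \<le> B^2"
    using 1 * unfolding l2_seq_def by (intro infsum_le_finite_sums) auto
  then show "l2_norm c \<le> B"
    unfolding l2_norm_def using B by (metis real_sqrt_le_iff real_sqrt_abs abs_of_nonneg)
qed

lemma L2_set_square: "(L2_set f F)^2 = (\<Sum>j\<in>F. (f j)^2)"
  by (simp add: L2_set_def sum_nonneg)

section \<open>Finite combinations of translates and their pairings\<close>

lemma sq_int_shift:
  assumes f: "sq_int f"
  shows "sq_int (\<lambda>t. f (t - a))"
proof -
  note [measurable] = sq_int_measurable[OF f]
  have "integrable lborel (\<lambda>t. (norm (f (- a + 1 * t)))^2)"
    using f by (intro lborel_integrable_real_affine) (auto simp: sq_int_def)
  then show ?thesis by (simp add: sq_int_def)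
qed

definition shift_comb :: "(real \<Rightarrow> complex) \<Rightarrow> (int \<Rightarrow> real) \<Rightarrow> int set \<Rightarrow> (int \<Rightarrow> complex) \<Rightarrow> real \<Rightarrow> complex" where
  "shift_comb \<psi> x F c t = (\<Sum>j\<in>F. c j * \<psi> (t - x j))"

lemma sq_int_scale: "sq_int f \<Longrightarrow> sq_int (\<lambda>t. c * f t)"
proof -
  assume f: "sq_int f"
  then have "sq_int (\<lambda>t. f t * c)" by (rule sq_int_mult_bounded[where C="norm c"]) auto
  then show ?thesis by (simp add: mult.commute)
qed

lemma sq_int_shift_comb: "sq_int \<psi> \<Longrightarrow> finite F \<Longrightarrow> sq_int (shift_comb \<psi> x F c)"
  unfolding shift_comb_def by (intro sq_int_sum sq_int_scale sq_int_shift)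

text \<open>Instead of transforming a translate of \<open>\<psi>\<close>, the test function is
  modulated: the modulation shifts \<open>FT \<phi>\<close>, and a change of variable moves the
  shift back onto \<open>\<psi>\<close>.\<close>

lemma shift_comb_pairing:
  assumes fg: "is_fourier_L2 \<psi> g" and int: "integrable lborel \<phi>" and sq: "sq_int \<phi>"
  shows "(LINT \<xi>|lborel. g \<xi> * expsum x F c \<xi> * \<phi> \<xi>) = (LINT t|lborel. shift_comb \<psi> x F c t * FT \<phi> t)"
proof -
  have \<psi>: "sq_int \<psi>" and g: "sq_int g" using fg by (auto simp: is_fourier_L2_def)
  note [measurable] = sq_int_measurable[OF sq] sq_int_measurable[OF \<psi>] sq_int_measurable[OF g]
  let ?\<phi> = "\<lambda>j \<xi>. \<phi> \<xi> * cis (- (x j * \<xi>))"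
  have i: "integrable lborel (?\<phi> j)" for j using integrable_cis[OF int] by simp
  have s: "sq_int (?\<phi> j)" for j by (rule sq_int_mult_bounded[OF sq, where C=1]) auto
  have "(LINT \<xi>|lborel. g \<xi> * expsum x F c \<xi> * \<phi> \<xi>) = (LINT \<xi>|lborel. (\<Sum>j\<in>F. c j * (g \<xi> * ?\<phi> j \<xi>)))"
    unfolding expsum_def by (simp add: sum_distrib_left sum_distrib_right mult_ac)
  also have "\<dots> = (\<Sum>j\<in>F. (LINT \<xi>|lborel. c j * (g \<xi> * ?\<phi> j \<xi>)))"
    by (intro Bochner_Integration.integral_sum integrable_mult_right sq_int_mult g s)
  also have "\<dots> = (\<Sum>j\<in>F. (LINT t|lborel. c j * (\<psi> (t - x j) * FT \<phi> t)))"
  proof (intro sum.cong refl)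
    fix j
    have FTj: "FT (?\<phi> j) t = FT \<phi> (t + x j)" for t
    proof -
      have "?\<phi> j \<xi> * cis (- (t * \<xi>)) = \<phi> \<xi> * cis (- ((t + x j) * \<xi>))" for \<xi>
        by (simp add: mult.assoc cis_mult algebra_simps)
      then show ?thesis unfolding FT_def by (simp only:)
    qed
    have "(LINT \<xi>|lborel. g \<xi> * ?\<phi> j \<xi>) = (LINT t|lborel. \<psi> t * FT \<phi> (t + x j))"
      by (simp only: is_fourier_L2_pairing[OF fg i s] FTj)
    also have "\<dots> = \<bar>1\<bar> *\<^sub>R (LINT t|lborel. \<psi> (- x j + 1 * t) * FT \<phi> (- x j + 1 * t + x j))"
      by (rule lborel_integral_real_affine) simp
    finally show "(LINT \<xi>|lborel. c j * (g \<xi> * ?\<phi> j \<xi>)) = (LINT t|lborel. c j * (\<psi> (t - x j) * FT \<phi> t))"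
      unfolding integral_mult_right_zero by simp
  qed
  also have "\<dots> = (LINT t|lborel. (\<Sum>j\<in>F. c j * (\<psi> (t - x j) * FT \<phi> t)))"
    by (intro Bochner_Integration.integral_sum[symmetric] integrable_mult_right sq_int_mult sq_int_shift \<psi> sq_int_FT int sq)
  also have "\<dots> = (LINT t|lborel. shift_comb \<psi> x F c t * FT \<phi> t)"
    unfolding shift_comb_def by (simp add: sum_distrib_left sum_distrib_right mult_ac)
  finally show ?thesis .
qed

lemma expsum_diff: "finite F \<Longrightarrow> G \<subseteq> F \<Longrightarrow> expsum x F c \<xi> - expsum x G c \<xi> = expsum x (F - G) c \<xi>"
  unfolding expsum_def by (simp add: sum_diff)

text \<open>M is the Riesz constant, K the energy constant of the amalgam weight, S an upper bound
  of |g| everywhere and d a lower bound on the torus. Riesz and energy bounds are assumed for finite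
  sums only; infinite ones are reached by limits.\<close>

locale interpolation_setting =
  fixes \<psi> g :: "real \<Rightarrow> complex" and x :: "int \<Rightarrow> real" and M K S d :: real
  assumes fg: "is_fourier_L2 \<psi> g"
    and g_int: "integrable lborel g"
    and g_nonneg: "AE \<xi> in lborel. g \<xi> = of_real (norm (g \<xi>))"
    and g_le: "\<And>\<xi>. norm (g \<xi>) \<le> S"
    and d: "0 < d" and g_ge: "\<And>\<xi>. \<xi> \<in> torus \<Longrightarrow> d \<le> norm (g \<xi>)"
    and M: "0 < M" and riesz: "\<And>F c. finite F \<Longrightarrow> L2_set (\<lambda>j. norm (c j)) F \<le> M * L2_norm (expsum_T x F c)"
    and K: "0 < K" and energy: "\<And>F c. finite F \<Longrightarrow>
      (\<integral>\<^sup>+\<xi>. ennreal (norm (g \<xi>) * (norm (expsum x F c \<xi>))^2) \<partial>lborel) \<le> ennreal (K * (\<Sum>j\<in>F. (norm (c j))^2))"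
begin

lemma psi_sq_int: "sq_int \<psi>" and g_sq_int: "sq_int g"
  using fg by (auto simp: is_fourier_L2_def)

lemma g_measurable [measurable]: "g \<in> borel_measurable borel"
  using g_int by auto

lemma S_pos: "0 < S"
  using g_le[of 0] g_ge[of 0] d by (auto simp: torus_def)

abbreviation nrm :: "int set \<Rightarrow> (int \<Rightarrow> complex) \<Rightarrow> real" where
  "nrm F c \<equiv> L2_set (\<lambda>j. norm (c j)) F"

text \<open>The continuous representative of \<^const>\<open>shift_comb\<close>.\<close>

definition cont_comb :: "int set \<Rightarrow> (int \<Rightarrow> complex) \<Rightarrow> real \<Rightarrow> complex" where
  "cont_comb F c a = FT (\<lambda>\<xi>. g \<xi> * expsum x F c \<xi>) (- a)"

text \<open>Cauchy-Schwarz for the measure |g| d\<xi>, with sqrt |g| attached to each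
  factor.\<close>

lemma energy_pairing:
  assumes F: "finite F" and G: "finite G"
  shows "(\<integral>\<^sup>+\<xi>. ennreal (norm (g \<xi> * expsum x F c \<xi> * cnj (expsum x G b \<xi>))) \<partial>lborel) \<le> ennreal (K * nrm F c * nrm G b)"
proof -
  let ?e = "\<lambda>F c \<xi>. complex_of_real (sqrt (norm (g \<xi>))) * expsum x F c \<xi>"
  have *: "(\<integral>\<^sup>+\<xi>. ennreal ((norm (?e F c \<xi>))^2) \<partial>lborel) \<le> ennreal ((sqrt K * nrm F c)^2)" if "finite F" for F c
    using energy[OF that, of c] K by (simp add: norm_mult power_mult_distrib L2_set_square)
  have "(\<integral>\<^sup>+\<xi>. ennreal (norm (?e F c \<xi>) * norm (?e G b \<xi>)) \<partial>lborel) \<le> ennreal ((sqrt K * nrm F c) * (sqrt K * nrm G b))"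
    by (rule nn_integral_Cauchy_Schwarz_bound) (use * F G K in auto)
  also have "(sqrt K * nrm F c) * (sqrt K * nrm G b) = K * nrm F c * nrm G b"
    using K by (simp add: algebra_simps flip: power2_eq_square)
  also have "(\<lambda>\<xi>. norm (?e F c \<xi>) * norm (?e G b \<xi>)) = (\<lambda>\<xi>. norm (g \<xi> * expsum x F c \<xi> * cnj (expsum x G b \<xi>)))"
    by (simp add: norm_mult fun_eq_iff algebra_simps flip: power2_eq_square)
  finally show ?thesis .
qed

lemma g_expsum_L1:
  assumes F: "finite F"
  shows "(\<integral>\<^sup>+\<xi>. ennreal (norm (g \<xi> * expsum x F c \<xi>)) \<partial>lborel) \<le> ennreal (K * nrm F c)"
    and "integrable lborel (\<lambda>\<xi>. g \<xi> * expsum x F c \<xi>)"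
proof -
  \<comment> \<open>The second sum in \<open>energy_pairing\<close> is taken to be a single
    exponential, which has modulus 1 and coefficient norm 1.\<close>
  show *: "(\<integral>\<^sup>+\<xi>. ennreal (norm (g \<xi> * expsum x F c \<xi>)) \<partial>lborel) \<le> ennreal (K * nrm F c)"
    using energy_pairing[OF F, of "{0}" c "\<lambda>_. 1"] by (simp add: expsum_def norm_mult L2_set_def)
  show "integrable lborel (\<lambda>\<xi>. g \<xi> * expsum x F c \<xi>)"
    by (rule integrable_bound_norm(1)[OF _ *]) (use K in auto)
qed

lemma cont_comb_pairing:
  assumes F: "finite F"
  shows "(\<Sum>k\<in>G. cnj (b k) * cont_comb F c (x k)) = of_real (1 / sqrt (2 * pi)) * (LINT \<xi>|lborel. g \<xi> * expsum x F c \<xi> * cnj (expsum x G b \<xi>))"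
  unfolding cont_comb_def using sum_FT_samples[OF g_expsum_L1(2)[OF F], where a="\<lambda>k. cnj (b k)" and x=x and F=G] by simp

text \<open>Duality: pairing the samples with themselves gives the square of their norm, which
  \<open>energy_pairing\<close> bounds linearly in that norm.\<close>

lemma cont_comb_samples_upper:
  assumes F: "finite F" and G: "finite G"
  shows "nrm G (\<lambda>k. cont_comb F c (x k)) \<le> K * nrm F c"
proof -
  let ?b = "\<lambda>k. cont_comb F c (x k)"
  have "complex_of_real ((nrm G ?b)^2) = (\<Sum>k\<in>G. cnj (?b k) * ?b k)"
    by (simp only: L2_set_square of_real_sum complex_norm_square mult.commute)
  also have "\<dots> = of_real (1 / sqrt (2 * pi)) * (LINT \<xi>|lborel. g \<xi> * expsum x F c \<xi> * cnj (expsum x G ?b \<xi>))"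
    by (rule cont_comb_pairing[OF F])
  finally have "norm (complex_of_real ((nrm G ?b)^2)) = 1 / sqrt (2 * pi) * norm (LINT \<xi>|lborel. g \<xi> * expsum x F c \<xi> * cnj (expsum x G ?b \<xi>))"
    by (simp add: norm_mult norm_divide)
  also have "\<dots> \<le> 1 * (K * nrm F c * nrm G ?b)"
  proof (intro mult_mono)
    have "1 \<le> sqrt (2 * pi)" using pi_ge_two by simp
    then show "1 / sqrt (2 * pi) \<le> 1" by simp
    show "norm (LINT \<xi>|lborel. g \<xi> * expsum x F c \<xi> * cnj (expsum x G ?b \<xi>)) \<le> K * nrm F c * nrm G ?b"
      using K by (intro integrable_bound_norm(2) energy_pairing F G) auto
  qed (use K in auto)
  finally have "nrm G ?b * nrm G ?b \<le> (K * nrm F c) * nrm G ?b"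
    by (simp only: norm_of_real abs_power2 power2_eq_square mult_1_left)
  then show ?thesis
    using K by (cases "nrm G ?b = 0") (auto simp: less_le intro: mult_right_le_imp_le[of _ "nrm G ?b"])
qed

lemma AE_torus: "AE \<xi> in lborel. \<xi> \<in> {-pi..pi} \<longrightarrow> \<xi> \<in> torus"
  using AE_lborel_singleton[of pi] by eventually_elim (auto simp: torus_def)

text \<open>Pairing the samples with c turns \<open>g >= 0\<close> into the energy integral of |g|
  |E|^2. Restricted to the torus it is at least d times the energy of E there, and the Riesz bound
  applied twice gives the factor M^2.\<close>

lemma cont_comb_samples_lower:
  assumes F: "finite F"
  shows "nrm F c \<le> M^2 * sqrt (2 * pi) / d * nrm F (\<lambda>k. cont_comb F c (x k))"
proof -
  let ?E = "expsum x F c"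
  let ?b = "\<lambda>k. cont_comb F c (x k)"
  have I: "integrable lborel (\<lambda>\<xi>. norm (g \<xi>) * (norm (?E \<xi>))^2)"
    using energy[OF F, of c] by (intro integrableI_bounded) (auto simp: abs_mult le_less_trans)
  have IE: "integrable lborel (\<lambda>\<xi>. (norm (expsum_T x F c \<xi>))^2)"
    using sq_int_expsum_T[of x F c] by (simp add: sq_int_def)
  have "d * (L2_norm (expsum_T x F c))^2 = (LINT \<xi>|lborel. d * (norm (expsum_T x F c \<xi>))^2)"
    unfolding L2_norm_square by simp
  also have "\<dots> \<le> (LINT \<xi>|lborel. norm (g \<xi>) * (norm (?E \<xi>))^2)"
  proof (rule integral_mono_AE)
    show "AE \<xi> in lborel. d * (norm (expsum_T x F c \<xi>))^2 \<le> norm (g \<xi>) * (norm (?E \<xi>))^2"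
      using AE_torus by eventually_elim (use g_ge in \<open>auto simp: expsum_T_def indicator_def intro!: mult_right_mono\<close>)
  qed (use I IE in auto)
  finally have 1: "d * (L2_norm (expsum_T x F c))^2 \<le> (LINT \<xi>|lborel. norm (g \<xi>) * (norm (?E \<xi>))^2)" .
  have "(LINT \<xi>|lborel. g \<xi> * ?E \<xi> * cnj (?E \<xi>)) = (LINT \<xi>|lborel. complex_of_real (norm (g \<xi>) * (norm (?E \<xi>))^2))"
  proof (rule integral_cong_AE)
    show "AE \<xi> in lborel. g \<xi> * ?E \<xi> * cnj (?E \<xi>) = complex_of_real (norm (g \<xi>) * (norm (?E \<xi>))^2)"
      using g_nonneg
    proof eventually_elim
      case (elim \<xi>)
      have "g \<xi> * ?E \<xi> * cnj (?E \<xi>) = of_real (norm (g \<xi>)) * of_real ((norm (?E \<xi>))^2)"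
        by (subst elim) (simp only: complex_norm_square mult.assoc)
      then show ?case by (simp only: of_real_mult)
    qed
  qed measurable
  also have "\<dots> = of_real (LINT \<xi>|lborel. norm (g \<xi>) * (norm (?E \<xi>))^2)"
    by (rule integral_complex_of_real)
  finally have 2: "norm (\<Sum>k\<in>F. cnj (c k) * ?b k) = (LINT \<xi>|lborel. norm (g \<xi>) * (norm (?E \<xi>))^2) / sqrt (2 * pi)"
    unfolding cont_comb_pairing[OF F] by (simp add: norm_mult norm_divide integral_nonneg_AE)
  have "norm (\<Sum>k\<in>F. cnj (c k) * ?b k) \<le> (\<Sum>k\<in>F. \<bar>norm (c k)\<bar> * \<bar>norm (?b k)\<bar>)"
    by (rule order_trans[OF norm_sum]) (simp add: norm_mult)
  also have "\<dots> \<le> nrm F c * nrm F ?b" by (rule L2_set_mult_ineq)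
  finally have 3: "d * (L2_norm (expsum_T x F c))^2 \<le> sqrt (2 * pi) * (nrm F c * nrm F ?b)"
    using 1 unfolding 2 by (simp add: field_simps)
  have "(nrm F c)^2 \<le> (M * L2_norm (expsum_T x F c))^2"
    by (intro power_mono riesz F) simp
  then have "d * (nrm F c)^2 \<le> M^2 * (d * (L2_norm (expsum_T x F c))^2)"
    using d by (simp add: power_mult_distrib mult.left_commute)
  also have "\<dots> \<le> M^2 * (sqrt (2 * pi) * (nrm F c * nrm F ?b))"
    by (intro mult_left_mono 3) simp
  finally have "nrm F c * nrm F c \<le> nrm F c * (M^2 * sqrt (2 * pi) / d * nrm F ?b)"
    using d by (simp add: field_simps power2_eq_square)
  then show ?thesis
    using d by (cases "nrm F c = 0") (auto simp: less_le intro: mult_left_le_imp_le[of "nrm F c"])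
qed

text \<open>With \<open>\<phi>\<close> the conjugate of \<open>g E\<close> cut off to [-pi, pi], the
  square of its norm equals the pairing of the combination with \<open>FT \<phi>\<close>. Since
  \<open>FT\<close> is a contraction, the norm of \<open>\<phi>\<close> is at most that of the
  combination.\<close>

lemma shift_comb_lower:
  assumes F: "finite F"
  shows "nrm F c \<le> M / d * L2_norm (shift_comb \<psi> x F c)"
proof -
  define \<phi> where "\<phi> \<xi> = cnj (g \<xi> * expsum_T x F c \<xi>)" for \<xi>
  have [measurable]: "\<phi> \<in> borel_measurable borel" unfolding \<phi>_def by measurable
  have gE: "sq_int (\<lambda>\<xi>. expsum_T x F c \<xi> * g \<xi>)"
    by (rule sq_int_mult_bounded[OF sq_int_expsum_T, where C=S]) (auto simp: g_le)
  have \<phi>: "sq_int \<phi>"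
    using gE by (simp add: sq_int_def \<phi>_def norm_mult mult.commute)
  have "integrable lborel (\<lambda>\<xi>. g \<xi> * expsum_T x F c \<xi>)"
    by (rule sq_int_mult[OF g_sq_int sq_int_expsum_T])
  then have \<phi>i: "integrable lborel \<phi>"
    unfolding \<phi>_def by (simp del: complex_cnj_mult)
  have "complex_of_real ((L2_norm \<phi>)^2) = (LINT \<xi>|lborel. complex_of_real ((norm (\<phi> \<xi>))^2))"
    unfolding L2_norm_square by (rule integral_complex_of_real[symmetric])
  also have "\<dots> = (LINT \<xi>|lborel. g \<xi> * expsum x F c \<xi> * \<phi> \<xi>)"
  proof (intro Bochner_Integration.integral_cong refl)
    fix \<xi>
    show "complex_of_real ((norm (\<phi> \<xi>))^2) = g \<xi> * expsum x F c \<xi> * \<phi> \<xi>"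
    proof (cases "\<xi> \<in> {-pi..pi}")
      case True
      have "complex_of_real ((norm (\<phi> \<xi>))^2) = \<phi> \<xi> * cnj (\<phi> \<xi>)" by (rule complex_norm_square)
      also have "cnj (\<phi> \<xi>) = g \<xi> * expsum x F c \<xi>" using True by (simp add: \<phi>_def expsum_T_def)
      finally show ?thesis by (simp only: mult.commute)
    qed (simp add: \<phi>_def expsum_T_def)
  qed
  also have "\<dots> = (LINT t|lborel. shift_comb \<psi> x F c t * FT \<phi> t)"
    by (rule shift_comb_pairing[OF fg \<phi>i \<phi>])
  finally have "norm (complex_of_real ((L2_norm \<phi>)^2)) \<le> L2_norm (shift_comb \<psi> x F c) * L2_norm (FT \<phi>)"
    by (simp only: sq_int_mult(2)[OF sq_int_shift_comb[OF psi_sq_int F] sq_int_FT(1)[OF \<phi>i \<phi>]])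
  also have "\<dots> \<le> L2_norm (shift_comb \<psi> x F c) * L2_norm \<phi>"
    by (intro mult_left_mono sq_int_FT \<phi>i \<phi>) simp
  finally have "L2_norm \<phi> * L2_norm \<phi> \<le> L2_norm (shift_comb \<psi> x F c) * L2_norm \<phi>"
    by (simp only: norm_of_real abs_power2 power2_eq_square mult_1_left)
  then have le: "L2_norm \<phi> \<le> L2_norm (shift_comb \<psi> x F c)"
    by (cases "L2_norm \<phi> = 0") (auto simp: less_le intro: mult_right_le_imp_le[of _ "L2_norm \<phi>"])
  have "(d * L2_norm (expsum_T x F c))^2 = (LINT \<xi>|lborel. d^2 * (norm (expsum_T x F c \<xi>))^2)"
    unfolding power_mult_distrib L2_norm_square by simp
  also have "\<dots> \<le> (LINT \<xi>|lborel. (norm (\<phi> \<xi>))^2)"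
  proof (rule integral_mono_AE)
    show "AE \<xi> in lborel. d^2 * (norm (expsum_T x F c \<xi>))^2 \<le> (norm (\<phi> \<xi>))^2"
      using AE_torus
      by eventually_elim
        (use g_ge d in \<open>auto simp: \<phi>_def norm_mult power_mult_distrib expsum_T_def indicator_def intro!: mult_right_mono power_mono\<close>)
  qed (use \<phi> sq_int_expsum_T[of x F c] in \<open>auto simp: sq_int_def\<close>)
  finally have "d * L2_norm (expsum_T x F c) \<le> L2_norm \<phi>"
    unfolding L2_norm_square[symmetric] by (rule power2_le_imp_le) simp
  with le have "L2_norm (expsum_T x F c) \<le> L2_norm (shift_comb \<psi> x F c) / d"
    using d by (simp add: field_simps)
  then have "M * L2_norm (expsum_T x F c) \<le> M * (L2_norm (shift_comb \<psi> x F c) / d)"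
    using M by (intro mult_left_mono) auto
  with riesz[OF F, of c] show ?thesis by simp
qed

text \<open>The Plancherel inequality leaves |g|^2 |E|^2, which is at most S |g| |E|^2.\<close>

lemma cont_comb_L2_upper:
  assumes F: "finite F"
  shows "(\<integral>\<^sup>+a. ennreal ((norm (cont_comb F c a))^2) \<partial>lborel) \<le> ennreal (S * K * (nrm F c)^2)"
proof -
  let ?h = "\<lambda>\<xi>. g \<xi> * expsum x F c \<xi>"
  have "(\<integral>\<^sup>+a. ennreal ((norm (FT ?h a))^2) \<partial>lborel) = ennreal \<bar>-1\<bar> * (\<integral>\<^sup>+a. ennreal ((norm (FT ?h (0 + (-1) * a)))^2) \<partial>lborel)"
    by (rule nn_integral_real_affine) auto
  then have "(\<integral>\<^sup>+a. ennreal ((norm (cont_comb F c a))^2) \<partial>lborel) = (\<integral>\<^sup>+a. ennreal ((norm (FT ?h a))^2) \<partial>lborel)"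
    by (simp add: cont_comb_def)
  also have "\<dots> \<le> (\<integral>\<^sup>+\<xi>. ennreal ((norm (?h \<xi>))^2) \<partial>lborel)"
    by (rule nn_integral_FT_le[OF g_expsum_L1(2)[OF F]])
  also have "\<dots> \<le> (\<integral>\<^sup>+\<xi>. ennreal S * ennreal (norm (g \<xi>) * (norm (expsum x F c \<xi>))^2) \<partial>lborel)"
  proof (intro nn_integral_mono)
    fix \<xi>
    have "norm (g \<xi>) * (norm (g \<xi>) * (norm (expsum x F c \<xi>))^2) \<le> S * (norm (g \<xi>) * (norm (expsum x F c \<xi>))^2)"
      by (intro mult_right_mono g_le) auto
    then show "ennreal ((norm (?h \<xi>))^2) \<le> ennreal S * ennreal (norm (g \<xi>) * (norm (expsum x F c \<xi>))^2)"
      using S_pos by (simp add: norm_mult power2_eq_square mult_ac ennreal_leI flip: ennreal_mult)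
  qed
  also have "\<dots> = ennreal S * (\<integral>\<^sup>+\<xi>. ennreal (norm (g \<xi>) * (norm (expsum x F c \<xi>))^2) \<partial>lborel)"
    by (rule nn_integral_cmult) measurable
  also have "\<dots> \<le> ennreal S * ennreal (K * (\<Sum>j\<in>F. (norm (c j))^2))"
    by (intro mult_left_mono energy F) simp
  also have "\<dots> = ennreal (S * K * (nrm F c)^2)"
    using S_pos K by (simp add: L2_set_square mult.assoc sum_nonneg flip: ennreal_mult)
  finally show ?thesis .
qed

section \<open>From finite combinations to elements of V\<close>

lemma in_V_repr_properties:
  assumes "in_V_repr \<psi> x c f"
  shows "l2_seq c" "continuous_on UNIV f" "sq_int f"
    and "(\<lambda>N. L2_norm (\<lambda>t. f t - shift_comb \<psi> x {- int N..int N} c t)) \<longlonglongrightarrow> 0"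
proof -
  let ?s = "\<lambda>N. shift_comb \<psi> x {- int N..int N} c"
  show "l2_seq c" and cont: "continuous_on UNIV f"
    using assms by (auto simp: in_V_repr_def)
  have [measurable]: "f \<in> borel_measurable borel" by (rule borel_measurable_continuous_onI[OF cont])
  have s: "sq_int (?s N)" for N by (rule sq_int_shift_comb[OF psi_sq_int]) simp
  note [measurable] = sq_int_measurable[OF s]
  have lim: "(\<lambda>N. \<integral>\<^sup>+t. ennreal ((norm (f t - ?s N t))^2) \<partial>lborel) \<longlonglongrightarrow> 0"
    using assms by (simp add: in_V_repr_def shift_comb_def)
  have "\<forall>\<^sub>F N in sequentially. (\<integral>\<^sup>+t. ennreal ((norm (f t - ?s N t))^2) \<partial>lborel) < 1"
    using lim by (rule order_tendstoD) simp
  then obtain N where "(\<integral>\<^sup>+t. ennreal ((norm (f t - ?s N t))^2) \<partial>lborel) < 1"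
    by (auto simp: eventually_sequentially)
  then have "sq_int (\<lambda>t. f t - ?s N t)"
    by (intro sq_int_bound(1)[where a=1]) (auto simp: less_imp_le)
  from sq_int_add_diff(1)[OF this s[of N]] show f: "sq_int f" by simp
  have "(\<lambda>N. (L2_norm (\<lambda>t. f t - ?s N t))^2) \<longlonglongrightarrow> 0"
    using lim by (simp add: nn_integral_sq_int[OF sq_int_add_diff(2)[OF f s]] flip: ennreal_0)
  then show "(\<lambda>N. L2_norm (\<lambda>t. f t - ?s N t)) \<longlonglongrightarrow> 0"
    using tendsto_real_sqrt by fastforce
qed

text \<open>The l2 norm of c outside [-m, m], written by Pythagoras to avoid a second infinite
  sum.\<close>

definition tail :: "(int \<Rightarrow> complex) \<Rightarrow> nat \<Rightarrow> real" where
  "tail c m = sqrt ((l2_norm c)^2 - (nrm {- int m..int m} c)^2)"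

lemma tail_tendsto: "l2_seq c \<Longrightarrow> tail c \<longlonglongrightarrow> 0"
proof -
  assume c: "l2_seq c"
  have "(\<lambda>m. sqrt ((l2_norm c)^2 - (nrm {- int m..int m} c)^2)) \<longlonglongrightarrow> sqrt ((l2_norm c)^2 - (l2_norm c)^2)"
    by (intro tendsto_intros l2_partial_sums c)
  then show ?thesis by (simp add: tail_def[abs_def])
qed

lemma nrm_diff_le_tail:
  assumes c: "l2_seq c" and mN: "m \<le> N"
  shows "nrm ({- int N..int N} - {- int m..int m}) c \<le> tail c m"
proof -
  have "(nrm {- int N..int N} c)^2 \<le> (l2_norm c)^2"
    by (intro power_mono l2_partial_sums c) auto
  then have "(nrm ({- int N..int N} - {- int m..int m}) c)^2 \<le> (l2_norm c)^2 - (nrm {- int m..int m} c)^2"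
    using mN unfolding L2_set_square by (subst sum_diff) auto
  then show ?thesis
    unfolding tail_def by (rule real_le_rsqrt)
qed

lemma cont_comb_diff:
  assumes "finite F" "G \<subseteq> F"
  shows "cont_comb F c a - cont_comb G c a = cont_comb (F - G) c a"
proof -
  have G: "finite G" using assms finite_subset by blast
  have "(LINT \<xi>|lborel. g \<xi> * expsum x F c \<xi> * cis (a * \<xi>)) - (LINT \<xi>|lborel. g \<xi> * expsum x G c \<xi> * cis (a * \<xi>))
     = (LINT \<xi>|lborel. g \<xi> * expsum x F c \<xi> * cis (a * \<xi>) - g \<xi> * expsum x G c \<xi> * cis (a * \<xi>))"
    by (intro Bochner_Integration.integral_diff[symmetric] integrable_cis g_expsum_L1 assms G)
  also have "\<dots> = (LINT \<xi>|lborel. g \<xi> * expsum x (F - G) c \<xi> * cis (a * \<xi>))"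
    by (simp add: expsum_diff[OF assms, symmetric] algebra_simps)
  finally show ?thesis
    unfolding cont_comb_def FT_def right_diff_distrib[symmetric] by simp
qed

text \<open>L2 convergence says nothing about the value at a, but it does pass through a Gaussian
  average at a. At fixed width the averages of f and of the m-th combination differ by at most K
  times the tail; as this bound does not depend on the width, it survives when the width shrinks to
  0.\<close>

lemma cont_comb_tendsto:
  assumes f: "in_V_repr \<psi> x c f"
  shows "(\<lambda>m. cont_comb {- int m..int m} c a) \<longlonglongrightarrow> f a"
proof -
  note V = in_V_repr_properties[OF f]
  let ?F = "\<lambda>m. {- int m..int m}"
  let ?s = "\<lambda>N. shift_comb \<psi> x (?F N) c"
  let ?h = "\<lambda>m \<xi>. g \<xi> * expsum x (?F m) c \<xi>"
  have s: "sq_int (?s N)" for N by (rule sq_int_shift_comb[OF psi_sq_int]) simp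
  have cont: "isCont f a" using V(2) by (simp add: continuous_on_eq_continuous_at)
  have tail0: "0 \<le> tail c m" for m
    using nrm_diff_le_tail[OF V(1), of m m] by simp
  have regularized: "norm (of_real (sqrt (2 * pi)) * (LINT t|lborel. f t * of_real (normal_density 0 e (t - a))) - (LINT \<xi>|lborel. ?h m \<xi> * wave e a \<xi>)) \<le> K * tail c m"
    if e: "0 < e" for e m
  proof -
    let ?W = "\<lambda>t. complex_of_real (normal_density 0 e (t - a))"
    have W: "sq_int ?W" by (rule sq_int_normal_density[OF e])
    have eq: "(LINT \<xi>|lborel. ?h N \<xi> * wave e a \<xi>) = of_real (sqrt (2 * pi)) * (LINT t|lborel. ?s N t * ?W t)" for N
      unfolding shift_comb_pairing[OF fg integrable_wave[OF e] sq_int_wave[OF e]]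
      by (subst integral_mult_right_zero[symmetric]) (simp add: FT_wave[OF e] mult_ac)
    have "(\<lambda>N. (LINT t|lborel. f t * ?W t) - (LINT t|lborel. ?s N t * ?W t)) \<longlonglongrightarrow> 0"
    proof (rule Lim_null_comparison)
      show "\<forall>\<^sub>F N in sequentially. norm ((LINT t|lborel. f t * ?W t) - (LINT t|lborel. ?s N t * ?W t)) \<le> L2_norm (\<lambda>t. f t - ?s N t) * L2_norm ?W"
      proof (intro always_eventually allI)
        fix N
        have "(LINT t|lborel. f t * ?W t) - (LINT t|lborel. ?s N t * ?W t) = (LINT t|lborel. (f t - ?s N t) * ?W t)"
          unfolding left_diff_distrib by (intro Bochner_Integration.integral_diff[symmetric] sq_int_mult V s W)
        then show "norm ((LINT t|lborel. f t * ?W t) - (LINT t|lborel. ?s N t * ?W t)) \<le> L2_norm (\<lambda>t. f t - ?s N t) * L2_norm ?W"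
          using sq_int_mult(2)[OF sq_int_add_diff(2)[OF V(3) s] W] by simp
      qed
      show "(\<lambda>N. L2_norm (\<lambda>t. f t - ?s N t) * L2_norm ?W) \<longlonglongrightarrow> 0"
        by (rule tendsto_mult_left_zero[OF V(4)])
    qed
    from tendsto_diff[OF tendsto_const[of "LINT t|lborel. f t * ?W t"] this]
    have "(\<lambda>N. LINT t|lborel. ?s N t * ?W t) \<longlonglongrightarrow> (LINT t|lborel. f t * ?W t)" by simp
    then have "(\<lambda>N. norm ((LINT \<xi>|lborel. ?h N \<xi> * wave e a \<xi>) - (LINT \<xi>|lborel. ?h m \<xi> * wave e a \<xi>)))
       \<longlonglongrightarrow> norm (of_real (sqrt (2 * pi)) * (LINT t|lborel. f t * ?W t) - (LINT \<xi>|lborel. ?h m \<xi> * wave e a \<xi>))"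
      unfolding eq by (intro tendsto_intros)
    then show ?thesis
    proof (rule LIMSEQ_le_const2, intro exI[of _ m] allI impI)
      fix N assume N: "m \<le> N"
      let ?D = "?F N - ?F m"
      have hw: "integrable lborel (\<lambda>\<xi>. ?h n \<xi> * wave e a \<xi>)" for n
        by (rule Bochner_Integration.integrable_bound[OF g_expsum_L1(2)[of "?F n" c]])
           (auto simp: norm_mult norm_wave gauss_bounds intro!: mult_left_le)
      have "(LINT \<xi>|lborel. ?h N \<xi> * wave e a \<xi>) - (LINT \<xi>|lborel. ?h m \<xi> * wave e a \<xi>) = (LINT \<xi>|lborel. ?h N \<xi> * wave e a \<xi> - ?h m \<xi> * wave e a \<xi>)"
        by (intro Bochner_Integration.integral_diff[symmetric] hw)
      also have "\<dots> = (LINT \<xi>|lborel. g \<xi> * expsum x ?D c \<xi> * wave e a \<xi>)"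
        using N by (subst expsum_diff[symmetric]) (auto simp: algebra_simps)
      also have "norm \<dots> \<le> K * nrm ?D c"
      proof (rule integrable_bound_norm(2))
        have "(\<integral>\<^sup>+\<xi>. ennreal (norm (g \<xi> * expsum x ?D c \<xi> * wave e a \<xi>)) \<partial>lborel) \<le> (\<integral>\<^sup>+\<xi>. ennreal (norm (g \<xi> * expsum x ?D c \<xi>)) \<partial>lborel)"
          using gauss_bounds by (intro nn_integral_mono ennreal_leI) (auto simp: norm_mult norm_wave intro!: mult_left_le)
        also have "\<dots> \<le> ennreal (K * nrm ?D c)" by (rule g_expsum_L1) simp
        finally show "(\<integral>\<^sup>+\<xi>. ennreal (norm (g \<xi> * expsum x ?D c \<xi> * wave e a \<xi>)) \<partial>lborel) \<le> ennreal (K * nrm ?D c)" .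
      qed (use K in auto)
      also have "\<dots> \<le> K * tail c m"
        using K by (intro mult_left_mono nrm_diff_le_tail V N) auto
      finally show "norm ((LINT \<xi>|lborel. ?h N \<xi> * wave e a \<xi>) - (LINT \<xi>|lborel. ?h m \<xi> * wave e a \<xi>)) \<le> K * tail c m" .
    qed
  qed
  have close: "norm (cont_comb (?F m) c a - f a) \<le> K * tail c m" for m
  proof -
    have "(\<lambda>n. norm (of_real (sqrt (2 * pi)) * (LINT t|lborel. f t * of_real (normal_density 0 (1 / real (Suc n)) (t - a))) - (LINT \<xi>|lborel. ?h m \<xi> * wave (1 / real (Suc n)) a \<xi>)))
      \<longlonglongrightarrow> norm (of_real (sqrt (2 * pi)) * f a - of_real (sqrt (2 * pi)) * cont_comb (?F m) c a)"
      unfolding cont_comb_def by (intro tendsto_intros approx_identity wave_limit V cont g_expsum_L1) simp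
    then have "norm (of_real (sqrt (2 * pi)) * f a - of_real (sqrt (2 * pi)) * cont_comb (?F m) c a) \<le> K * tail c m"
      by (rule LIMSEQ_le_const2) (intro exI[of _ 0] allI impI regularized, simp)
    then have "sqrt (2 * pi) * norm (cont_comb (?F m) c a - f a) \<le> K * tail c m"
      by (simp add: norm_mult norm_minus_commute flip: right_diff_distrib)
    moreover have "1 * norm (cont_comb (?F m) c a - f a) \<le> sqrt (2 * pi) * norm (cont_comb (?F m) c a - f a)"
      using pi_ge_two by (intro mult_right_mono) auto
    ultimately show ?thesis by simp
  qed
  have "(\<lambda>m. K * tail c m) \<longlonglongrightarrow> 0"
    using tendsto_mult_right_zero[OF tail_tendsto[OF V(1)]] .
  from Lim_null_comparison[OF always_eventually[OF allI[OF close]] this]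
  show ?thesis by (rule LIM_zero_cancel)
qed

lemma samples_upper:
  assumes f: "in_V_repr \<psi> x c f"
  shows "l2_seq (\<lambda>j. f (x j))" "l2_norm (\<lambda>j. f (x j)) \<le> K * l2_norm c"
proof -
  have c: "l2_seq c" by (rule in_V_repr_properties[OF f])
  have *: "nrm G (\<lambda>j. f (x j)) \<le> K * l2_norm c" if G: "finite G" for G
  proof (rule LIMSEQ_le_const2)
    show "(\<lambda>m. nrm G (\<lambda>k. cont_comb {- int m..int m} c (x k))) \<longlonglongrightarrow> nrm G (\<lambda>j. f (x j))"
      unfolding L2_set_def by (intro tendsto_intros cont_comb_tendsto f)
    have "nrm G (\<lambda>k. cont_comb {- int m..int m} c (x k)) \<le> K * l2_norm c" for m
      using K by (intro order_trans[OF cont_comb_samples_upper[OF _ G]] mult_left_mono l2_partial_sums c) auto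
    then show "\<exists>N. \<forall>m\<ge>N. nrm G (\<lambda>k. cont_comb {- int m..int m} c (x k)) \<le> K * l2_norm c" by blast
  qed
  have "0 \<le> K * l2_norm c" using *[of "{}"] by simp
  with * show "l2_seq (\<lambda>j. f (x j))" "l2_norm (\<lambda>j. f (x j)) \<le> K * l2_norm c"
    by (auto intro: l2_norm_bound)
qed

text \<open>The finite lower bound involves the samples of the truncated combination, not of f. On
  the window [-m, m] the two differ by at most K times the tail, by the upper sample bound for the
  omitted terms, and this error vanishes in the limit.\<close>

lemma samples_lower:
  assumes f: "in_V_repr \<psi> x c f"
  shows "l2_norm c \<le> M^2 * sqrt (2 * pi) / d * l2_norm (\<lambda>j. f (x j))"
proof -
  have c: "l2_seq c" by (rule in_V_repr_properties[OF f])
  let ?F = "\<lambda>m. {- int m..int m}"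
  define C where "C = M^2 * sqrt (2 * pi) / d"
  have C: "0 < C" using M d by (simp add: C_def)
  have err: "nrm (?F m) (\<lambda>k. f (x k) - cont_comb (?F m) c (x k)) \<le> K * tail c m" for m
  proof (rule LIMSEQ_le_const2)
    show "(\<lambda>N. nrm (?F m) (\<lambda>k. cont_comb (?F N) c (x k) - cont_comb (?F m) c (x k))) \<longlonglongrightarrow> nrm (?F m) (\<lambda>k. f (x k) - cont_comb (?F m) c (x k))"
      unfolding L2_set_def by (intro tendsto_intros cont_comb_tendsto f)
    show "\<exists>N0. \<forall>N\<ge>N0. nrm (?F m) (\<lambda>k. cont_comb (?F N) c (x k) - cont_comb (?F m) c (x k)) \<le> K * tail c m"
    proof (intro exI[of _ m] allI impI)
      fix N assume N: "m \<le> N"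
      have "nrm (?F m) (\<lambda>k. cont_comb (?F N) c (x k) - cont_comb (?F m) c (x k)) = nrm (?F m) (\<lambda>k. cont_comb (?F N - ?F m) c (x k))"
        using N by (subst cont_comb_diff) auto
      also have "\<dots> \<le> K * nrm (?F N - ?F m) c" by (intro cont_comb_samples_upper) auto
      also have "\<dots> \<le> K * tail c m" using K by (intro mult_left_mono nrm_diff_le_tail c N) auto
      finally show "nrm (?F m) (\<lambda>k. cont_comb (?F N) c (x k) - cont_comb (?F m) c (x k)) \<le> K * tail c m" .
    qed
  qed
  have "nrm (?F m) c \<le> C * (l2_norm (\<lambda>j. f (x j)) + K * tail c m)" for m
  proof -
    have "nrm (?F m) (\<lambda>k. cont_comb (?F m) c (x k)) \<le> L2_set (\<lambda>k. norm (f (x k)) + norm (f (x k) - cont_comb (?F m) c (x k))) (?F m)"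
    proof (rule L2_set_mono)
      show "norm (cont_comb (?F m) c (x k)) \<le> norm (f (x k)) + norm (f (x k) - cont_comb (?F m) c (x k))" for k
        by (metis norm_minus_commute norm_triangle_sub)
    qed simp
    also have "\<dots> \<le> nrm (?F m) (\<lambda>k. f (x k)) + nrm (?F m) (\<lambda>k. f (x k) - cont_comb (?F m) c (x k))"
      by (rule L2_set_triangle_ineq)
    also have "\<dots> \<le> l2_norm (\<lambda>j. f (x j)) + K * tail c m"
      by (intro add_mono err l2_partial_sums(2)[OF samples_upper(1)[OF f]]) auto
    finally have "C * nrm (?F m) (\<lambda>k. cont_comb (?F m) c (x k)) \<le> C * (l2_norm (\<lambda>j. f (x j)) + K * tail c m)"
      using C by (intro mult_left_mono) auto
    then show ?thesis
      using cont_comb_samples_lower[of "?F m" c] by (simp add: C_def)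
  qed
  moreover have "(\<lambda>m. C * (l2_norm (\<lambda>j. f (x j)) + K * tail c m)) \<longlonglongrightarrow> C * (l2_norm (\<lambda>j. f (x j)) + K * 0)"
    by (intro tendsto_intros tail_tendsto c)
  ultimately have "l2_norm c \<le> C * (l2_norm (\<lambda>j. f (x j)) + K * 0)"
    using l2_partial_sums(1)[OF c] by (blast intro: LIMSEQ_le)
  then show ?thesis by (simp add: C_def)
qed

text \<open>Fatou along \<open>cont_comb\<close>, which converges to f at every point.\<close>

lemma L2_upper:
  assumes f: "in_V_repr \<psi> x c f"
  shows "L2_norm f \<le> sqrt (S * K) * l2_norm c"
proof -
  note V = in_V_repr_properties[OF f]
  note [measurable] = sq_int_measurable[OF V(3)]
  let ?F = "\<lambda>m. {- int m..int m}"
  have l0: "0 \<le> l2_norm c" using l2_partial_sums(2)[OF V(1), of "{}"] by simp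
  have [measurable]: "cont_comb (?F m) c \<in> borel_measurable borel" for m
    unfolding cont_comb_def by measurable
  have "(\<integral>\<^sup>+t. ennreal ((norm (f t))^2) \<partial>lborel) = (\<integral>\<^sup>+t. liminf (\<lambda>m. ennreal ((norm (cont_comb (?F m) c t))^2)) \<partial>lborel)"
  proof (intro nn_integral_cong)
    fix t
    have "(\<lambda>m. ennreal ((norm (cont_comb (?F m) c t))^2)) \<longlonglongrightarrow> ennreal ((norm (f t))^2)"
      by (intro tendsto_ennrealI tendsto_intros cont_comb_tendsto f)
    from lim_imp_Liminf[OF trivial_limit_sequentially this]
    show "ennreal ((norm (f t))^2) = liminf (\<lambda>m. ennreal ((norm (cont_comb (?F m) c t))^2))"
      by (rule sym)
  qed
  also have "\<dots> \<le> liminf (\<lambda>m. \<integral>\<^sup>+t. ennreal ((norm (cont_comb (?F m) c t))^2) \<partial>lborel)"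
    by (intro nn_integral_liminf) auto
  also have "\<dots> \<le> liminf (\<lambda>m::nat. ennreal (S * K * (l2_norm c)^2))"
  proof (intro Liminf_mono always_eventually allI)
    fix m
    have "S * K * (nrm (?F m) c)^2 \<le> S * K * (l2_norm c)^2"
      using S_pos K by (intro mult_left_mono power_mono l2_partial_sums V) auto
    with cont_comb_L2_upper[of "?F m" c] show "(\<integral>\<^sup>+t. ennreal ((norm (cont_comb (?F m) c t))^2) \<partial>lborel) \<le> ennreal (S * K * (l2_norm c)^2)"
      by (auto intro: order_trans ennreal_leI)
  qed
  also have "\<dots> = ennreal ((sqrt (S * K) * l2_norm c)^2)"
    using S_pos K by (simp add: Liminf_const power_mult_distrib)
  finally show ?thesis
    using S_pos K l0 by (intro sq_int_bound(2)) auto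
qed

lemma L2_lower:
  assumes f: "in_V_repr \<psi> x c f"
  shows "l2_norm c \<le> M / d * L2_norm f"
proof -
  note V = in_V_repr_properties[OF f]
  let ?F = "\<lambda>m. {- int m..int m}"
  let ?s = "\<lambda>N. shift_comb \<psi> x (?F N) c"
  have s: "sq_int (?s N)" for N by (rule sq_int_shift_comb[OF psi_sq_int]) simp
  have "nrm (?F m) c \<le> M / d * (L2_norm f + L2_norm (\<lambda>t. f t - ?s m t))" for m
  proof -
    have "L2_norm (?s m) = L2_norm (\<lambda>t. f t + (?s m t - f t))" by simp
    also have "\<dots> \<le> L2_norm f + L2_norm (\<lambda>t. ?s m t - f t)"
      by (intro L2_norm_triangle sq_int_add_diff V s)
    also have "L2_norm (\<lambda>t. ?s m t - f t) = L2_norm (\<lambda>t. f t - ?s m t)"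
      by (simp add: L2_norm_def norm_minus_commute)
    finally have "M / d * L2_norm (?s m) \<le> M / d * (L2_norm f + L2_norm (\<lambda>t. f t - ?s m t))"
      using M d by (intro mult_left_mono) auto
    then show ?thesis using shift_comb_lower[of "?F m" c] by simp
  qed
  moreover have "(\<lambda>m. M / d * (L2_norm f + L2_norm (\<lambda>t. f t - ?s m t))) \<longlonglongrightarrow> M / d * (L2_norm f + 0)"
    by (intro tendsto_intros V)
  ultimately have "l2_norm c \<le> M / d * (L2_norm f + 0)"
    using l2_partial_sums(1)[OF V(1)] by (blast intro: LIMSEQ_le)
  then show ?thesis by simp
qed

end

theorem theorem3:
  fixes \<psi> :: "real \<Rightarrow> complex" and x :: "int \<Rightarrow> real"
  assumes "cond_A1 \<psi>" and "cond_A2 \<psi>" and "complete_interpolating x"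
  shows "\<exists>c1 c2 c3 c4 :: real. c1 > 0 \<and> c2 > 0 \<and> c3 > 0 \<and> c4 > 0 \<and>
    (\<forall>c f. in_V_repr \<psi> x c f \<longrightarrow>
       sq_int f \<and> l2_seq (\<lambda>j. f (x j)) \<and>
       c1 * l2_norm c \<le> L2_norm f \<and> L2_norm f \<le> c2 * l2_norm c \<and>
       c3 * l2_norm (\<lambda>j. f (x j)) \<le> l2_norm c \<and> l2_norm c \<le> c4 * l2_norm (\<lambda>j. f (x j)))"
proof -
  obtain g where fg: "is_fourier_L2 \<psi> g" and am: "in_amalgam g" and inf: "(INF \<xi>\<in>torus. norm (g \<xi>)) > 0"
    using assms(2) unfolding cond_A2_def by blast
  have g: "sq_int g" using fg by (simp add: is_fourier_L2_def)
  note [measurable] = sq_int_measurable[OF g]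
  obtain M where M: "0 < M" "\<And>F c. finite F \<Longrightarrow> L2_set (\<lambda>j. norm (c j)) F \<le> M * L2_norm (expsum_T x F c)"
    using riesz_lower_bound[OF assms(3)] by blast
  obtain s where s: "0 < s" "\<And>j k. j \<noteq> k \<Longrightarrow> s \<le> \<bar>x j - x k\<bar>"
    using riesz_lower_separated[OF M] by blast
  obtain B where B: "0 < B" "\<And>F c. finite F \<Longrightarrow> (\<integral>\<^sup>+\<xi>. ennreal ((norm (expsum x F c \<xi>))^2) * indicator {-pi..pi} \<xi> \<partial>lborel)
      \<le> ennreal (B * (\<Sum>j\<in>F. (norm (c j))^2))"
    using bessel_upper_bound[of s x] s by blast
  obtain K where K: "0 < K" "\<And>F c. finite F \<Longrightarrow> (\<integral>\<^sup>+\<xi>. ennreal (norm (g \<xi>) * (norm (expsum x F c \<xi>))^2) \<partial>lborel) \<le> ennreal (K * (\<Sum>j\<in>F. (norm (c j))^2))"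
    using amalgam_energy[OF am _ B] by auto
  \<comment> \<open>A single exponential has modulus 1, so for it the energy bound reads: the
    integral of |g| is at most K.\<close>
  have g_int: "integrable lborel g"
    using K(2)[of "{0}" "\<lambda>_. 1"] K(1) by (intro integrable_bound_norm(1)[where a=K]) (auto simp: expsum_def)
  define d where "d = (INF \<xi>\<in>torus. norm (g \<xi>))"
  have g_ge: "d \<le> norm (g \<xi>)" if "\<xi> \<in> torus" for \<xi>
    unfolding d_def by (rule cINF_lower[OF _ that]) (auto intro!: bdd_belowI2[of _ 0])
  define S where "S = (\<Sum>\<^sub>\<infinity>k. amalgam_sup g k)"
  interpret interpolation_setting \<psi> g x M K S d
  proof
    show "AE \<xi> in lborel. g \<xi> = of_real (norm (g \<xi>))"
      using assms(1) by (intro fourier_pd_nonneg[OF _ fg g_int]) (simp add: cond_A1_def)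
    show "norm (g \<xi>) \<le> S" for \<xi> unfolding S_def by (rule in_amalgam_bounded[OF am])
    show "0 < d" using inf by (simp add: d_def)
  qed (fact fg g_int g_ge M K)+
  \<comment> \<open>Inverts the two estimates whose constants M / d and K stand on the opposite
    side.\<close>
  have "d / M * l2_norm c \<le> L2_norm f" "1 / K * l2_norm (\<lambda>j. f (x j)) \<le> l2_norm c"
    if "in_V_repr \<psi> x c f" for c f
    using L2_lower[OF that] samples_upper(2)[OF that] M d K by (simp_all add: field_simps)
  then show ?thesis
    using M d K S_pos L2_upper samples_upper(1) samples_lower in_V_repr_properties(3)
    by (intro exI[of _ "d / M"] exI[of _ "sqrt (S * K)"] exI[of _ "1 / K"] exI[of _ "M^2 * sqrt (2 * pi) / d"]) auto
qed

end
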